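(* Let $f,g$ satisfy Assumption (CPSO) and let $(x^*,u^* )\in\mathcal M\times\Omega$ be a point at which (RPD-ii) and (ND) hold. Let $\alpha\in[\underline\alpha,\overline\alpha]$ and $\beta\in[0,1]$ satisfy $-\frac1{1+2\beta}<\lambda_{\min}(D_x\mathcal A_\alpha(x^*,u^* ))$. Then $$\rho\big(D_z\mathcal A_{\alpha,\beta}(x^*,x^*,u^* )\,\Pi(x^*,x^* )\big)<1 .$$ If in addition (RPD-i) holds at $(x^*,u^* )$, let $\psi:U\to\mathcal M$ be the local solution map around $u^*$. Then, after possibly shrinking the neighbourhood $U$ of $u^*$, for all $u\in U$ the point $z:=(\psi(u),\psi(u))$ satisfies $z=\mathcal A_{\alpha,\beta}(z,u)$ and $$\begin{bmatrix}D\psi(u)\\ D\psi(u)\end{bmatrix}=\big(I-D_z\mathcal A_{\alpha,\beta}(z,u)\,\Pi(z)\big)^{-1}D_u\mathcal A_{\alpha,\beta}(z,u).$$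
   Context: $\mathcal X,\mathcal U$ are finite-dimensional Euclidean spaces, $\mathcal M\subset\mathcal X$ is a $C^2$-smooth embedded submanifold, $\Omega\subset\mathcal U$ is open. $T_x\mathcal M$, $N_x\mathcal M=(T_x\mathcal M)^\perp$ are the tangent and normal spaces, $\Pi(x)$, $\Pi^\perp(x)$ the orthogonal projections onto them; for $z=(x_1,x_2)\in\mathcal M\times\mathcal M$, $\Pi(z)=\Pi(x_1,x_2):=\mathrm{diag}(\Pi(x_1),\Pi(x_2))$. A linear operator defined on a subspace is extended to the whole space by composing it with the orthogonal projection onto that subspace; $\dagger$ is the pseudoinverse; $\rho$ is the spectral radius; $\lambda_{\min}$ is the smallest eigenvalue (of an operator with real eigenvalues). Riemannian derivatives: for a function $h$ whose restriction to $\mathcal M$ is $C^2$ with $C^2$ extension $\tilde h$ near $x\in\mathcal M$, $\nabla_{\mathcal M}h(x)=\Pi(x)\nabla\tilde h(x)$ and $\nabla^2_{\mathcal M}h(x)=\Pi(x)\nabla^2\tilde h(x)+\mathfrak W_x(\cdot,\Pi^\perp(x)\nabla\tilde h(x))$ on $T_x\mathcal M$, where for $w\in N_x\mathcal M$ the Weingarten map $\mathfrak W_x(\cdot,w):T_x\mathcal M\to T_x\mathcal M$ is $v\mapsto-\Pi(x)\,\mathrm dW[v]$ with $W$ any local extension of $w$ to a normal vector field on $\mathcal M$. For $h(x,u)$, $\nabla_{\mathcal M}h,\nabla^2_{\mathcal M}h$ are taken in $x$ with $u$ fixed, and $D_u$ is the partial derivative in $u$. Partial smoothness: a proper lower semicontinuous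 $h$ is partly smooth at $x\in\mathcal M$ relative to $\mathcal M$ if $h$ is (Clarke/Rockafellar–Wets) regular at all points near $x$ and $\partial h(x)\ne\emptyset$; $\mathcal M$ is a $C^2$ manifold and $h|_{\mathcal M}$ is $C^2$ around $x$; $N_x\mathcal M=\mathrm{par}\,\partial h(x)$ (subspace parallel to the affine hull); and $\partial h$ is continuous at $x$ relative to $\mathcal M$. It is partly smooth relative to $\mathcal M$ if this holds at every $x\in\mathcal M$. Assumption (CPSO): $f:\mathcal X\times\mathcal U\to\mathbb R$ is $C^2$; $g:\mathcal X\times\mathcal U\to\overline{\mathbb R}$ is partly smooth relative to $\mathcal M\times\Omega$; for each $u\in\Omega$, $f(\cdot,u)$ and $g(\cdot,u)$ are convex and $\nabla_xf(\cdot,u)$ is $L$-Lipschitz. $F:=f+g$; $\partial_x$ is the convex subdifferential in $x$. Conditions at a point $(x^*,u^* )\in\mathcal M\times\Omega$: (RPD-i) $\nabla^2_{\mathcal M}F(x^*,u^* )$ is positive definite on $T_{x^*}\mathcal M$; (RPD-ii) $\Pi(x^* )\nabla_x^2f(x^*,u^* )|_{T_{x^*}\mathcal M}$ is positive definite on $T_{x^*}\mathcal M$; (ND) $0\in\mathrm{ri}\,\partial_xF(x^*,u^* )$. Local solution map (known fact): if (CPSO) holds and (RPD-i), (ND) hold at $(x^*,u^* )$, there are an open neighbourhood $U\subset\Omega$ of $u^*$ and a $C^1$ map $\psi:U\to\mathcal M$ with $\psi(u^* )=x^*$ such that for all $u\in U$: $\psi(u)$ is the unique minimizer of $F(\cdot,u)|_{\mathcal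 M}$, (ND) and (RPD-i) hold at $(\psi(u),u)$, and $D\psi(u)=-\nabla^2_{\mathcal M}F(\psi(u),u)^\dagger D_u\nabla_{\mathcal M}F(\psi(u),u)$. Update maps: $0<\underline\alpha\le\overline\alpha<2/L$ are fixed; $P_{\alpha g}(w,u):=\arg\min_{x\in\mathcal X}\alpha g(x,u)+\tfrac12\|x-w\|^2$, $\mathcal A_\alpha(x,u):=P_{\alpha g}(x-\alpha\nabla_xf(x,u),u)$, and $\mathcal A_{\alpha,\beta}(x_1,x_2,u):=\big(\mathcal A_\alpha(x_1+\beta(x_1-x_2),u),\,x_1\big)$, with $z=(x_1,x_2)$. (Under (CPSO) and (ND) at $(x^*,u^* )$, for $\alpha\in(0,2/L)$ the map $\mathcal A_\alpha$ is $C^1$ near $(x^*,u^* )$ and $\mathcal A_{\alpha,\beta}$ is $C^1$ near $(x^*,x^*,u^* )$.) *)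

theory Defs
  imports "HOL-Analysis.Analysis"
begin

definition C1_on :: "('a::real_normed_vector \<Rightarrow> 'b::real_normed_vector) \<Rightarrow> 'a set \<Rightarrow> bool" where
  "C1_on f S \<longleftrightarrow> open S \<and> (\<exists>f'. (\<forall>x\<in>S. (f has_derivative blinfun_apply (f' x)) (at x)) \<and> continuous_on S f')"

definition C2_on :: "('a::real_normed_vector \<Rightarrow> 'b::real_normed_vector) \<Rightarrow> 'a set \<Rightarrow> bool" where
  "C2_on f S \<longleftrightarrow> open S \<and> (\<exists>f'. (\<forall>x\<in>S. (f has_derivative blinfun_apply (f' x)) (at x)) \<and> C1_on f' S)"

definition grad :: "('a::euclidean_space \<Rightarrow> real) \<Rightarrow> 'a \<Rightarrow> 'a" where
  "grad f x = (THE D. GDERIV f x :> D)"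

definition hess :: "('a::euclidean_space \<Rightarrow> real) \<Rightarrow> 'a \<Rightarrow> 'a \<Rightarrow> 'a" where
  "hess f x = frechet_derivative (grad f) (at x)"

text \<open>On a subspace the closest point is the orthogonal projection.\<close>

abbreviation proj :: "'a::euclidean_space set \<Rightarrow> 'a \<Rightarrow> 'a" where
  "proj S \<equiv> closest_point S"

definition pos_def_on :: "'a::euclidean_space set \<Rightarrow> ('a \<Rightarrow> 'a) \<Rightarrow> bool" where
  "pos_def_on S A \<longleftrightarrow> (\<forall>v\<in>S. v \<noteq> 0 \<longrightarrow> 0 < v \<bullet> A v)"

text \<open>The Moore--Penrose inverse, through the four Penrose equations.\<close>

definition pseudoinverse ::
    "('a::euclidean_space \<Rightarrow> 'b::euclidean_space) \<Rightarrow> 'b \<Rightarrow> 'a" where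
  "pseudoinverse A = (THE B. linear B \<and> A \<circ> B \<circ> A = A \<and> B \<circ> A \<circ> B = B \<and>
      adjoint (A \<circ> B) = A \<circ> B \<and> adjoint (B \<circ> A) = B \<circ> A)"

text \<open>\<open>l\<close> is an eigenvalue of the complexification of \<open>A\<close>, with eigenvector \<open>p + \<i> q\<close>.\<close>

definition complex_eigenvalue :: "('a::euclidean_space \<Rightarrow> 'a) \<Rightarrow> complex \<Rightarrow> bool" where
  "complex_eigenvalue A l \<longleftrightarrow> (\<exists>p q. (p, q) \<noteq> (0, 0) \<and>
      A p = Re l *\<^sub>R p - Im l *\<^sub>R q \<and> A q = Im l *\<^sub>R p + Re l *\<^sub>R q)"

text \<open>For linear operators the sets of eigenvalues below are finite, so supremum and infimum
  are a maximum and a minimum (for \<open>lambda_min\<close> provided there is a real eigenvalue).\<close>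

definition spectral_radius :: "('a::euclidean_space \<Rightarrow> 'a) \<Rightarrow> real" where
  "spectral_radius A = Sup (cmod ` {l. complex_eigenvalue A l})"

definition lambda_min :: "('a::euclidean_space \<Rightarrow> 'a) \<Rightarrow> real" where
  "lambda_min A = Inf {l. \<exists>v. v \<noteq> 0 \<and> A v = l *\<^sub>R v}"

text \<open>Around each of its points, \<open>M\<close> is mapped by a \<open>C\<^sup>2\<close> diffeomorphism of the ambient space
  onto a piece of a linear subspace of the fixed dimension \<open>d\<close>.\<close>

definition C2_submanifold :: "'a::euclidean_space set \<Rightarrow> bool" where
  "C2_submanifold M \<longleftrightarrow> (\<exists>d. \<forall>x\<in>M. \<exists>V \<phi> \<phi>' S.
      open V \<and> x \<in> V \<and> open (\<phi> ` V) \<and> C2_on \<phi> V \<and> C2_on \<phi>' (\<phi> ` V) \<and>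
      (\<forall>y\<in>V. \<phi>' (\<phi> y) = y) \<and>
      subspace (S :: 'a set) \<and> dim S = d \<and> \<phi> ` (M \<inter> V) = S \<inter> \<phi> ` V)"

definition tangent_space :: "'a::euclidean_space set \<Rightarrow> 'a \<Rightarrow> 'a set" where
  "tangent_space M x = {v. \<exists>\<gamma> e. 0 < e \<and> C1_on \<gamma> {-e<..<e} \<and> \<gamma> ` {-e<..<e} \<subseteq> M \<and>
      \<gamma> 0 = x \<and> (\<gamma> has_vector_derivative v) (at (0::real))}"

abbreviation normal_space :: "'a::euclidean_space set \<Rightarrow> 'a \<Rightarrow> 'a set" where
  "normal_space M x \<equiv> (tangent_space M x)\<^sup>\<bottom>"

definition C2_extension :: "('a::euclidean_space \<Rightarrow> ereal) \<Rightarrow> 'a set \<Rightarrow> 'a \<Rightarrow> ('a \<Rightarrow> real) \<Rightarrow> bool" where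
  "C2_extension h M x k \<longleftrightarrow> (\<exists>V. x \<in> V \<and> C2_on k V \<and> (\<forall>y\<in>M \<inter> V. h y = ereal (k y)))"

definition normal_extension :: "'a::euclidean_space set \<Rightarrow> 'a \<Rightarrow> 'a \<Rightarrow> ('a \<Rightarrow> 'a) \<Rightarrow> bool" where
  "normal_extension M x w W \<longleftrightarrow>
     (\<exists>V. x \<in> V \<and> C1_on W V \<and> (\<forall>y\<in>M \<inter> V. W y \<in> normal_space M y)) \<and> W x = w"

text \<open>The following three notions do not depend on the chosen extensions.\<close>

definition weingarten :: "'a::euclidean_space set \<Rightarrow> 'a \<Rightarrow> 'a \<Rightarrow> 'a \<Rightarrow> 'a" where
  "weingarten M x v w =
     - proj (tangent_space M x) (frechet_derivative (SOME W. normal_extension M x w W) (at x) v)"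

definition rgrad :: "'a::euclidean_space set \<Rightarrow> ('a \<Rightarrow> ereal) \<Rightarrow> 'a \<Rightarrow> 'a" where
  "rgrad M h x = proj (tangent_space M x) (grad (SOME k. C2_extension h M x k) x)"

text \<open>The Hessian is defined on the tangent space and extended to the whole space by precomposing
  with the orthogonal projection.\<close>

definition rhess :: "'a::euclidean_space set \<Rightarrow> ('a \<Rightarrow> ereal) \<Rightarrow> 'a \<Rightarrow> 'a \<Rightarrow> 'a" where
  "rhess M h x v =
    (let k = (SOME k. C2_extension h M x k); t = proj (tangent_space M x) v
     in proj (tangent_space M x) (hess k x t)
        + weingarten M x t (proj (normal_space M x) (grad k x)))"

definition epi :: "('a \<Rightarrow> ereal) \<Rightarrow> ('a \<times> real) set" where
  "epi h = {(x, r). h x \<le> ereal r}"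

definition proper_lsc :: "('a::euclidean_space \<Rightarrow> ereal) \<Rightarrow> bool" where
  "proper_lsc h \<longleftrightarrow> (\<forall>x. h x \<noteq> -\<infinity>) \<and> (\<exists>x. h x \<noteq> \<infinity>) \<and> (\<forall>x. h x \<le> Liminf (at x) h)"

definition convex_subdiff :: "('a::euclidean_space \<Rightarrow> ereal) \<Rightarrow> 'a \<Rightarrow> 'a set" where
  "convex_subdiff h x = {v. \<bar>h x\<bar> \<noteq> \<infinity> \<and> (\<forall>y. h x + ereal (v \<bullet> (y - x)) \<le> h y)}"

text \<open>Rockafellar--Wets: the condition in \<open>regular_subdiff\<close> reads
  \<open>h y \<ge> h x + v \<bullet> (y - x) + o (norm (y - x))\<close>; general subgradients are limits along
  \<open>h\<close>-attentive sequences; \<open>h\<close> is regular when its epigraph is Clarke regular.\<close>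

definition regular_subdiff :: "('a::euclidean_space \<Rightarrow> ereal) \<Rightarrow> 'a \<Rightarrow> 'a set" where
  "regular_subdiff h x = {v. \<bar>h x\<bar> \<noteq> \<infinity> \<and>
     (\<forall>e>0. \<forall>\<^sub>F y in nhds x. h x + ereal (v \<bullet> (y - x) - e * norm (y - x)) \<le> h y)}"

definition subdiff :: "('a::euclidean_space \<Rightarrow> ereal) \<Rightarrow> 'a \<Rightarrow> 'a set" where
  "subdiff h x = {v. \<bar>h x\<bar> \<noteq> \<infinity> \<and> (\<exists>X V. X \<longlonglongrightarrow> x \<and> (\<lambda>n. h (X n)) \<longlonglongrightarrow> h x \<and>
     (\<forall>n::nat. V n \<in> regular_subdiff h (X n)) \<and> V \<longlonglongrightarrow> v)}"

definition regular_normals :: "'a::euclidean_space set \<Rightarrow> 'a \<Rightarrow> 'a set" where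
  "regular_normals C x =
     {v. \<forall>e>0. \<forall>\<^sub>F y in nhds x. y \<in> C \<longrightarrow> v \<bullet> (y - x) \<le> e * norm (y - x)}"

definition normals :: "'a::euclidean_space set \<Rightarrow> 'a \<Rightarrow> 'a set" where
  "normals C x = {v. \<exists>X V. X \<longlonglongrightarrow> x \<and>
     (\<forall>n::nat. X n \<in> C \<and> V n \<in> regular_normals C (X n)) \<and> V \<longlonglongrightarrow> v}"

definition clarke_regular :: "'a::euclidean_space set \<Rightarrow> 'a \<Rightarrow> bool" where
  "clarke_regular C x \<longleftrightarrow> x \<in> C \<and> (\<exists>r>0. closed (C \<inter> cball x r)) \<and> normals C x = regular_normals C x"

definition subdiff_regular :: "('a::euclidean_space \<Rightarrow> ereal) \<Rightarrow> 'a \<Rightarrow> bool" where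
  "subdiff_regular h x \<longleftrightarrow> \<bar>h x\<bar> \<noteq> \<infinity> \<and> clarke_regular (epi h) (x, real_of_ereal (h x))"

definition par :: "'a::euclidean_space set \<Rightarrow> 'a set" where
  "par S = {a - b |a b. a \<in> affine hull S \<and> b \<in> affine hull S}"

text \<open>Painleve--Kuratowski continuity: outer and inner semicontinuity.\<close>

definition set_continuous_at_within ::
    "('a::euclidean_space \<Rightarrow> 'b::euclidean_space set) \<Rightarrow> 'a \<Rightarrow> 'a set \<Rightarrow> bool" where
  "set_continuous_at_within G x M \<longleftrightarrow> (\<forall>X. (\<forall>n::nat. X n \<in> M) \<and> X \<longlonglongrightarrow> x \<longrightarrow>
     (\<forall>V v. (\<forall>n. V n \<in> G (X n)) \<and> V \<longlonglongrightarrow> v \<longrightarrow> v \<in> G x) \<and>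
     (\<forall>v\<in>G x. \<exists>V. (\<forall>\<^sub>F n in sequentially. V n \<in> G (X n)) \<and> V \<longlonglongrightarrow> v))"

text \<open>Regularity is a property of points of the effective domain, so it is required at the nearby
  points at which \<open>h\<close> is finite.\<close>

definition partly_smooth_at :: "('a::euclidean_space \<Rightarrow> ereal) \<Rightarrow> 'a set \<Rightarrow> 'a \<Rightarrow> bool" where
  "partly_smooth_at h M x \<longleftrightarrow> proper_lsc h \<and> x \<in> M \<and>
     (\<forall>\<^sub>F y in nhds x. h y \<noteq> \<infinity> \<longrightarrow> subdiff_regular h y) \<and> subdiff h x \<noteq> {} \<and>
     C2_submanifold M \<and> (\<exists>k. C2_extension h M x k) \<and>
     normal_space M x = par (subdiff h x) \<and>
     set_continuous_at_within (subdiff h) x M"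

definition partly_smooth :: "('a::euclidean_space \<Rightarrow> ereal) \<Rightarrow> 'a set \<Rightarrow> bool" where
  "partly_smooth h M \<longleftrightarrow> (\<forall>x\<in>M. partly_smooth_at h M x)"

definition CPSO :: "('x::euclidean_space \<times> 'u::euclidean_space \<Rightarrow> real) \<Rightarrow> ('x \<times> 'u \<Rightarrow> ereal) \<Rightarrow>
    'x set \<Rightarrow> 'u set \<Rightarrow> real \<Rightarrow> bool" where
  "CPSO f g M \<Omega> L \<longleftrightarrow> C2_on f UNIV \<and> partly_smooth g (M \<times> \<Omega>) \<and>
     (\<forall>u\<in>\<Omega>. convex_on UNIV (\<lambda>x. f (x, u)) \<and> convex (epi (\<lambda>x. g (x, u))) \<and>
        L-lipschitz_on UNIV (grad (\<lambda>x. f (x, u))))"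

definition obj :: "('x \<times> 'u \<Rightarrow> real) \<Rightarrow> ('x \<times> 'u \<Rightarrow> ereal) \<Rightarrow> 'u \<Rightarrow> 'x \<Rightarrow> ereal" where
  "obj f g u x = ereal (f (x, u)) + g (x, u)"

definition RPD_i :: "('x::euclidean_space \<times> 'u::euclidean_space \<Rightarrow> real) \<Rightarrow> ('x \<times> 'u \<Rightarrow> ereal) \<Rightarrow>
    'x set \<Rightarrow> 'x \<Rightarrow> 'u \<Rightarrow> bool" where
  "RPD_i f g M x u \<longleftrightarrow> pos_def_on (tangent_space M x) (rhess M (obj f g u) x)"

definition RPD_ii :: "('x::euclidean_space \<times> 'u::euclidean_space \<Rightarrow> real) \<Rightarrow> 'x set \<Rightarrow> 'x \<Rightarrow> 'u \<Rightarrow> bool" where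
  "RPD_ii f M x u \<longleftrightarrow> pos_def_on (tangent_space M x)
     (\<lambda>v. proj (tangent_space M x) (hess (\<lambda>y. f (y, u)) x v))"

definition ND :: "('x::euclidean_space \<times> 'u::euclidean_space \<Rightarrow> real) \<Rightarrow> ('x \<times> 'u \<Rightarrow> ereal) \<Rightarrow>
    'x \<Rightarrow> 'u \<Rightarrow> bool" where
  "ND f g x u \<longleftrightarrow> 0 \<in> rel_interior (convex_subdiff (obj f g u) x)"

definition local_solution_map :: "('x::euclidean_space \<times> 'u::euclidean_space \<Rightarrow> real) \<Rightarrow>
    ('x \<times> 'u \<Rightarrow> ereal) \<Rightarrow> 'x set \<Rightarrow> 'u set \<Rightarrow> 'x \<Rightarrow> 'u \<Rightarrow> 'u set \<Rightarrow> ('u \<Rightarrow> 'x) \<Rightarrow> bool" where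
  "local_solution_map f g M \<Omega> x0 u0 U \<psi> \<longleftrightarrow>
     open U \<and> u0 \<in> U \<and> U \<subseteq> \<Omega> \<and> C1_on \<psi> U \<and> \<psi> ` U \<subseteq> M \<and> \<psi> u0 = x0 \<and>
     (\<forall>u\<in>U. (\<forall>x\<in>M. x \<noteq> \<psi> u \<longrightarrow> obj f g u (\<psi> u) < obj f g u x) \<and>
        ND f g (\<psi> u) u \<and> RPD_i f g M (\<psi> u) u \<and>
        frechet_derivative \<psi> (at u) =
          (\<lambda>w. - pseudoinverse (rhess M (obj f g u) (\<psi> u))
                 (frechet_derivative (\<lambda>u'. rgrad M (obj f g u') (\<psi> u)) (at u) w)))"

definition prox :: "real \<Rightarrow> ('x::euclidean_space \<times> 'u \<Rightarrow> ereal) \<Rightarrow> 'x \<Rightarrow> 'u \<Rightarrow> 'x" where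
  "prox \<alpha> g w u =
     arg_min (\<lambda>x. ereal \<alpha> * g (x, u) + ereal (1 / 2 * (norm (x - w))\<^sup>2)) (\<lambda>_. True)"

definition pg_map :: "('x::euclidean_space \<times> 'u::euclidean_space \<Rightarrow> real) \<Rightarrow> ('x \<times> 'u \<Rightarrow> ereal) \<Rightarrow>
    real \<Rightarrow> 'x \<Rightarrow> 'u \<Rightarrow> 'x" where
  "pg_map f g \<alpha> x u = prox \<alpha> g (x - \<alpha> *\<^sub>R grad (\<lambda>y. f (y, u)) x) u"

definition apg_map :: "('x::euclidean_space \<times> 'u::euclidean_space \<Rightarrow> real) \<Rightarrow> ('x \<times> 'u \<Rightarrow> ereal) \<Rightarrow>
    real \<Rightarrow> real \<Rightarrow> 'x \<times> 'x \<Rightarrow> 'u \<Rightarrow> 'x \<times> 'x" where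
  "apg_map f g \<alpha> \<beta> z u = (pg_map f g \<alpha> (fst z + \<beta> *\<^sub>R (fst z - snd z)) u, fst z)"

definition proj2 :: "'x::euclidean_space set \<Rightarrow> 'x \<times> 'x \<Rightarrow> 'x \<times> 'x \<Rightarrow> 'x \<times> 'x" where
  "proj2 M z w = (proj (tangent_space M (fst z)) (fst w), proj (tangent_space M (snd z)) (snd w))"

end

theory Submission
  imports Defs
begin

text \<open>Near a nondegenerate point the proximal map is the solution map of a smooth problem: in a chart
  of \<open>M\<close>, the critical points of \<open>p \<mapsto> \<alpha> g(p, u) + \<bar>p - w\<bar>\<^sup>2 / 2\<close> on \<open>M\<close> are given by the inverse function
  theorem, and a critical point \<open>p\<close> is the minimizer over the whole space because \<open>(w - p) / \<alpha>\<close> remains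
  a subgradient when its tangential part is right. Convexity alone yields the nonsingularity.

  The derivative \<open>P\<close> of the proximal map in \<open>w\<close> is symmetric, since \<open>w - prox w\<close> is the gradient of the Moreau
  envelope; it satisfies \<open>\<bar>P a\<bar>\<^sup>2 \<le> P a \<bullet> a\<close> by firm nonexpansiveness, and it takes values in the tangent space.
  These three properties place the eigenvalues \<open>\<mu>\<close> of \<open>P (I - \<alpha> H)\<close> on the real interval \<open>(-1, 1)\<close>. The
  eigenvalues \<open>l\<close> of the inertial map solve \<open>l\<^sup>2 = \<mu> ((1 + \<beta>) l - \<beta>)\<close>, or vanish. The derivative formula
  comes from differentiating the fixed point equation of \<open>\<psi>\<close>, whose derivative is tangent to \<open>M\<close>.\<close>

section \<open>Orthogonal projections and gradients\<close>

text \<open>The obstacle is a mismatch of subdifferentials: ND concerns the partial convex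
  subdifferential in \<open>x\<close>, partial smoothness the joint limiting subdifferential of
  \<open>g\<close>. Since \<Omega> is open, normals to \<open>M \<times> \<Omega>\<close> have zero
  u-part, so all joint subgradients at a point share their u-component; this rigidity makes their
  x-parts exactly the partial subgradients. The derivative of the proximal map, with its curvature
  terms, is never written out; inequalities between nearby values suffice. As differentiability is
  established at the base point alone, the results on symmetric second derivatives and on tangent
  curves ask for it at a single point. For the eigenvalues \<mu>, RPD-ii yields \<mu> < 1 and
  \<alpha> L < 2 yields \<mu> > -1. The threshold -1/(1 + 2 \<beta>) expresses that l^2 - \<mu> (1 +
  \<beta>) l + \<mu> \<beta> is positive at l = -1. Because \<open>spectral_radius\<close> is a
  supremum, an eigenvalue must also be exhibited.\<close>

lemma proj_in: "subspace S \<Longrightarrow> proj S x \<in> S"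
  by (intro closest_point_in_set closed_subspace) (auto dest: subspace_0)

lemma proj_orth:
  assumes "subspace S" "s \<in> S"
  shows "(x - proj S x) \<bullet> s = 0"
proof -
  have cl: "closed S" "convex S" "S \<noteq> {}"
    using assms closed_subspace subspace_imp_convex by auto
  have p: "proj S x + s \<in> S" "proj S x - s \<in> S"
    using assms proj_in[OF assms(1)] by (auto intro: subspace_add subspace_diff)
  have "(x - proj S x) \<bullet> ((proj S x + s) - proj S x) \<le> 0"
    "(x - proj S x) \<bullet> ((proj S x - s) - proj S x) \<le> 0"
    by (rule closest_point_dot; use cl p in auto)+
  then show ?thesis by simp
qed

lemma proj_unique:
  assumes "subspace S" "y \<in> S" "\<And>s. s \<in> S \<Longrightarrow> (x - y) \<bullet> s = 0"
  shows "proj S x = y"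
proof -
  have d: "y - proj S x \<in> S" using assms proj_in[OF assms(1)] by (auto intro: subspace_diff)
  have "(y - proj S x) \<bullet> (y - proj S x)
      = (x - proj S x) \<bullet> (y - proj S x) - (x - y) \<bullet> (y - proj S x)"
    by (simp add: inner_diff_left)
  also have "\<dots> = 0" using proj_orth[OF assms(1) d] assms(3)[OF d] by simp
  finally show ?thesis by simp
qed

lemma proj_linear:
  assumes "subspace S"
  shows "linear (proj S)"
proof (rule linearI)
  note o = proj_orth[OF assms]
  show "proj S (x + y) = proj S x + proj S y" for x y
    apply (rule proj_unique[OF assms])
     apply (simp add: assms proj_in subspace_add)
    using o[of _ x] o[of _ y] by (simp add: inner_diff_left inner_add_left algebra_simps)
  show "proj S (c *\<^sub>R x) = c *\<^sub>R proj S x" for c x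
    apply (rule proj_unique[OF assms])
     apply (simp add: assms proj_in subspace_scale)
    using o[of _ x] by (simp add: scaleR_right_diff_distrib[symmetric])
qed

lemma proj_inner:
  assumes "subspace S" "s \<in> S"
  shows "proj S x \<bullet> s = x \<bullet> s"
  using proj_orth[OF assms, of x] by (simp add: inner_diff_left)

lemma grad_eqI:
  assumes "GDERIV f x :> D"
  shows "grad f x = D"
  unfolding grad_def
proof (rule the_equality[where P="\<lambda>D. GDERIV f x :> D", OF assms])
  fix E assume "GDERIV f x :> E"
  then have "(\<lambda>h. h \<bullet> E) = (\<lambda>h. h \<bullet> D)"
    using assms has_derivative_unique unfolding gderiv_def by blast
  then show "E = D" by (metis vector_eq_rdot inner_commute)
qed

text \<open>The Riesz vector is spelled out in coordinates so that gradients assembled this way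
  inherit smoothness from the functional; the partial gradients and the equation
  \<open>\<Psi>\<close> of the proximal problem are built from it.\<close>

lemma linear_functional_representation:
  fixes D :: "'a::euclidean_space \<Rightarrow> real"
  assumes "linear D"
  shows "(\<Sum>b\<in>Basis. D b *\<^sub>R b) \<bullet> s = D s"
proof -
  interpret linear D by fact
  have "D s = D (\<Sum>b\<in>Basis. (s \<bullet> b) *\<^sub>R b)" by (simp add: euclidean_representation)
  also have "\<dots> = (\<Sum>b\<in>Basis. D b *\<^sub>R b) \<bullet> s"
    by (simp add: sum scale inner_sum_left) (simp add: inner_commute mult.commute)
  finally show ?thesis by simp
qed

lemma gderiv_of_has_derivative:
  fixes f :: "'a::euclidean_space \<Rightarrow> real"
  assumes "(f has_derivative D) (at x)"
  shows "GDERIV f x :> (\<Sum>b\<in>Basis. D b *\<^sub>R b)"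
proof -
  have "D h = h \<bullet> (\<Sum>b\<in>Basis. D b *\<^sub>R b)" for h
    using linear_functional_representation[OF has_derivative_linear[OF assms], of h]
    by (simp add: inner_commute)
  then show ?thesis using assms unfolding gderiv_def by (metis (no_types, lifting) ext)
qed

lemma gderiv_along_line:
  assumes "GDERIV e (y + s *\<^sub>R a) :> k"
  shows "((\<lambda>s. e (y + s *\<^sub>R a)) has_real_derivative (k \<bullet> a)) (at s)"
proof -
  have "((\<lambda>s. e (y + s *\<^sub>R a)) has_derivative (\<lambda>h. (h *\<^sub>R a) \<bullet> k)) (at s)"
    by (rule has_derivative_compose[where g=e and g'="\<lambda>h. h \<bullet> k"])
      (use assms in \<open>auto intro!: derivative_eq_intros simp: gderiv_def\<close>)
  then show ?thesis
    by (rule has_derivative_imp_has_field_derivative) (simp add: inner_commute)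
qed

text \<open>The second difference is the increment in direction \<open>a\<close> of a first
  difference in direction \<open>b\<close>. One application of the mean value theorem turns it into
  a difference of two gradients, which the first-order expansion of \<open>k\<close> at
  \<open>x\<close> evaluates.\<close>

lemma second_difference_estimate:
  fixes e :: "'a::euclidean_space \<Rightarrow> real"
  assumes e: "\<forall>\<^sub>F y in nhds x. GDERIV e y :> k y" and K: "(k has_derivative K) (at x)"
    and eps: "0 < \<epsilon>"
  shows "\<exists>d>0. \<forall>t. 0 < t \<and> t < d \<longrightarrow>
    \<bar>e (x + t *\<^sub>R a + t *\<^sub>R b) - e (x + t *\<^sub>R a) - e (x + t *\<^sub>R b) + e x - t\<^sup>2 * (K b \<bullet> a)\<bar> \<le> \<epsilon> * t\<^sup>2"
proof -
  \<comment> \<open>\<open>C\<close> dominates \<open>(2 * norm a + norm b) * norm a\<close>, the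
    factor collected at the end; the added ones keep it positive for the division.\<close>
  define C where "C = (2 * norm a + norm b + 1) * (norm a + 1)"
  have C: "0 < C" unfolding C_def by (intro mult_pos_pos) (auto intro: add_nonneg_pos)
  interpret K: bounded_linear K using K by (rule has_derivative_bounded_linear)
  obtain d1 where d1: "d1 > 0" "\<And>y. dist y x < d1 \<Longrightarrow> GDERIV e y :> k y"
    using e unfolding eventually_nhds_metric by blast
  obtain d2 where d2: "d2 > 0"
    "\<And>y. norm (y - x) < d2 \<Longrightarrow> norm (k y - k x - K (y - x)) \<le> (\<epsilon> / C) * norm (y - x)"
    using K eps C unfolding has_derivative_at_alt by (meson divide_pos_pos)
  \<comment> \<open>Strictly above \<open>norm a + norm b\<close>, so that all points
    \<open>x + s a + r b\<close> with \<open>s\<close> and \<open>r\<close> between 0 and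
    \<open>t\<close> stay within \<open>t * B\<close> of \<open>x\<close>.\<close>
  define B where "B = 2 * norm a + norm b + 1"
  have B: "0 < B" unfolding B_def by (auto intro: add_nonneg_pos)
  define d where "d = min d1 d2 / B"
  have "d > 0" using d1 d2 B by (simp add: d_def)
  moreover have "\<bar>e (x + t *\<^sub>R a + t *\<^sub>R b) - e (x + t *\<^sub>R a) - e (x + t *\<^sub>R b) + e x - t\<^sup>2 * (K b \<bullet> a)\<bar> \<le> \<epsilon> * t\<^sup>2"
    if t: "0 < t" "t < d" for t
  proof -
    have tB: "t * B < d1" "t * B < d2" using t B by (auto simp: d_def field_simps)
    have nrm: "norm (s *\<^sub>R a + r *\<^sub>R b) \<le> t * (norm a + norm b)" if "0 \<le> s" "s \<le> t" "0 \<le> r" "r \<le> t" for s r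
      using norm_triangle_le[of "s *\<^sub>R a" "r *\<^sub>R b" "t * (norm a + norm b)"] that
        mult_right_mono[of s t "norm a"] mult_right_mono[of r t "norm b"]
      by (simp add: distrib_left)
    have le: "t * (norm a + norm b) < t * B" "t * norm a < t * B"
      using t(1) norm_ge_zero[of a] norm_ge_zero[of b] unfolding B_def
      by (intro mult_strict_left_mono; linarith)+
    have le': "norm (s *\<^sub>R a + r *\<^sub>R b) < t * B" if "0 \<le> s" "s \<le> t" "0 \<le> r" "r \<le> t" for s r
      using nrm[OF that] le by simp
    define \<theta> where "\<theta> s = e (x + t *\<^sub>R b + s *\<^sub>R a) - e (x + s *\<^sub>R a)" for s
    have der: "(\<theta> has_real_derivative (k (x + t *\<^sub>R b + s *\<^sub>R a) - k (x + s *\<^sub>R a)) \<bullet> a) (at s)"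
      if "0 \<le> s" "s \<le> t" for s
    proof -
      have "dist (x + t *\<^sub>R b + s *\<^sub>R a) x < d1" "dist (x + s *\<^sub>R a) x < d1"
        using le'[OF that, of t] le'[OF that, of 0] t tB by (auto simp: dist_norm algebra_simps)
      then show ?thesis unfolding \<theta>_def inner_diff_left
        by (intro DERIV_diff gderiv_along_line d1)
    qed
    obtain s where s: "0 < s" "s < t" "\<theta> t - \<theta> 0 = (t - 0) * ((k (x + t *\<^sub>R b + s *\<^sub>R a) - k (x + s *\<^sub>R a)) \<bullet> a)"
      using MVT2[of 0 t \<theta> "\<lambda>s. (k (x + t *\<^sub>R b + s *\<^sub>R a) - k (x + s *\<^sub>R a)) \<bullet> a"] t der by auto
    define y1 where "y1 = x + t *\<^sub>R b + s *\<^sub>R a"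
    define y2 where "y2 = x + s *\<^sub>R a"
    have n1: "norm (y1 - x) \<le> t * (norm a + norm b)" "norm (y2 - x) \<le> t * norm a"
      using nrm[of s t] s t by (auto simp: y1_def y2_def algebra_simps mult_right_mono)
    have r1: "norm (k y1 - k x - K (y1 - x)) \<le> (\<epsilon> / C) * (t * (norm a + norm b))"
      using d2(2)[of y1] n1 le tB mult_left_mono[OF n1(1), of "\<epsilon>/C"] eps C by fastforce
    have r2: "norm (k y2 - k x - K (y2 - x)) \<le> (\<epsilon> / C) * (t * norm a)"
      using d2(2)[of y2] n1 le tB mult_left_mono[OF n1(2), of "\<epsilon>/C"] eps C by fastforce
    have Kd: "K (y1 - x) - K (y2 - x) = t *\<^sub>R K b"
      by (simp add: y1_def y2_def K.diff[symmetric] K.scaleR[symmetric])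
    have "norm (k y1 - k y2 - t *\<^sub>R K b) = norm ((k y1 - k x - K (y1 - x)) - (k y2 - k x - K (y2 - x)))"
      using Kd by (simp add: algebra_simps)
    also have "\<dots> \<le> (\<epsilon> / C) * (t * (norm a + norm b)) + (\<epsilon> / C) * (t * norm a)"
      using norm_triangle_le_diff[OF add_mono[OF r1 r2]] by simp
    also have "\<dots> = (\<epsilon> / C) * (t * (2 * norm a + norm b))" by (simp add: algebra_simps)
    finally have r: "norm (k y1 - k y2 - t *\<^sub>R K b) \<le> (\<epsilon> / C) * (t * (2 * norm a + norm b))" .
    have "\<bar>\<theta> t - \<theta> 0 - t\<^sup>2 * (K b \<bullet> a)\<bar> = t * \<bar>(k y1 - k y2 - t *\<^sub>R K b) \<bullet> a\<bar>"
    proof -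
      have "\<theta> t - \<theta> 0 - t\<^sup>2 * (K b \<bullet> a) = t * ((k y1 - k y2 - t *\<^sub>R K b) \<bullet> a)"
        unfolding s(3) y1_def[symmetric] y2_def[symmetric]
        by (simp add: inner_diff_left power2_eq_square algebra_simps)
      then show ?thesis using t by (simp add: abs_mult)
    qed
    also have "\<dots> \<le> t * (((\<epsilon> / C) * (t * (2 * norm a + norm b))) * norm a)"
      using t mult_right_mono[OF r, of "norm a"] Cauchy_Schwarz_ineq2[of "k y1 - k y2 - t *\<^sub>R K b" a]
      by (intro mult_left_mono) auto
    also have "\<dots> = (\<epsilon> / C * t\<^sup>2) * ((2 * norm a + norm b) * norm a)"
      by (simp add: power2_eq_square algebra_simps)
    also have "\<dots> \<le> (\<epsilon> / C * t\<^sup>2) * C"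
      unfolding C_def using eps C[unfolded C_def] by (intro mult_left_mono mult_mono) auto
    also have "\<dots> = \<epsilon> * t\<^sup>2" using C by simp
    finally show ?thesis by (simp add: \<theta>_def algebra_simps)
  qed
  ultimately show ?thesis by blast
qed

text \<open>The second difference is unchanged when \<open>a\<close> and \<open>b\<close> are
  exchanged, and after division by \<open>t\<^sup>2\<close> it tends to both sides.
  Differentiability of the gradient at one point matters for the Moreau envelope, where no more is
  known.\<close>

lemma gradient_derivative_symmetric:
  fixes e :: "'a::euclidean_space \<Rightarrow> real"
  assumes e: "\<forall>\<^sub>F y in nhds x. GDERIV e y :> k y" and K: "(k has_derivative K) (at x)"
  shows "K a \<bullet> b = a \<bullet> K b"
proof -
  have "\<bar>K b \<bullet> a - K a \<bullet> b\<bar> \<le> \<epsilon>" if eps: "0 < \<epsilon>" for \<epsilon>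
  proof -
    let ?D = "\<lambda>t a b. e (x + t *\<^sub>R a + t *\<^sub>R b) - e (x + t *\<^sub>R a) - e (x + t *\<^sub>R b) + e x"
    obtain d1 where d1: "d1 > 0" "\<And>t. 0 < t \<Longrightarrow> t < d1 \<Longrightarrow> \<bar>?D t a b - t\<^sup>2 * (K b \<bullet> a)\<bar> \<le> \<epsilon>/2 * t\<^sup>2"
      using second_difference_estimate[OF e K, of "\<epsilon>/2" a b] eps by auto
    obtain d2 where d2: "d2 > 0" "\<And>t. 0 < t \<Longrightarrow> t < d2 \<Longrightarrow> \<bar>?D t b a - t\<^sup>2 * (K a \<bullet> b)\<bar> \<le> \<epsilon>/2 * t\<^sup>2"
      using second_difference_estimate[OF e K, of "\<epsilon>/2" b a] eps by auto
    define t where "t = min d1 d2 / 2"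
    have t: "0 < t" "t < d1" "t < d2" using d1 d2 by (auto simp: t_def)
    have sym: "?D t a b = ?D t b a" by (simp add: algebra_simps)
    have "\<bar>t\<^sup>2 * (K b \<bullet> a) - t\<^sup>2 * (K a \<bullet> b)\<bar> \<le> \<epsilon> * t\<^sup>2"
      using d1(2)[OF t(1,2)] d2(2)[OF t(1,3)] unfolding sym by linarith
    moreover have "\<bar>t\<^sup>2 * (K b \<bullet> a) - t\<^sup>2 * (K a \<bullet> b)\<bar> = \<bar>K b \<bullet> a - K a \<bullet> b\<bar> * t\<^sup>2"
      unfolding right_diff_distrib[symmetric] abs_mult by simp
    ultimately show ?thesis using t by simp
  qed
  from this[of "\<bar>K b \<bullet> a - K a \<bullet> b\<bar> / 2"] have "K b \<bullet> a = K a \<bullet> b"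
    by (cases "K b \<bullet> a = K a \<bullet> b") auto
  then show ?thesis by (simp add: inner_commute[of a])
qed

section \<open>Charts and tangent spaces\<close>

lemma C1_onI:
  assumes "open S" "\<And>x. x \<in> S \<Longrightarrow> (f has_derivative blinfun_apply (f' x)) (at x)" "continuous_on S f'"
  shows "C1_on f S"
  unfolding C1_on_def using assms by (intro conjI exI[of _ f'] ballI)

lemma C1_onD:
  assumes "C1_on f S"
  shows "open S" "x \<in> S \<Longrightarrow> f differentiable (at x)" "continuous_on S f"
proof -
  show "open S" and *: "x \<in> S \<Longrightarrow> f differentiable (at x)" for x
    using assms unfolding C1_on_def differentiable_def by auto
  show "continuous_on S f"
    by (intro continuous_at_imp_continuous_on ballI differentiable_imp_continuous_within *)
qed

text \<open>In finite dimension, continuity of the derivative in operator norm follows from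
  continuity of its value at each vector, so products and compositions can be treated vector by
  vector.\<close>

lemma C1_onI_euclidean:
  fixes f :: "'a::euclidean_space \<Rightarrow> 'b::real_normed_vector"
  assumes "open S" and D: "\<And>x. x \<in> S \<Longrightarrow> (f has_derivative D x) (at x)"
    and cont: "\<And>h. continuous_on S (\<lambda>x. D x h)"
  shows "C1_on f S"
proof (rule C1_onI[OF assms(1)])
  have eq: "blinfun_apply (Blinfun (D x)) = D x" if "x \<in> S" for x
    using D[OF that] has_derivative_bounded_linear bounded_linear_Blinfun_apply by blast
  show "(f has_derivative blinfun_apply (Blinfun (D x))) (at x)" if "x \<in> S" for x
    using D[OF that] eq[OF that] by simp
  show "continuous_on S (\<lambda>x. Blinfun (D x))"
    by (rule continuous_on_blinfun_componentwise) (simp add: eq cont cong: continuous_on_cong)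
qed

lemma C1_onE:
  assumes "C1_on f S"
  obtains f' where "\<And>x. x \<in> S \<Longrightarrow> (f has_derivative blinfun_apply (f' x)) (at x)" "continuous_on S f'"
    "\<And>h. continuous_on S (\<lambda>x. blinfun_apply (f' x) h)"
proof -
  obtain f' where f': "\<forall>x\<in>S. (f has_derivative blinfun_apply (f' x)) (at x)" "continuous_on S f'"
    using assms unfolding C1_on_def by (elim conjE exE)
  show ?thesis
  proof (rule that[of f'])
    show "continuous_on S (\<lambda>x. blinfun_apply (f' x) h)" for h
      by (intro bounded_bilinear.continuous_on[OF bounded_bilinear_blinfun_apply] f'(2) continuous_on_const)
  qed (use f' in auto)
qed

lemma C1_on_linear:
  fixes f :: "'a::euclidean_space \<Rightarrow> 'b::real_normed_vector"
  assumes "bounded_linear f" "open S"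
  shows "C1_on f S"
  by (rule C1_onI_euclidean[OF assms(2), of f "\<lambda>_. f"])
    (auto intro: bounded_linear_imp_has_derivative assms)

lemma C1_on_const:
  fixes S :: "'a::euclidean_space set"
  assumes "open S"
  shows "C1_on (\<lambda>_. c) S"
  by (rule C1_onI_euclidean[OF assms, of _ "\<lambda>_ _. 0"]) auto

lemma C1_on_Pair:
  fixes S :: "'a::euclidean_space set"
  assumes "C1_on f S" "C1_on g S"
  shows "C1_on (\<lambda>x. (f x, g x)) S"
proof -
  obtain f' where f': "\<And>x. x \<in> S \<Longrightarrow> (f has_derivative blinfun_apply (f' x)) (at x)"
    "\<And>h. continuous_on S (\<lambda>x. blinfun_apply (f' x) h)"
    by (rule C1_onE[OF assms(1)]) (rule that; assumption)
  obtain g' where g': "\<And>x. x \<in> S \<Longrightarrow> (g has_derivative blinfun_apply (g' x)) (at x)"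
    "\<And>h. continuous_on S (\<lambda>x. blinfun_apply (g' x) h)"
    by (rule C1_onE[OF assms(2)]) (rule that; assumption)
  show ?thesis
  proof (rule C1_onI_euclidean[where D="\<lambda>x h. (f' x h, g' x h)", OF C1_onD(1)[OF assms(1)]])
    show "((\<lambda>x. (f x, g x)) has_derivative (\<lambda>h. (f' x h, g' x h))) (at x)" if "x \<in> S" for x
      by (rule has_derivative_Pair[OF f'(1)[OF that] g'(1)[OF that]])
    show "continuous_on S (\<lambda>x. (f' x h, g' x h))" for h by (rule continuous_on_Pair[OF f'(2) g'(2)])
  qed
qed

lemma C1_on_bilinear:
  fixes S :: "'a::euclidean_space set"
  assumes b: "bounded_bilinear pr" and fg: "C1_on f S" "C1_on g S"
  shows "C1_on (\<lambda>x. pr (f x) (g x)) S"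
proof -
  obtain f' where f': "\<And>x. x \<in> S \<Longrightarrow> (f has_derivative blinfun_apply (f' x)) (at x)"
    "\<And>h. continuous_on S (\<lambda>x. blinfun_apply (f' x) h)"
    by (rule C1_onE[OF fg(1)]) (rule that; assumption)
  obtain g' where g': "\<And>x. x \<in> S \<Longrightarrow> (g has_derivative blinfun_apply (g' x)) (at x)"
    "\<And>h. continuous_on S (\<lambda>x. blinfun_apply (g' x) h)"
    by (rule C1_onE[OF fg(2)]) (rule that; assumption)
  show ?thesis
  proof (rule C1_onI_euclidean[where D="\<lambda>x h. pr (f x) (g' x h) + pr (f' x h) (g x)", OF C1_onD(1)[OF fg(1)]])
    show "((\<lambda>x. pr (f x) (g x)) has_derivative (\<lambda>h. pr (f x) (g' x h) + pr (f' x h) (g x))) (at x)" if "x \<in> S" for x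
      by (rule bounded_bilinear.FDERIV[OF b f'(1)[OF that] g'(1)[OF that]])
    show "continuous_on S (\<lambda>x. pr (f x) (g' x h) + pr (f' x h) (g x))" for h
      by (intro continuous_on_add bounded_bilinear.continuous_on[OF b] f' g' C1_onD(3)[OF fg(1)] C1_onD(3)[OF fg(2)])
  qed
qed

lemma C1_on_compose:
  fixes S :: "'a::euclidean_space set" and T :: "'b::euclidean_space set"
  assumes "C1_on f S" "C1_on g T" "\<And>x. x \<in> S \<Longrightarrow> f x \<in> T"
  shows "C1_on (\<lambda>x. g (f x)) S"
proof -
  obtain f' where f': "\<And>x. x \<in> S \<Longrightarrow> (f has_derivative blinfun_apply (f' x)) (at x)"
    "\<And>h. continuous_on S (\<lambda>x. blinfun_apply (f' x) h)"
    by (rule C1_onE[OF assms(1)]) (rule that; assumption)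
  obtain g' where g': "\<And>x. x \<in> T \<Longrightarrow> (g has_derivative blinfun_apply (g' x)) (at x)"
    "continuous_on T g'" by (rule C1_onE[OF assms(2)]) (rule that; assumption)
  show ?thesis
  proof (rule C1_onI_euclidean[where D="\<lambda>x h. g' (f x) (f' x h)"])
    show "continuous_on S (\<lambda>x. g' (f x) (f' x h))" for h
      by (intro bounded_bilinear.continuous_on[OF bounded_bilinear_blinfun_apply] f'
          continuous_on_compose2[OF g'(2)] C1_onD(3)[OF assms(1)]) (use assms(3) in auto)
    show "((\<lambda>x. g (f x)) has_derivative (\<lambda>h. g' (f x) (f' x h))) (at x)" if "x \<in> S" for x
      by (rule has_derivative_compose[OF f'(1)[OF that] g'(1)[OF assms(3)[OF that]]])
  qed (rule C1_onD(1)[OF assms(1)])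
qed

lemma C1_on_add:
  fixes f g :: "'a::euclidean_space \<Rightarrow> 'b::euclidean_space"
  assumes "C1_on f S" "C1_on g S"
  shows "C1_on (\<lambda>x. f x + g x) S"
  using C1_on_compose[OF C1_on_Pair[OF assms] C1_on_linear[OF _ open_UNIV, of "\<lambda>z. fst z + snd z"]]
  by (simp add: bounded_linear_add bounded_linear_fst bounded_linear_snd)

lemma C1_on_sum:
  fixes f :: "'i \<Rightarrow> 'a::euclidean_space \<Rightarrow> 'b::euclidean_space"
  assumes "finite I" "open S" "\<And>i. i \<in> I \<Longrightarrow> C1_on (f i) S"
  shows "C1_on (\<lambda>x. \<Sum>i\<in>I. f i x) S"
  using assms(1,3) by (induction I rule: finite_induct) (simp_all add: C1_on_const C1_on_add assms(2))

lemma C1_on_affine: "open I \<Longrightarrow> C1_on (\<lambda>t::real. c + t *\<^sub>R v :: 'a::euclidean_space) I"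
  by (intro C1_on_add C1_on_const C1_on_linear bounded_linear_scaleR_left)

lemma has_derivative_line: "((\<lambda>t. x + t *\<^sub>R v) has_derivative (\<lambda>s. s *\<^sub>R v)) (at t)"
  by (auto intro!: derivative_eq_intros)

lemma has_derivative_insert_left: "((\<lambda>x. (x, c)) has_derivative (\<lambda>h. (h, 0))) (at x)"
  and has_derivative_insert_right: "((\<lambda>y. (c, y)) has_derivative (\<lambda>h. (0, h))) (at y)"
  by (intro has_derivative_Pair has_derivative_ident has_derivative_const)+

lemma open_line_segment:
  fixes x v :: "'a::real_normed_vector"
  assumes "open S" "x \<in> S"
  obtains e where "0 < e" "\<And>t. t \<in> {-e<..<e} \<Longrightarrow> x + t *\<^sub>R v \<in> S"
proof -
  have "((\<lambda>t. x + t *\<^sub>R v) \<longlongrightarrow> x + 0 *\<^sub>R v) (nhds 0)"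
    by (intro tendsto_intros filterlim_ident)
  then have "\<forall>\<^sub>F t in nhds 0. x + t *\<^sub>R v \<in> S" using assms by (simp add: topological_tendstoD)
  then obtain e where "e > 0" "\<And>t. dist t 0 < e \<Longrightarrow> x + t *\<^sub>R v \<in> S"
    unfolding eventually_nhds_metric by blast
  then show ?thesis using that[of e] by (simp add: abs_less_iff)
qed

section \<open>Tangent vectors through curves and charts\<close>

lemma tangent_spaceI:
  fixes e :: real
  assumes "0 < e" "C1_on \<gamma> {-e<..<e}" "\<And>t. t \<in> {-e<..<e} \<Longrightarrow> \<gamma> t \<in> M" "\<gamma> 0 = x"
    "(\<gamma> has_vector_derivative v) (at 0)"
  shows "v \<in> tangent_space M x"
  unfolding tangent_space_def mem_Collect_eq using assms
  by (intro exI[of _ \<gamma>] exI[of _ e] conjI image_subsetI)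

lemma tangent_space_differentiable:
  assumes "v \<in> tangent_space M x"
  obtains \<gamma> where "\<gamma> 0 = x" "\<forall>\<^sub>F t in nhds 0. \<gamma> t \<in> M" "(\<gamma> has_vector_derivative v) (at (0::real))"
proof -
  obtain \<gamma> e where "0 < e" "\<gamma> ` {-e<..<e} \<subseteq> M" "\<gamma> 0 = x" "(\<gamma> has_vector_derivative v) (at (0::real))"
    using assms unfolding tangent_space_def by auto
  moreover from this have "\<forall>\<^sub>F t in nhds 0. \<gamma> t \<in> M"
    using eventually_nhds[of "\<lambda>t. \<gamma> t \<in> M" 0] by (auto intro!: exI[of _ "{-e<..<e}"])
  ultimately show ?thesis using that by blast
qed

text \<open>\<open>A\<close> and \<open>B\<close> are the derivative fields of the chart and of its
  inverse. Keeping them explicit presents each tangent space as the image of the fixed subspace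
  \<open>S\<close> under \<open>B\<close> and as its preimage under \<open>A\<close>, which makes
  limits of tangent and normal vectors tractable.\<close>

locale chart =
  fixes M V :: "'a::euclidean_space set" and \<phi> \<phi>' :: "'a \<Rightarrow> 'a" and S :: "'a set"
    and A B :: "'a \<Rightarrow> 'a \<Rightarrow>\<^sub>L 'a"
  assumes V: "open V" and W: "open (\<phi> ` V)" and inv: "y \<in> V \<Longrightarrow> \<phi>' (\<phi> y) = y"
    and S: "subspace S" and image: "\<phi> ` (M \<inter> V) = S \<inter> \<phi> ` V"
    and A: "y \<in> V \<Longrightarrow> (\<phi> has_derivative blinfun_apply (A y)) (at y)" and A1: "C1_on A V"
    and B: "w \<in> \<phi> ` V \<Longrightarrow> (\<phi>' has_derivative blinfun_apply (B w)) (at w)" and B1: "C1_on B (\<phi> ` V)"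

lemma chart_exists:
  assumes "C2_submanifold M" "x \<in> M"
  obtains V \<phi> \<phi>' S A B where "chart M V \<phi> \<phi>' S A B" "x \<in> V"
proof -
  obtain d where "\<forall>x\<in>M. \<exists>V \<phi> \<phi>' S.
      open V \<and> x \<in> V \<and> open (\<phi> ` V) \<and> C2_on \<phi> V \<and> C2_on \<phi>' (\<phi> ` V) \<and>
      (\<forall>y\<in>V. \<phi>' (\<phi> y) = y) \<and>
      subspace (S :: 'a set) \<and> dim S = d \<and> \<phi> ` (M \<inter> V) = S \<inter> \<phi> ` V"
    using assms unfolding C2_submanifold_def by auto
  from bspec[OF this assms(2)] obtain V \<phi> \<phi>' S where *: "open V" "x \<in> V" "open (\<phi> ` V)" "C2_on \<phi> V" "C2_on \<phi>' (\<phi> ` V)"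
      "(\<forall>y\<in>V. \<phi>' (\<phi> y) = y)" "subspace (S :: 'a set)" "\<phi> ` (M \<inter> V) = S \<inter> \<phi> ` V"
    by (elim exE conjE) (rule that; assumption)
  obtain A where hA: "\<And>y. y \<in> V \<Longrightarrow> (\<phi> has_derivative blinfun_apply (A y)) (at y)" and hA1: "C1_on A V"
    using *(4) unfolding C2_on_def by auto
  obtain B where hB: "\<And>w. w \<in> \<phi> ` V \<Longrightarrow> (\<phi>' has_derivative blinfun_apply (B w)) (at w)" and hB1: "C1_on B (\<phi> ` V)"
    using *(5) unfolding C2_on_def by auto
  have "chart M V \<phi> \<phi>' S A B"
    by (rule chart.intro; (rule *(1) *(3) bspec[OF *(6)] *(7) *(8) hA hB hA1 hB1)?; assumption?)
  then show ?thesis using that *(2) by blast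
qed

context chart
begin

lemma in_M_iff: "y \<in> V \<Longrightarrow> y \<in> M \<longleftrightarrow> \<phi> y \<in> S"
  using image inv by (smt (verit, ccfv_threshold) IntD1 IntD2 IntI image_iff)

lemma inv': "w \<in> \<phi> ` V \<Longrightarrow> \<phi> (\<phi>' w) = w" "w \<in> \<phi> ` V \<Longrightarrow> \<phi>' w \<in> V"
  using inv by auto

lemma param_in_M: "w \<in> S \<Longrightarrow> w \<in> \<phi> ` V \<Longrightarrow> \<phi>' w \<in> M"
  using in_M_iff inv' by metis

lemma cont_A: "continuous_on V A" and cont_B: "continuous_on (\<phi> ` V) B"
  using A1 B1 C1_onD by auto

lemma cont_phi': "continuous_on (\<phi> ` V) \<phi>'"
  by (intro continuous_at_imp_continuous_on ballI has_derivative_continuous) (rule B)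

lemma BA:
  assumes "y \<in> V"
  shows "B (\<phi> y) (A y v) = v"
proof -
  have "((\<lambda>z. \<phi>' (\<phi> z)) has_derivative (\<lambda>v. B (\<phi> y) (A y v))) (at y)"
    by (rule has_derivative_compose[OF A[OF assms] B]) (use assms in auto)
  moreover have "((\<lambda>z. \<phi>' (\<phi> z)) has_derivative (\<lambda>v. v)) (at y)"
    by (rule has_derivative_transform_within_open[OF _ V assms, of "\<lambda>z. z"]) (auto simp: inv)
  ultimately show ?thesis using has_derivative_unique by metis
qed

lemma AB:
  assumes "y \<in> V"
  shows "A y (B (\<phi> y) v) = v"
proof -
  have "((\<lambda>z. \<phi> (\<phi>' z)) has_derivative (\<lambda>v. A y (B (\<phi> y) v))) (at (\<phi> y))"
    by (rule has_derivative_compose[OF B]) (use assms A[OF assms] in \<open>auto simp: inv\<close>)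
  moreover have "((\<lambda>z. \<phi> (\<phi>' z)) has_derivative (\<lambda>v. v)) (at (\<phi> y))"
    by (rule has_derivative_transform_within_open[OF _ W, of "\<lambda>z. z"]) (use assms in \<open>auto simp: inv\<close>)
  ultimately show ?thesis using has_derivative_unique by metis
qed

text \<open>The part \<open>q\<close> of \<open>A y v\<close> orthogonal to \<open>S\<close> pairs
  to zero with the chart image of the curve at all small times, hence also with its velocity.
  Differentiability of the curve at 0 is enough for this.\<close>

lemma curve_velocity:
  assumes "y \<in> V" "\<gamma> 0 = y" "\<forall>\<^sub>F t in nhds 0. \<gamma> t \<in> M" "(\<gamma> has_vector_derivative v) (at (0::real))"
  shows "A y v \<in> S"
proof -
  define q where "q = A y v - proj S (A y v)"
  have q: "s \<in> S \<Longrightarrow> q \<bullet> s = 0" for s unfolding q_def by (rule proj_orth[OF S])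
  have "((\<lambda>t. \<phi> (\<gamma> t)) has_derivative (\<lambda>t. A y (t *\<^sub>R v))) (at 0)"
    using has_derivative_compose[OF assms(4)[unfolded has_vector_derivative_def], of \<phi> "A y"] A assms by simp
  then have "((\<lambda>t. q \<bullet> \<phi> (\<gamma> t)) has_derivative (\<lambda>t. q \<bullet> A y (t *\<^sub>R v))) (at 0)"
    by (rule has_derivative_inner_right)
  moreover have "((\<lambda>t. q \<bullet> \<phi> (\<gamma> t)) has_derivative (\<lambda>t. 0)) (at 0)"
  proof (rule has_derivative_transform_eventually[of "\<lambda>_. 0"])
    have "isCont \<gamma> 0" using assms(4) has_vector_derivative_continuous by blast
    then have "\<forall>\<^sub>F t in at 0. \<gamma> t \<in> V"
      using topological_tendstoD[of \<gamma> y "at 0" V] V assms by (simp add: isCont_def)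
    moreover have "\<forall>\<^sub>F t in at 0. \<gamma> t \<in> M"
      using assms(3) by (simp add: eventually_nhds_conv_at)
    ultimately show "\<forall>\<^sub>F t in at 0. 0 = q \<bullet> \<phi> (\<gamma> t)"
      by eventually_elim (metis q in_M_iff)
    show "0 = q \<bullet> \<phi> (\<gamma> 0)"
      using assms in_M_iff q by (metis eventually_nhds_x_imp_x)
  qed auto
  ultimately have "(\<lambda>t::real. q \<bullet> A y (t *\<^sub>R v)) = (\<lambda>t. 0)" using has_derivative_unique by blast
  from fun_cong[OF this, of 1] have "q \<bullet> A y v = 0" by simp
  then have "q \<bullet> q = 0" using q[OF proj_in[OF S], of "A y v"] by (simp add: q_def inner_diff_right)
  then show ?thesis using proj_in[OF S, of "A y v"] by (simp add: q_def)
qed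

text \<open>From right to left, the line \<open>\<phi> y + t s\<close> inside \<open>S\<close> is
  lifted through the inverse chart, which produces the continuously differentiable curve that
  \<open>tangent_space\<close> asks for.\<close>

lemma tangent:
  assumes "y \<in> V" "y \<in> M"
  shows "tangent_space M y = B (\<phi> y) ` S"
proof
  show "tangent_space M y \<subseteq> B (\<phi> y) ` S"
  proof
    fix v assume "v \<in> tangent_space M y"
    then have "A y v \<in> S"
      by (elim tangent_space_differentiable) (use curve_velocity assms in auto)
    then show "v \<in> B (\<phi> y) ` S" using BA[OF assms(1), of v] by (metis imageI)
  qed
  show "B (\<phi> y) ` S \<subseteq> tangent_space M y"
  proof
    fix v assume "v \<in> B (\<phi> y) ` S"
    then obtain s where s: "s \<in> S" "v = B (\<phi> y) s" by auto
    obtain e where e: "0 < e" "\<And>t. t \<in> {-e<..<e} \<Longrightarrow> \<phi> y + t *\<^sub>R s \<in> \<phi> ` V"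
      using open_line_segment[OF W imageI[OF assms(1)], of s] by blast
    define \<gamma> where "\<gamma> t = \<phi>' (\<phi> y + t *\<^sub>R s)" for t
    have "C1_on \<gamma> {-e<..<e}"
      unfolding \<gamma>_def using e(2) by (intro C1_on_compose[OF C1_on_affine C1_onI[OF W B cont_B]]) auto
    moreover have "\<gamma> ` {-e<..<e} \<subseteq> M"
    proof
      fix z assume "z \<in> \<gamma> ` {-e<..<e}"
      then obtain t where t: "t \<in> {-e<..<e}" "z = \<gamma> t" by auto
      have "\<phi> y + t *\<^sub>R s \<in> S"
        using s assms in_M_iff S by (intro subspace_add subspace_scale) auto
      then show "z \<in> M" unfolding t \<gamma>_def by (rule param_in_M[OF _ e(2)[OF t(1)]])
    qed
    moreover have "\<gamma> 0 = y" using assms by (simp add: \<gamma>_def inv)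
    moreover have "(\<gamma> has_vector_derivative v) (at 0)"
      unfolding \<gamma>_def has_vector_derivative_def s
      using has_derivative_compose[OF has_derivative_line[of "\<phi> y" s 0], of \<phi>' "B (\<phi> y)"] assms B
      by (simp add: blinfun.scaleR_right)
    ultimately show "v \<in> tangent_space M y" using e(1) by (intro tangent_spaceI[of e \<gamma>]) auto
  qed
qed

lemma subspace_tangent: "y \<in> V \<Longrightarrow> y \<in> M \<Longrightarrow> subspace (tangent_space M y)"
  unfolding tangent
  by (intro linear_subspace_image S bounded_linear.linear blinfun.bounded_linear_right)

lemma tangent_iff: "y \<in> V \<Longrightarrow> y \<in> M \<Longrightarrow> v \<in> tangent_space M y \<longleftrightarrow> A y v \<in> S"
proof -
  assume y: "y \<in> V" "y \<in> M"
  have "v = B (\<phi> y) (A y v)" using BA[OF y(1)] by simp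
  then have "A y v \<in> S \<Longrightarrow> v \<in> B (\<phi> y) ` S" by (rule image_eqI)
  then show ?thesis unfolding tangent[OF y] using AB[OF y(1)] by auto
qed

text \<open>The definition of \<open>tangent_space\<close> uses continuously differentiable curves;
  this version admits curves differentiable at 0 alone, such as those produced by the proximal map
  at its base point.\<close>

lemma curve_tangent:
  assumes "y \<in> V" "\<gamma> 0 = y" "\<forall>\<^sub>F t in nhds 0. \<gamma> t \<in> M" "(\<gamma> has_vector_derivative v) (at (0::real))"
  shows "v \<in> tangent_space M y"
  using curve_velocity[OF assms] tangent_iff assms eventually_nhds_x_imp_x by metis

text \<open>A tangent vector \<open>B (\<phi> y) s\<close> at the limit is approached by the tangent
  vectors \<open>B (\<phi> (X n)) s\<close>, so orthogonality survives the limit.\<close>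

lemma normal_limit:
  assumes "y \<in> V" "y \<in> M" "X \<longlonglongrightarrow> y" "\<And>n::nat. X n \<in> M" "\<And>n. a n \<in> normal_space M (X n)" "a \<longlonglongrightarrow> a0"
  shows "a0 \<in> normal_space M y"
proof -
  have ev: "\<forall>\<^sub>F n in sequentially. X n \<in> V" using assms V topological_tendstoD by blast
  have "v \<bullet> a0 = 0" if vT: "v \<in> tangent_space M y" for v
  proof -
    obtain s where s: "s \<in> S" "v = B (\<phi> y) s" using vT unfolding tangent[OF assms(1,2)] by auto
    have "(\<lambda>n. \<phi> (X n)) \<longlonglongrightarrow> \<phi> y"
      using A[OF assms(1)] has_derivative_continuous assms(3) isCont_tendsto_compose by blast
    then have "(\<lambda>n. B (\<phi> (X n))) \<longlonglongrightarrow> B (\<phi> y)"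
      using cont_B W assms(1) by (metis continuous_on_eq_continuous_at imageI isCont_tendsto_compose)
    then have "(\<lambda>n. B (\<phi> (X n)) s \<bullet> a n) \<longlonglongrightarrow> v \<bullet> a0"
      unfolding s using assms(6) by (intro tendsto_intros)
    moreover have "\<forall>\<^sub>F n in sequentially. B (\<phi> (X n)) s \<bullet> a n = 0"
      using ev
    proof eventually_elim
      case (elim n)
      then have "B (\<phi> (X n)) s \<in> tangent_space M (X n)" using tangent assms(4) s by auto
      then show ?case using assms(5)[of n] by (auto simp: orthogonal_comp_def orthogonal_def)
    qed
    ultimately show ?thesis using tendsto_unique[OF _ _ tendsto_eventually] by (metis sequentially_bot)
  qed
  then show ?thesis by (auto simp: orthogonal_comp_def orthogonal_def)
qed

text \<open>Tangency is membership of \<open>A y v\<close> in the closed set \<open>S\<close>, and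
  \<open>A\<close> is continuous.\<close>

lemma tangent_limit:
  assumes "y \<in> V" "y \<in> M" "X \<longlonglongrightarrow> y" "\<And>n::nat. X n \<in> M" "\<And>n. a n \<in> tangent_space M (X n)" "a \<longlonglongrightarrow> a0"
  shows "a0 \<in> tangent_space M y"
proof -
  have ev: "\<forall>\<^sub>F n in sequentially. X n \<in> V" using assms V topological_tendstoD by blast
  have "(\<lambda>n. A (X n)) \<longlonglongrightarrow> A y"
    using cont_A V assms(1,3) by (metis continuous_on_eq_continuous_at isCont_tendsto_compose)
  then have "(\<lambda>n. A (X n) (a n)) \<longlonglongrightarrow> A y a0" using assms(6) by (intro tendsto_intros)
  moreover have "\<forall>\<^sub>F n in sequentially. A (X n) (a n) \<in> S"
    using ev by eventually_elim (use tangent_iff assms in blast)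
  ultimately have "A y a0 \<in> S"
    using Lim_in_closed_set[OF closed_subspace[OF S]] by (metis sequentially_bot)
  then show ?thesis using tangent_iff assms by blast
qed

end

lemma subspace_tangent_space:
  assumes "C2_submanifold M" "x \<in> M"
  shows "subspace (tangent_space M x)"
  using chart_exists[OF assms] chart.subspace_tangent assms(2) by metis

text \<open>An open \<Omega> admits every direction, so the u-part of a normal vector vanishes. This
  gives the parallel-space condition of partial smoothness its force in the u-directions.\<close>

lemma normal_space_Times:
  fixes M :: "'x::euclidean_space set" and \<Omega> :: "'u::euclidean_space set"
  assumes M: "C2_submanifold M" "x \<in> M" and \<Omega>: "open \<Omega>" "u \<in> \<Omega>"
  shows "normal_space (M \<times> \<Omega>) (x, u) = normal_space M x \<times> {0}"
proof -
  obtain V \<phi> \<phi>' S A B where c: "chart M V \<phi> \<phi>' S A B" "x \<in> V" using chart_exists[OF M] .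
  have 1: "fst v \<in> tangent_space M x" if v: "v \<in> tangent_space (M \<times> \<Omega>) (x, u)" for v
  proof -
    obtain \<gamma> where \<gamma>: "\<gamma> 0 = (x,u)" "\<forall>\<^sub>F t in nhds 0. \<gamma> t \<in> M \<times> \<Omega>" "(\<gamma> has_vector_derivative v) (at (0::real))"
      using tangent_space_differentiable[OF v] by blast
    have "((\<lambda>t. fst (\<gamma> t)) has_vector_derivative fst v) (at 0)"
      using \<gamma>(3) unfolding has_vector_derivative_def by (auto dest: has_derivative_fst)
    moreover have "\<forall>\<^sub>F t in nhds 0. fst (\<gamma> t) \<in> M"
      using \<gamma>(2) by eventually_elim auto
    ultimately show ?thesis using chart.curve_tangent[OF c, of "\<lambda>t. fst (\<gamma> t)"] \<gamma>(1) by simp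
  qed
  have 2: "(v, 0) \<in> tangent_space (M \<times> \<Omega>) (x, u)" if vT: "v \<in> tangent_space M x" for v
  proof -
    obtain \<gamma> and e :: real where \<gamma>: "0 < e" "C1_on \<gamma> {-e<..<e}" "\<gamma> ` {-e<..<e} \<subseteq> M" "\<gamma> 0 = x"
      "(\<gamma> has_vector_derivative v) (at (0::real))"
      using vT unfolding tangent_space_def mem_Collect_eq
      by (elim exE conjE) (rule that; assumption)
    have "C1_on (\<lambda>t. (\<gamma> t, u)) {-e<..<e}" by (intro C1_on_Pair \<gamma>(2) C1_on_const) simp
    moreover have "((\<lambda>t. (\<gamma> t, u)) has_vector_derivative (v, 0)) (at 0)"
      using has_derivative_Pair[OF \<gamma>(5)[unfolded has_vector_derivative_def] has_derivative_const[of u]]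
      by (simp add: has_vector_derivative_def scaleR_prod_def)
    moreover have "(\<gamma> t, u) \<in> M \<times> \<Omega>" if "t \<in> {-e<..<e}" for t
      using \<gamma>(3) that \<Omega>(2) by auto
    ultimately show ?thesis using \<gamma>(1,4) by (intro tangent_spaceI[of e "\<lambda>t. (\<gamma> t, u)"]) simp_all
  qed
  have 3: "(0, w) \<in> tangent_space (M \<times> \<Omega>) (x, u)" for w
  proof -
    obtain e where e: "0 < e" "\<And>t. t \<in> {-e<..<e} \<Longrightarrow> u + t *\<^sub>R w \<in> \<Omega>"
      using open_line_segment[OF \<Omega>, of w] by blast
    have "((\<lambda>t::real. (x, u) + t *\<^sub>R (0, w)) has_vector_derivative (0, w)) (at 0)"
      unfolding has_vector_derivative_def by (rule has_derivative_line)
    moreover have "(x, u) + t *\<^sub>R (0, w) \<in> M \<times> \<Omega>" if "t \<in> {-e<..<e}" for t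
      using e(2)[OF that] M by simp
    ultimately show ?thesis
      using e(1) C1_on_affine[of "{-e<..<e}" "(x, u)" "(0, w)"] by (intro tangent_spaceI[of e]) simp_all
  qed
  have "(a, b) \<in> normal_space (M \<times> \<Omega>) (x, u) \<longleftrightarrow> a \<in> normal_space M x \<and> b = 0" for a b
  proof
    assume ab: "(a, b) \<in> normal_space (M \<times> \<Omega>) (x, u)"
    then have "b \<bullet> b = 0" using 3[of b] by (auto simp: orthogonal_comp_def orthogonal_def)
    moreover have "a \<in> normal_space M x"
      using ab 2 by (fastforce simp: orthogonal_comp_def orthogonal_def)
    ultimately show "a \<in> normal_space M x \<and> b = 0" by simp
  next
    assume "a \<in> normal_space M x \<and> b = 0"
    then show "(a, b) \<in> normal_space (M \<times> \<Omega>) (x, u)"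
      using 1 by (auto simp: orthogonal_comp_def orthogonal_def)
  qed
  then show ?thesis by auto
qed

section \<open>Regular normals and subgradients\<close>

lemma regular_normals_add:
  assumes "v \<in> regular_normals C x" "w \<in> regular_normals C x"
  shows "v + w \<in> regular_normals C x"
  unfolding regular_normals_def mem_Collect_eq
proof (intro allI impI)
  fix e :: real assume "e > 0"
  then have "e / 2 > 0" by simp
  then have "\<forall>\<^sub>F y in nhds x. y \<in> C \<longrightarrow> v \<bullet> (y - x) \<le> e/2 * norm (y - x)"
    "\<forall>\<^sub>F y in nhds x. y \<in> C \<longrightarrow> w \<bullet> (y - x) \<le> e/2 * norm (y - x)"
    using assms unfolding regular_normals_def by blast+
  then show "\<forall>\<^sub>F y in nhds x. y \<in> C \<longrightarrow> (v + w) \<bullet> (y - x) \<le> e * norm (y - x)"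
    by eventually_elim (auto simp: inner_add_left)
qed

lemma regular_normals_scale:
  assumes "v \<in> regular_normals C x" "0 \<le> c"
  shows "c *\<^sub>R v \<in> regular_normals C x"
proof (cases "c = 0")
  case True
  then show ?thesis by (simp add: regular_normals_def)
next
  case False
  then have c: "c > 0" using assms by simp
  show ?thesis
    unfolding regular_normals_def mem_Collect_eq
  proof (intro allI impI)
    fix e :: real assume "e > 0"
    then have "e / c > 0" using c by simp
    then have "\<forall>\<^sub>F y in nhds x. y \<in> C \<longrightarrow> v \<bullet> (y - x) \<le> e/c * norm (y - x)"
      using assms unfolding regular_normals_def by blast
    then show "\<forall>\<^sub>F y in nhds x. y \<in> C \<longrightarrow> (c *\<^sub>R v) \<bullet> (y - x) \<le> e * norm (y - x)"
      by eventually_elim (use c in \<open>auto simp: field_simps\<close>)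
  qed
qed

lemma closed_regular_normals: "closed (regular_normals C x)"
proof -
  have "l \<in> regular_normals C x" if n: "\<forall>n. X n \<in> regular_normals C x" "X \<longlonglongrightarrow> l" for X :: "nat \<Rightarrow> _" and l
    unfolding regular_normals_def mem_Collect_eq
  proof (intro allI impI)
    fix e :: real assume e: "e > 0"
    then obtain n where "dist (X n) l < e / 2"
      using metric_LIMSEQ_D[OF n(2), of "e/2"] by auto
    then have d: "norm (l - X n) \<le> e / 2" by (simp add: dist_norm norm_minus_commute)
    have "\<forall>\<^sub>F y in nhds x. y \<in> C \<longrightarrow> X n \<bullet> (y - x) \<le> e/2 * norm (y - x)"
      using n(1) e unfolding regular_normals_def mem_Collect_eq by (metis half_gt_zero)
    then show "\<forall>\<^sub>F y in nhds x. y \<in> C \<longrightarrow> l \<bullet> (y - x) \<le> e * norm (y - x)"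
    proof eventually_elim
      case (elim y)
      have "(l - X n) \<bullet> (y - x) \<le> norm (l - X n) * norm (y - x)" by (rule norm_cauchy_schwarz)
      also have "\<dots> \<le> e / 2 * norm (y - x)" by (rule mult_right_mono[OF d]) simp
      finally show ?case using elim by (auto simp: inner_diff_left)
    qed
  qed
  then show ?thesis unfolding closed_sequential_limits by blast
qed

text \<open>Epigraph points lie above the first-order minorant, which gives one direction.
  Conversely, where \<open>h\<close> drops below the minorant, the point on the minorant belongs to
  the epigraph, is close to \<open>(x, r0)\<close>, and violates the normal inequality.\<close>

lemma regular_subdiff_iff:
  fixes h :: "'a::euclidean_space \<Rightarrow> ereal"
  assumes hx: "h x = ereal r0"
  shows "v \<in> regular_subdiff h x \<longleftrightarrow> (v, -1) \<in> regular_normals (epi h) (x, r0)"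
proof
  assume v: "v \<in> regular_subdiff h x"
  show "(v, -1) \<in> regular_normals (epi h) (x, r0)"
    unfolding regular_normals_def mem_Collect_eq
  proof (intro allI impI)
    fix e :: real assume e: "e > 0"
    have "\<forall>\<^sub>F y in nhds x. h x + ereal (v \<bullet> (y - x) - e * norm (y - x)) \<le> h y"
      using v e unfolding regular_subdiff_def by blast
    moreover have "filterlim fst (nhds x) (nhds (x, r0))"
      using tendsto_fst[OF filterlim_ident, of "(x, r0)"] by simp
    ultimately have "\<forall>\<^sub>F p in nhds (x, r0). h x + ereal (v \<bullet> (fst p - x) - e * norm (fst p - x)) \<le> h (fst p)"
      by (rule eventually_compose_filterlim)
    then show "\<forall>\<^sub>F p in nhds (x, r0). p \<in> epi h \<longrightarrow> (v, - 1) \<bullet> (p - (x, r0)) \<le> e * norm (p - (x, r0))"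
    proof eventually_elim
      case (elim p)
      show ?case
      proof
        assume "p \<in> epi h"
        then have "h (fst p) \<le> ereal (snd p)" by (cases p) (auto simp: epi_def)
        with elim hx have "ereal (r0 + (v \<bullet> (fst p - x) - e * norm (fst p - x))) \<le> ereal (snd p)"
          by (simp del: ereal_less_eq)
        then have "v \<bullet> (fst p - x) - (snd p - r0) \<le> e * norm (fst p - x)" by simp
        also have "\<dots> \<le> e * norm (p - (x, r0))"
          using e norm_fst_le[of "fst p - x" "snd p - r0"] by (cases p) (simp add: norm_Pair)
        finally show "(v, - 1) \<bullet> (p - (x, r0)) \<le> e * norm (p - (x, r0))"
          by (cases p) simp
      qed
    qed
  qed
next
  assume n: "(v, -1) \<in> regular_normals (epi h) (x, r0)"
  have "\<forall>\<^sub>F y in nhds x. h x + ereal (v \<bullet> (y - x) - e * norm (y - x)) \<le> h y" if e: "e > 0" for e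
  proof -
    \<comment> \<open>Points on the minorant are within \<open>c * norm (y - x)\<close> of
      \<open>(x, r0)\<close>. With \<epsilon> chosen so that \<open>\<epsilon> * c = e / 2\<close>,
      the normal inequality allows only half of the violation.\<close>
    define c where "c = 1 + norm v + e"
    have c: "c > 0" using e by (simp add: c_def add_pos_nonneg)
    define \<epsilon> where "\<epsilon> = e / (2 * c)"
    have "\<epsilon> > 0" using e c by (simp add: \<epsilon>_def)
    then have "\<forall>\<^sub>F p in nhds (x, r0). p \<in> epi h \<longrightarrow> (v, - 1) \<bullet> (p - (x, r0)) \<le> \<epsilon> * norm (p - (x, r0))"
      using n unfolding regular_normals_def by blast
    then obtain d where d: "d > 0"
      "\<And>p. dist p (x, r0) < d \<Longrightarrow> p \<in> epi h \<Longrightarrow> (v, - 1) \<bullet> (p - (x, r0)) \<le> \<epsilon> * norm (p - (x, r0))"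
      unfolding eventually_nhds_metric by blast
    have "h x + ereal (v \<bullet> (y - x) - e * norm (y - x)) \<le> h y" if y: "dist y x < d / c" for y
    proof (rule ccontr)
      define r where "r = r0 + (v \<bullet> (y - x) - e * norm (y - x))"
      assume "\<not> h x + ereal (v \<bullet> (y - x) - e * norm (y - x)) \<le> h y"
      then have lt: "h y < ereal r" by (simp add: hx r_def)
      then have ep: "(y, r) \<in> epi h" by (simp add: epi_def)
      have "\<bar>r - r0\<bar> \<le> norm v * norm (y - x) + e * norm (y - x)"
        unfolding r_def using Cauchy_Schwarz_ineq2[of v "y - x"] e
        by (simp add: abs_le_iff) (smt (verit) mult_nonneg_nonneg norm_ge_zero)
      then have le: "norm ((y, r) - (x, r0)) \<le> c * norm (y - x)"
        using norm_Pair_le[of "y - x" "r - r0"] by (simp add: c_def algebra_simps)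
      also have "\<dots> < d" using y c by (simp add: dist_norm field_simps)
      finally have "dist (y, r) (x, r0) < d" by (simp add: dist_norm)
      from d(2)[OF this ep] have "e * norm (y - x) \<le> \<epsilon> * norm ((y, r) - (x, r0))"
        by (simp add: r_def)
      also have "\<dots> \<le> \<epsilon> * (c * norm (y - x))" by (rule mult_left_mono[OF le]) (use \<open>\<epsilon> > 0\<close> in simp)
      also have "\<dots> = e / 2 * norm (y - x)" using c by (simp add: \<epsilon>_def)
      finally have "y = x" using e by (simp add: field_simps)
      then show False using lt by (simp add: r_def hx)
    qed
    then show ?thesis unfolding eventually_nhds_metric using d(1) c by (meson divide_pos_pos)
  qed
  then show "v \<in> regular_subdiff h x" unfolding regular_subdiff_def using hx by simp
qed

lemma convex_regular_subdiff:
  fixes h :: "'a::euclidean_space \<Rightarrow> ereal"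
  shows "convex (regular_subdiff h x)"
proof (cases "h x")
  case (real r)
  note iff = regular_subdiff_iff[where h=h and x=x, OF real]
  show ?thesis
  proof (rule convexI)
    fix v w :: 'a and a b :: real
    assume *: "v \<in> regular_subdiff h x" "w \<in> regular_subdiff h x" "0 \<le> a" "0 \<le> b" "a + b = 1"
    then have "a *\<^sub>R (v, -1) + b *\<^sub>R (w, -1) \<in> regular_normals (epi h) (x, r)"
      unfolding iff by (intro regular_normals_add regular_normals_scale)
    moreover have "a *\<^sub>R (v, -1) + b *\<^sub>R (w, -1::real) = (a *\<^sub>R v + b *\<^sub>R w, -1)"
      using *(5) by simp
    ultimately show "a *\<^sub>R v + b *\<^sub>R w \<in> regular_subdiff h x"
      unfolding iff by simp
  qed
qed (auto simp: regular_subdiff_def)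

text \<open>Regular subgradients along an \<open>h\<close>-attentive sequence are epigraph normals
  with last component -1 at converging epigraph points; Clarke regularity makes their limit a
  regular normal again.\<close>

lemma subdiff_eq_regular_subdiff:
  assumes "subdiff_regular h x"
  shows "subdiff h x = regular_subdiff h x"
proof
  obtain r where r: "h x = ereal r" using assms unfolding subdiff_regular_def by (cases "h x") auto
  then have cr: "normals (epi h) (x, r) = regular_normals (epi h) (x, r)"
    using assms unfolding subdiff_regular_def clarke_regular_def by simp
  show "subdiff h x \<subseteq> regular_subdiff h x"
  proof
    fix v assume "v \<in> subdiff h x"
    then obtain X V where XV: "X \<longlonglongrightarrow> x" "(\<lambda>n. h (X n)) \<longlonglongrightarrow> h x"
      "\<And>n::nat. V n \<in> regular_subdiff h (X n)" "V \<longlonglongrightarrow> v" unfolding subdiff_def by blast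
    have fin: "h (X n) = ereal (real_of_ereal (h (X n)))" for n
      using XV(3)[of n] unfolding regular_subdiff_def by (simp add: ereal_real')
    have "(\<lambda>n. real_of_ereal (h (X n))) \<longlonglongrightarrow> r" using XV(2) unfolding r by (rule lim_real_of_ereal)
    then have "(\<lambda>n. (X n, real_of_ereal (h (X n)))) \<longlonglongrightarrow> (x, r)" using XV(1) by (intro tendsto_Pair)
    moreover have "(X n, real_of_ereal (h (X n))) \<in> epi h" for n using fin[of n] by (simp add: epi_def)
    moreover have "(V n, -1) \<in> regular_normals (epi h) (X n, real_of_ereal (h (X n)))" for n
      using XV(3) regular_subdiff_iff[of h "X n", OF fin[of n]] by blast
    moreover have "(\<lambda>n. (V n, -1::real)) \<longlonglongrightarrow> (v, -1)" using XV by (intro tendsto_intros)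
    ultimately have "(v, -1) \<in> normals (epi h) (x, r)"
      unfolding normals_def mem_Collect_eq
      by (intro exI[of _ "\<lambda>n. (X n, real_of_ereal (h (X n)))"] exI[of _ "\<lambda>n. (V n, -1::real)"]) simp
    then show "v \<in> regular_subdiff h x" using cr regular_subdiff_iff[of h x, OF r] by simp
  qed
  show "regular_subdiff h x \<subseteq> subdiff h x"
  proof
    fix v assume v: "v \<in> regular_subdiff h x"
    show "v \<in> subdiff h x" unfolding subdiff_def mem_Collect_eq
      by (intro conjI exI[of _ "\<lambda>_. x"] exI[of _ "\<lambda>_. v"]) (use v r in auto)
  qed
qed

text \<open>A gap \<delta> below the affine minorant at \<open>y\<close> would persist by convexity,
  scaled to \<open>t * \<delta>\<close>, at \<open>x + t (y - x)\<close>, whereas the local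
  inequality tolerates at most half of that.\<close>

lemma convex_subdiff_if_regular:
  fixes h :: "'a::euclidean_space \<Rightarrow> ereal"
  assumes cv: "convex (epi h)" and d: "d \<in> regular_subdiff h x"
  shows "d \<in> convex_subdiff h x"
proof -
  have fin: "\<bar>h x\<bar> \<noteq> \<infinity>" using d unfolding regular_subdiff_def by simp
  then obtain r0 where r0: "h x = ereal r0" by (cases "h x") auto
  have "h x + ereal (d \<bullet> (y - x)) \<le> h y" for y
  proof (rule ccontr)
    assume "\<not> h x + ereal (d \<bullet> (y - x)) \<le> h y"
    then have "h y < ereal (r0 + d \<bullet> (y - x))" by (simp add: r0)
    then obtain r where r: "h y < ereal r" "ereal r < ereal (r0 + d \<bullet> (y - x))"
      by (metis ereal_dense2)
    define \<delta> where "\<delta> = r0 + d \<bullet> (y - x) - r"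
    define e where "e = \<delta> / (2 * (norm (y - x) + 1))"
    have \<delta>: "\<delta> > 0" using r by (simp add: \<delta>_def)
    have n1: "norm (y - x) + 1 > 0" by (simp add: add_nonneg_pos)
    have e: "e > 0" using \<delta> n1 by (simp add: e_def)
    obtain \<eta> where \<eta>: "\<eta> > 0" "\<And>z. dist z x < \<eta> \<Longrightarrow> h x + ereal (d \<bullet> (z - x) - e * norm (z - x)) \<le> h z"
      using d e unfolding regular_subdiff_def eventually_nhds_metric by blast
    define t where "t = min 1 (\<eta> / (2 * (norm (y - x) + 1)))"
    have t: "0 < t" "t \<le> 1" "t * (norm (y - x) + 1) < \<eta>"
    proof -
      show "0 < t" "t \<le> 1" using \<eta> n1 by (auto simp: t_def)
      have "t * (norm (y - x) + 1) \<le> \<eta> / (2 * (norm (y - x) + 1)) * (norm (y - x) + 1)"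
        by (rule mult_right_mono) (use n1 in \<open>auto simp: t_def\<close>)
      also have "\<dots> = \<eta> / 2" using less_imp_neq[OF n1] by (simp only: times_divide_eq_left) (simp add: field_simps)
      finally show "t * (norm (y - x) + 1) < \<eta>" using \<eta> by simp
    qed
    define z where "z = x + t *\<^sub>R (y - x)"
    have zx: "z - x = t *\<^sub>R (y - x)" "norm (z - x) = t * norm (y - x)" using t by (auto simp: z_def)
    have "(1 - t) *\<^sub>R (x, r0) + t *\<^sub>R (y, r) \<in> epi h"
      using cv r r0 t by (intro convexD) (auto simp: epi_def)
    moreover have "(1 - t) *\<^sub>R (x, r0) + t *\<^sub>R (y, r) = (z, (1 - t) * r0 + t * r)"
      by (simp add: z_def algebra_simps)
    ultimately have "h z \<le> ereal ((1 - t) * r0 + t * r)" by (simp add: epi_def)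
    moreover have "dist z x < \<eta>" using zx t by (simp add: dist_norm algebra_simps)
    ultimately have "h x + ereal (d \<bullet> (z - x) - e * norm (z - x)) \<le> ereal ((1 - t) * r0 + t * r)"
      using \<eta>(2) order_trans by blast
    then have "r0 + (t * (d \<bullet> (y - x)) - e * (t * norm (y - x))) \<le> (1 - t) * r0 + t * r"
      using t(1) by (simp add: r0 zx)
    then have "t * (\<delta> - e * norm (y - x)) \<le> 0" by (simp add: \<delta>_def algebra_simps)
    then have "\<delta> \<le> e * norm (y - x)" using t(1) by (simp add: mult_le_0_iff)
    also have "\<dots> \<le> e * (norm (y - x) + 1)" using e by simp
    also have "\<dots> = \<delta> / 2" using less_imp_neq[OF n1] unfolding e_def
      by (simp only: times_divide_eq_left) (simp add: field_simps)
    finally show False using \<delta> by simp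
  qed
  then show ?thesis unfolding convex_subdiff_def using fin by simp
qed

text \<open>Along a curve in \<open>M\<close> through \<open>x\<close>, the function
  \<open>k (\<gamma> t) - v \<bullet> \<gamma> t\<close> has a local minimum at 0 by the subgradient
  inequality; its derivative there pairs the velocity with \<open>G - v\<close>.\<close>

lemma convex_subdiff_minus_gradient_normal:
  assumes x: "x \<in> M" and k: "(k has_derivative (\<lambda>v. v \<bullet> G)) (at x)"
    and h: "\<forall>\<^sub>F y in nhds x. y \<in> M \<longrightarrow> h y = ereal (k y)"
    and v: "v \<in> convex_subdiff h x"
  shows "v - G \<in> normal_space M x"
proof -
  have "w \<bullet> (v - G) = 0" if wT: "w \<in> tangent_space M x" for w
  proof -
    obtain \<gamma> where \<gamma>: "\<gamma> 0 = x" "\<forall>\<^sub>F t in nhds 0. \<gamma> t \<in> M" "(\<gamma> has_vector_derivative w) (at (0::real))"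
      using tangent_space_differentiable[OF wT] .
    define \<theta> where "\<theta> t = k (\<gamma> t) - v \<bullet> \<gamma> t" for t
    have "((\<lambda>t. k (\<gamma> t)) has_derivative (\<lambda>t. (t *\<^sub>R w) \<bullet> G)) (at 0)"
      using has_derivative_compose[OF \<gamma>(3)[unfolded has_vector_derivative_def], of k "\<lambda>v. v \<bullet> G"] k \<gamma>(1) by simp
    then have "(\<theta> has_derivative (\<lambda>t. (t *\<^sub>R w) \<bullet> G - v \<bullet> (t *\<^sub>R w))) (at 0)"
      unfolding \<theta>_def using \<gamma>(3)[unfolded has_vector_derivative_def]
      by (intro has_derivative_diff has_derivative_inner_right)
    then have der: "(\<theta> has_real_derivative (w \<bullet> G - v \<bullet> w)) (at 0)"
      by (rule has_derivative_imp_has_field_derivative) (simp add: algebra_simps)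
    have hx: "h x = ereal (k x)" using eventually_nhds_x_imp_x[OF h] x by simp
    have "filterlim \<gamma> (nhds x) (nhds 0)"
      using has_vector_derivative_continuous[OF \<gamma>(3)] tendsto_at_iff_tendsto_nhds[of \<gamma> 0] \<gamma>(1)
      by (simp add: isCont_def)
    then have "\<forall>\<^sub>F t in nhds 0. \<gamma> t \<in> M \<longrightarrow> h (\<gamma> t) = ereal (k (\<gamma> t))"
      by (rule eventually_compose_filterlim[OF h])
    with \<gamma>(2) have "\<forall>\<^sub>F t in nhds 0. \<theta> 0 \<le> \<theta> t"
    proof eventually_elim
      case (elim t)
      have "h x + ereal (v \<bullet> (\<gamma> t - x)) \<le> h (\<gamma> t)" using v unfolding convex_subdiff_def by blast
      then have "ereal (k x + v \<bullet> (\<gamma> t - x)) \<le> ereal (k (\<gamma> t))" using elim by (simp add: hx)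
      then have "k x + v \<bullet> (\<gamma> t - x) \<le> k (\<gamma> t)" by simp
      then show ?case by (simp add: \<theta>_def \<gamma>(1) inner_diff_right)
    qed
    then obtain \<delta> where "\<delta> > 0" "\<And>t. dist t 0 < \<delta> \<Longrightarrow> \<theta> 0 \<le> \<theta> t"
      unfolding eventually_nhds_metric by blast
    then have "w \<bullet> G - v \<bullet> w = 0"
      using DERIV_local_min[OF der, of \<delta>] by (simp add: dist_norm abs_minus_commute)
    then show ?thesis by (simp add: inner_diff_right inner_commute)
  qed
  then show ?thesis by (auto simp: orthogonal_comp_def orthogonal_def)
qed

text \<open>\<open>Liminf (at x)\<close> ignores the value at \<open>x\<close>. The bound
  \<open>c < h x\<close> covers that point and turns the eventual bound on \<open>at x\<close> into
  one on \<open>nhds x\<close>.\<close>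

lemma closed_epi:
  assumes "proper_lsc h"
  shows "closed (epi h)"
proof -
  have "(x, r) \<in> epi h" if XR: "\<And>n. (X n, R n) \<in> epi h" "X \<longlonglongrightarrow> x" "R \<longlonglongrightarrow> r" for X :: "nat \<Rightarrow> 'a" and R x r
  proof (rule ccontr)
    assume "(x, r) \<notin> epi h"
    then have "ereal r < h x" by (simp add: epi_def)
    then obtain c where c: "ereal r < ereal c" "ereal c < h x" by (metis ereal_dense2)
    have "ereal c < Liminf (at x) h"
      using c(2) assms unfolding proper_lsc_def by (meson order_less_le_trans)
    then have "\<forall>\<^sub>F y in at x. ereal c < h y" by (rule less_LiminfD)
    then have "\<forall>\<^sub>F y in nhds x. ereal c < h y" using c(2) by (simp add: eventually_nhds_conv_at)
    then have "\<forall>\<^sub>F n in sequentially. ereal c < h (X n)"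
      by (rule eventually_compose_filterlim[OF _ XR(2)])
    then have "\<forall>\<^sub>F n in sequentially. c \<le> R n"
    proof eventually_elim
      case (elim n)
      have "h (X n) \<le> ereal (R n)" using XR(1)[of n] by (simp add: epi_def)
      then have "ereal c \<le> ereal (R n)" using elim by (meson order_less_imp_le order_trans)
      then show ?case by simp
    qed
    then have "c \<le> r" using tendsto_lowerbound[OF XR(3)] by simp
    then show False using c by simp
  qed
  note lim = this
  show ?thesis
    unfolding closed_sequential_limits
  proof (intro allI impI)
    fix Z and l :: "'a \<times> real" assume Z: "(\<forall>n. Z n \<in> epi h) \<and> Z \<longlonglongrightarrow> l"
    have "(fst l, snd l) \<in> epi h"
      by (rule lim[of "\<lambda>n. fst (Z n)" "\<lambda>n. snd (Z n)" "fst l" "snd l"]) (use Z in \<open>auto intro: tendsto_fst tendsto_snd\<close>)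
    then show "l \<in> epi h" by simp
  qed
qed

text \<open>Weierstrass for extended values: a real sublevel set of \<open>h + \<kappa>\<close> is
  the preimage of the epigraph under \<open>y \<mapsto> (y, r - \<kappa> y)\<close>, hence closed,
  and the finite intersection property applies. The minimum may be infinite.\<close>

lemma lsc_attains_min:
  fixes h :: "'a::euclidean_space \<Rightarrow> ereal"
  assumes cl: "closed (epi h)" and h: "\<And>y. h y \<noteq> -\<infinity>" and K: "compact K" "K \<noteq> {}"
    and \<kappa>: "continuous_on UNIV \<kappa>"
  obtains z where "z \<in> K" "\<And>y. y \<in> K \<Longrightarrow> h z + ereal (\<kappa> z) \<le> h y + ereal (\<kappa> y)"
proof -
  define q where "q y = h y + ereal (\<kappa> y)" for y
  have qn: "q y \<noteq> -\<infinity>" for y unfolding q_def using h[of y] by (cases "h y") auto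
  have cls: "closed {y. q y \<le> c}" for c
  proof (cases c)
    case (real r)
    have "q y \<le> ereal r \<longleftrightarrow> (y, r - \<kappa> y) \<in> epi h" for y
      unfolding q_def epi_def by (cases "h y") auto
    then have "{y. q y \<le> c} = (\<lambda>y. (y, r - \<kappa> y)) -` epi h" using real by auto
    then show ?thesis using \<kappa> by (auto intro!: closed_vimage[OF cl] continuous_intros)
  next
    case MInf
    then show ?thesis using qn by simp
  qed simp
  have "K \<inter> (\<Inter>z\<in>K. {y. q y \<le> q z}) \<noteq> {}"
  proof (rule compact_imp_fip_image[OF K(1)])
    fix I assume I: "finite I" "I \<subseteq> K"
    show "K \<inter> (\<Inter>z\<in>I. {y. q y \<le> q z}) \<noteq> {}"
    proof (cases "I = {}")
      case False
      then have "Min (q ` I) \<in> q ` I" using I by (intro Min_in) auto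
      then obtain z where z: "z \<in> I" "q z = Min (q ` I)" by (metis imageE)
      then have "\<And>y. y \<in> I \<Longrightarrow> q z \<le> q y" using I by simp
      then show ?thesis using z I by blast
    qed (use K in simp)
  qed (use cls in auto)
  then obtain z where "z \<in> K" "\<And>y. y \<in> K \<Longrightarrow> q z \<le> q y" by blast
  then show ?thesis using that unfolding q_def by blast
qed

section \<open>Subgradients of partly smooth families\<close>

lemma LIMSEQ_if_dist_less_inverse:
  assumes "\<And>n. dist (X n) l < inverse (real (Suc n))"
  shows "X \<longlonglongrightarrow> l"
  by (rule metric_LIMSEQ_I) (metis assms reals_Archimedean less_trans order_le_less_trans inverse_le_imp_le
        of_nat_0_less_iff zero_less_Suc Suc_le_mono of_nat_le_iff le_imp_inverse_le)

locale partly_smooth_family =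
  fixes g :: "'x::euclidean_space \<times> 'u::euclidean_space \<Rightarrow> ereal"
    and M :: "'x set" and \<Omega> :: "'u set"
  assumes M: "C2_submanifold M" and \<Omega>: "open \<Omega>" and ps: "partly_smooth g (M \<times> \<Omega>)"
    and cv: "u \<in> \<Omega> \<Longrightarrow> convex (epi (\<lambda>x. g (x, u)))"
begin

lemma at_point:
  assumes "x \<in> M" "u \<in> \<Omega>"
  shows "proper_lsc g" "\<bar>g (x, u)\<bar> \<noteq> \<infinity>" "subdiff g (x, u) \<noteq> {}"
    "subdiff g (x, u) = regular_subdiff g (x, u)" "subdiff_regular g (x, u)"
    "normal_space M x \<times> {0} = par (subdiff g (x, u))"
    "set_continuous_at_within (subdiff g) (x, u) (M \<times> \<Omega>)"
    "\<exists>k. C2_extension g (M \<times> \<Omega>) (x, u) k"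
proof -
  have p: "partly_smooth_at g (M \<times> \<Omega>) (x, u)" using ps assms unfolding partly_smooth_def by blast
  show "proper_lsc g" and ne: "subdiff g (x, u) \<noteq> {}"
    and "set_continuous_at_within (subdiff g) (x, u) (M \<times> \<Omega>)"
    and "\<exists>k. C2_extension g (M \<times> \<Omega>) (x, u) k"
    using p unfolding partly_smooth_at_def by blast+
  show fin: "\<bar>g (x, u)\<bar> \<noteq> \<infinity>" using ne unfolding subdiff_def by auto
  have "\<forall>\<^sub>F y in nhds (x, u). g y \<noteq> \<infinity> \<longrightarrow> subdiff_regular g y"
    using p unfolding partly_smooth_at_def by blast
  then show "subdiff_regular g (x, u)"
    using eventually_nhds_x_imp_x fin by fastforce
  then show "subdiff g (x, u) = regular_subdiff g (x, u)" by (rule subdiff_eq_regular_subdiff)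
  show "normal_space M x \<times> {0} = par (subdiff g (x, u))"
    using p normal_space_Times[OF M assms(1) \<Omega> assms(2)] unfolding partly_smooth_at_def by metis
qed

text \<open>The parallel subspace is \<open>normal_space M x \<times> {0}\<close>. The equality of
  u-components is the rigidity behind the comparison of joint and partial subdifferentials.\<close>

lemma subdiff_diff:
  assumes "x \<in> M" "u \<in> \<Omega>" "(d, e) \<in> subdiff g (x, u)" "(d', e') \<in> subdiff g (x, u)"
  shows "d - d' \<in> normal_space M x" "e = e'"
proof -
  have "(d, e) - (d', e') \<in> par (subdiff g (x, u))"
    unfolding par_def mem_Collect_eq by (intro exI[of _ "(d, e)"] exI[of _ "(d', e')"] conjI refl hull_inc assms)
  then have "(d - d', e - e') \<in> normal_space M x \<times> {0}" unfolding at_point(6)[OF assms(1,2)] by simp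
  then show "d - d' \<in> normal_space M x" "e = e'" by auto
qed

lemma fst_subdiff:
  assumes "x \<in> M" "u \<in> \<Omega>"
  shows "fst ` subdiff g (x, u) \<subseteq> convex_subdiff (\<lambda>x. g (x, u)) x"
proof
  fix d assume "d \<in> fst ` subdiff g (x, u)"
  then obtain e where de: "(d, e) \<in> regular_subdiff g (x, u)" using at_point(4)[OF assms] by auto
  have "d \<in> regular_subdiff (\<lambda>x. g (x, u)) x"
    unfolding regular_subdiff_def mem_Collect_eq
  proof (intro conjI allI impI at_point(2)[OF assms])
    fix r :: real assume "r > 0"
    then have "\<forall>\<^sub>F y in nhds (x, u). g (x, u) + ereal ((d, e) \<bullet> (y - (x, u)) - r * norm (y - (x, u))) \<le> g y"
      using de unfolding regular_subdiff_def by blast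
    moreover have "filterlim (\<lambda>y. (y, u)) (nhds (x, u)) (nhds x)"
      by (intro tendsto_Pair filterlim_ident tendsto_const)
    ultimately have "\<forall>\<^sub>F y in nhds x. g (x, u) + ereal ((d, e) \<bullet> ((y, u) - (x, u)) - r * norm ((y, u) - (x, u))) \<le> g (y, u)"
      by (rule eventually_compose_filterlim)
    then show "\<forall>\<^sub>F y in nhds x. g (x, u) + ereal (d \<bullet> (y - x) - r * norm (y - x)) \<le> g (y, u)"
      by (simp add: norm_Pair)
  qed
  then show "d \<in> convex_subdiff (\<lambda>x. g (x, u)) x"
    using convex_subdiff_if_regular[of "\<lambda>x. g (x, u)"] cv[OF assms(2)] by blast
qed

text \<open>A projection of a closed set need not be closed. Here all subgradients share the
  component \<open>e\<close>, so the projection is also a slice of the closed cone of regular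
  normals.\<close>

lemma fst_subdiff_closed_convex:
  assumes "x \<in> M" "u \<in> \<Omega>"
  shows "closed (fst ` subdiff g (x, u))" "convex (fst ` subdiff g (x, u))" "fst ` subdiff g (x, u) \<noteq> {}"
proof -
  show "convex (fst ` subdiff g (x, u))"
    unfolding at_point(4)[OF assms] by (intro convex_linear_image linear_fst convex_regular_subdiff)
  show ne: "fst ` subdiff g (x, u) \<noteq> {}" using at_point(3)[OF assms] by simp
  obtain r where r: "g (x, u) = ereal r" using at_point(2)[OF assms] by (cases "g (x, u)") auto
  obtain d e where de: "(d, e) \<in> subdiff g (x, u)" using ne by auto
  have "d' \<in> fst ` subdiff g (x, u) \<longleftrightarrow> ((d', e), -1) \<in> regular_normals (epi g) ((x, u), r)" for d'
  proof
    assume "d' \<in> fst ` subdiff g (x, u)"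
    then obtain e' where e': "(d', e') \<in> subdiff g (x, u)" by auto
    with subdiff_diff(2)[OF assms de] have "e' = e" by simp
    then show "((d', e), -1) \<in> regular_normals (epi g) ((x, u), r)"
      using e' unfolding at_point(4)[OF assms] regular_subdiff_iff[where h=g and x="(x,u)", OF r] by simp
  next
    assume "((d', e), -1) \<in> regular_normals (epi g) ((x, u), r)"
    then have "(d', e) \<in> subdiff g (x, u)"
      unfolding at_point(4)[OF assms] regular_subdiff_iff[where h=g and x="(x,u)", OF r] .
    then show "d' \<in> fst ` subdiff g (x, u)" by force
  qed
  then have "fst ` subdiff g (x, u) = (\<lambda>d'. ((d', e), -1)) -` regular_normals (epi g) ((x, u), r)" by blast
  then show "closed (fst ` subdiff g (x, u))"
    by (simp add: closed_vimage[OF closed_regular_normals] continuous_on_Pair continuous_on_id)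
qed

text \<open>Penalizing \<open>u' \<noteq> u\<close> turns a partial subgradient into regular subgradients
  \<open>(v - (x\<^sub>k - x), \<lambda>\<^sub>k)\<close> of \<open>g\<close> at points tending to \<open>(x, u)\<close>. If the \<open>\<lambda>\<^sub>k\<close> were unbounded, a
  horizontal normal \<open>((0, \<lambda>), 0)\<close> with \<open>\<lambda> \<noteq> 0\<close> would arise, and adding it to a subgradient would contradict
  \<open>par (\<partial>g) = N \<times> {0}\<close>.\<close>

lemma partial_subdiff_subset:
  assumes x: "x \<in> M" and u: "u \<in> \<Omega>" and v: "v \<in> convex_subdiff (\<lambda>x. g (x, u)) x"
  shows "v \<in> fst ` subdiff g (x, u)"
proof -
  note pt = at_point[OF x u]
  define z0 where "z0 = (x, u)"
  obtain r0 where r0: "g z0 = ereal r0" using pt(2) by (cases "g (x, u)") (auto simp: z0_def)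
  \<comment> \<open>On the slice of \<open>u\<close> the linear term makes \<open>x\<close> a
    minimizer of \<open>g + \<kappa>\<close> by the subgradient inequality, and the square makes it
    the only one; the factor \<open>k\<close> penalizes leaving the slice.\<close>
  define \<kappa> where "\<kappa> k z = - (v \<bullet> (fst z - x)) + (1/2) * (norm (fst z - x))\<^sup>2 + k * (norm (snd z - u))\<^sup>2" for k :: real and z
  have \<kappa>0: "\<kappa> k z0 = 0" for k by (simp add: \<kappa>_def z0_def)
  have cont: "continuous_on UNIV (\<kappa> k)" for k unfolding \<kappa>_def by (intro continuous_intros)
  have \<kappa>lim: "(\<lambda>n. \<kappa> 0 (X n)) \<longlonglongrightarrow> \<kappa> 0 l" if "X \<longlonglongrightarrow> l" for X :: "nat \<Rightarrow> _" and l
    using continuous_on_tendsto_compose[OF cont[of 0] that] by simp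
  have cl: "closed (epi g)" by (rule closed_epi[OF pt(1)])
  have nm: "g y \<noteq> -\<infinity>" for y using pt(1) unfolding proper_lsc_def by blast
  have "\<exists>z\<in>cball z0 1. \<forall>y\<in>cball z0 1. g z + ereal (\<kappa> k z) \<le> g y + ereal (\<kappa> k y)" for k
    using lsc_attains_min[of g "cball z0 1", OF cl nm _ _ cont[of k]] by (metis centre_in_cball compact_cball empty_iff zero_le_one)
  then obtain Z where Z: "\<And>k. Z k \<in> cball z0 1"
    "\<And>k y. y \<in> cball z0 1 \<Longrightarrow> g (Z k) + ereal (\<kappa> k (Z k)) \<le> g y + ereal (\<kappa> k y)" by metis
  have Zle: "g (Z k) + ereal (\<kappa> k (Z k)) \<le> ereal r0" for k
    using Z(2)[of z0 k] by (simp add: \<kappa>0 r0)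
  define R where "R k = real_of_ereal (g (Z k))" for k
  have R: "g (Z k) = ereal (R k)" for k
    using Zle[of k] nm[of "Z k"] unfolding R_def by (cases "g (Z k)") auto
  have RZ: "R k + \<kappa> k (Z k) \<le> r0" for k using Zle[of k] by (simp add: R)
  \<comment> \<open>The minimum of the unpenalized objective over the ball. It bounds the penalty
    term at \<open>Z k\<close> by the constant \<open>r0 - m\<close>, which drives
    \<open>snd (Z k)\<close> to \<open>u\<close> as \<open>k\<close> grows.\<close>
  define m where "m = R 0 + \<kappa> 0 (Z 0)"
  have m: "m \<le> R k + \<kappa> 0 (Z k)" for k using Z(2)[OF Z(1)[of k], of 0] by (simp add: R m_def)
  have \<kappa>k: "\<kappa> k z = \<kappa> 0 z + k * (norm (snd z - u))\<^sup>2" for k z by (simp add: \<kappa>_def)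
  have bnd: "k * (norm (snd (Z k) - u))\<^sup>2 \<le> r0 - m" for k using RZ[of k] m[of k] by (simp add: \<kappa>k[of k])
  have Rle: "R k \<le> r0 - \<kappa> 0 (Z k)" if "k \<ge> 0" for k
    using RZ[of k] mult_nonneg_nonneg[OF that zero_le_power2[of "norm (snd (Z k) - u)"]] by (simp only: \<kappa>k[of k])
  \<comment> \<open>Minus the gradient of the penalty, which becomes the u-component of the
    subgradient at \<open>Z k\<close>. Rescaling by \<open>s k\<close> keeps it bounded, and
    \<open>s k + norm (s k *\<^sub>R lam k) = 1\<close> prevents both limits from vanishing.\<close>
  define lam where "lam k = (- 2 * k) *\<^sub>R (snd (Z k) - u)" for k
  define s where "s k = 1 / (1 + norm (lam k))" for k
  have s: "0 < s k" "s k \<le> 1" "s k + norm (s k *\<^sub>R lam k) = 1" for k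
  proof -
    have p: "1 + norm (lam k) > 0" by (simp add: add_pos_nonneg)
    then show "0 < s k" "s k \<le> 1" by (auto simp: s_def divide_simps)
    show "s k + norm (s k *\<^sub>R lam k) = 1" using p less_imp_neq[OF p] by (simp add: s_def field_simps)
  qed
  define Y where "Y n = (Z (real n), s (real n), s (real n) *\<^sub>R lam (real n))" for n :: nat
  have "compact (cball z0 1 \<times> {0..1::real} \<times> cball (0::'u) 1)"
    by (intro compact_Times compact_cball compact_Icc)
  moreover have "Y n \<in> cball z0 1 \<times> {0..1} \<times> cball 0 1" for n
    unfolding Y_def using Z(1)[of "real n"] s[of "real n"] by auto
  ultimately obtain l \<sigma> where \<sigma>: "l \<in> cball z0 1 \<times> {0..1} \<times> cball 0 1" "strict_mono (\<sigma> :: nat \<Rightarrow> nat)" "(Y \<circ> \<sigma>) \<longlonglongrightarrow> l"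
    unfolding compact_def by meson
  define zb where "zb = fst l"
  define sb where "sb = fst (snd l)"
  define lb where "lb = snd (snd l)"
  define K where "K n = real (\<sigma> n)" for n
  have YK: "Y (\<sigma> n) = (Z (K n), s (K n), s (K n) *\<^sub>R lam (K n))" for n by (simp add: Y_def K_def)
  have limZ: "(\<lambda>n. Z (K n)) \<longlonglongrightarrow> zb" and lims: "(\<lambda>n. s (K n)) \<longlonglongrightarrow> sb"
    and liml: "(\<lambda>n. s (K n) *\<^sub>R lam (K n)) \<longlonglongrightarrow> lb"
    using tendsto_fst[OF \<sigma>(3)] tendsto_fst[OF tendsto_snd[OF \<sigma>(3)]] tendsto_snd[OF tendsto_snd[OF \<sigma>(3)]]
    by (simp_all add: o_def YK zb_def sb_def lb_def)
  have K0: "K n \<ge> 0" for n by (simp add: K_def)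
  have Kinf: "filterlim K at_top sequentially"
    unfolding K_def using \<sigma>(2) by (intro filterlim_compose[OF filterlim_real_sequentially] filterlim_subseq)
  have "snd zb = u"
  proof -
    have l1: "(\<lambda>n. (norm (snd (Z (K n)) - u))\<^sup>2) \<longlonglongrightarrow> (norm (snd zb - u))\<^sup>2"
      by (intro tendsto_intros limZ)
    have "(\<lambda>n. (r0 - m) / K n) \<longlonglongrightarrow> 0"
      by (intro real_tendsto_divide_at_top[OF tendsto_const] Kinf)
    moreover have "\<forall>\<^sub>F n in sequentially. (norm (snd (Z (K n)) - u))\<^sup>2 \<le> (r0 - m) / K n"
      using Kinf[unfolded filterlim_at_top_dense, rule_format, of 0]
    proof eventually_elim
      case (elim n)
      then show ?case using bnd[of "K n"] by (simp add: pos_le_divide_eq mult.commute)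
    qed
    ultimately have "(norm (snd zb - u))\<^sup>2 \<le> 0"
      using tendsto_le[OF sequentially_bot _ l1] by blast
    then show ?thesis by simp
  qed
  moreover have "fst zb = x"
  proof -
    have "(\<lambda>n. (Z (K n), r0 - \<kappa> 0 (Z (K n)))) \<longlonglongrightarrow> (zb, r0 - \<kappa> 0 zb)"
      by (intro tendsto_Pair tendsto_diff tendsto_const \<kappa>lim limZ)
    moreover have "(Z (K n), r0 - \<kappa> 0 (Z (K n))) \<in> epi g" for n
      using Rle[OF K0, of n] by (simp add: epi_def R)
    ultimately have "(zb, r0 - \<kappa> 0 zb) \<in> epi g"
      by (rule closed_sequentially[OF cl, rotated])
    then have "g (fst zb, u) \<le> ereal (r0 - \<kappa> 0 zb)" using \<open>snd zb = u\<close> by (cases zb) (auto simp: epi_def)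
    moreover have "ereal (r0 + v \<bullet> (fst zb - x)) \<le> g (fst zb, u)"
      using v r0 unfolding convex_subdiff_def z0_def by auto
    ultimately have "ereal (r0 + v \<bullet> (fst zb - x)) \<le> ereal (r0 - \<kappa> 0 zb)" by (rule order_trans[rotated])
    then have "(norm (fst zb - x))\<^sup>2 \<le> 0" by (simp add: \<kappa>_def)
    then show ?thesis by simp
  qed
  ultimately have zb: "zb = z0" by (simp add: z0_def prod_eq_iff)
  \<comment> \<open>Limiting normals require convergence of epigraph points, hence of the values
    too: closedness of the epigraph bounds them from below, minimality of \<open>Z k\<close> from
    above.\<close>
  have limR: "(\<lambda>n. R (K n)) \<longlonglongrightarrow> r0"
  proof (rule order_tendstoI)
    fix a assume "a < r0"
    then have "(z0, a) \<in> - epi g" by (simp add: epi_def r0)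
    moreover have "(\<lambda>n. (Z (K n), a)) \<longlonglongrightarrow> (z0, a)"
      using limZ zb by (intro tendsto_Pair tendsto_const) simp
    ultimately have "\<forall>\<^sub>F n in sequentially. (Z (K n), a) \<in> - epi g"
      using topological_tendstoD cl open_Compl by blast
    then show "\<forall>\<^sub>F n in sequentially. a < R (K n)"
      by eventually_elim (simp add: epi_def R not_le)
  next
    fix a assume a: "r0 < a"
    have "(\<lambda>n. r0 - \<kappa> 0 (Z (K n))) \<longlonglongrightarrow> r0 - \<kappa> 0 z0"
      using limZ zb by (intro tendsto_diff tendsto_const \<kappa>lim) simp
    then have "\<forall>\<^sub>F n in sequentially. r0 - \<kappa> 0 (Z (K n)) < a"
      using a by (simp add: order_tendstoD \<kappa>0)
    then show "\<forall>\<^sub>F n in sequentially. R (K n) < a"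
      by eventually_elim (use Rle[OF K0] in \<open>meson order_le_less_trans\<close>)
  qed
  \<comment> \<open>Minus the gradient of \<open>\<kappa> k\<close> at \<open>Z k\<close>. At a
    minimizer of \<open>g + \<kappa> k\<close> inside the ball it is a regular subgradient of
    \<open>g\<close>, because \<open>\<kappa> k\<close> differs from its linearization by a
    quadratic term.\<close>
  define G where "G k = (v - (fst (Z k) - x), lam k)" for k
  have sub: "G k \<in> regular_subdiff g (Z k)" if k: "k \<ge> 0" and Zb: "Z k \<in> ball z0 1" for k
    unfolding regular_subdiff_def mem_Collect_eq
  proof (intro conjI allI impI)
    show "\<bar>g (Z k)\<bar> \<noteq> \<infinity>" by (simp add: R)
    fix e :: real assume e: "e > 0"
    define c where "c = 1/2 + k"
    have c: "c > 0" using k by (simp add: c_def)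
    have "\<forall>\<^sub>F y in nhds (Z k). y \<in> ball z0 1 \<inter> ball (Z k) (e / c)"
      by (rule eventually_nhds_in_open) (use Zb e c in auto)
    then show "\<forall>\<^sub>F y in nhds (Z k). g (Z k) + ereal (G k \<bullet> (y - Z k) - e * norm (y - Z k)) \<le> g y"
    proof eventually_elim
      case (elim y)
      have id: "(norm (a - c))\<^sup>2 = (norm (b - c))\<^sup>2 + 2 * ((b - c) \<bullet> (a - b)) + (norm (a - b))\<^sup>2"
        for a b c :: "'c::real_inner"
        by (simp add: power2_norm_eq_inner inner_diff_left inner_diff_right inner_commute)
      have "\<kappa> k y = \<kappa> k (Z k) - v \<bullet> (fst y - fst (Z k))
          + (fst (Z k) - x) \<bullet> (fst y - fst (Z k)) + 1/2 * (norm (fst y - fst (Z k)))\<^sup>2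
          + k * (2 * ((snd (Z k) - u) \<bullet> (snd y - snd (Z k))) + (norm (snd y - snd (Z k)))\<^sup>2)"
        unfolding \<kappa>_def id[of "fst y" x "fst (Z k)"] id[of "snd y" u "snd (Z k)"]
        by (simp add: inner_diff_right algebra_simps)
      also have "\<dots> = \<kappa> k (Z k) - G k \<bullet> (y - Z k) + (1/2 * (norm (fst y - fst (Z k)))\<^sup>2 + k * (norm (snd y - snd (Z k)))\<^sup>2)"
        by (simp add: G_def inner_prod_def lam_def inner_diff_left algebra_simps)
      finally have eq: "\<kappa> k y = \<kappa> k (Z k) - G k \<bullet> (y - Z k) + (1/2 * (norm (fst y - fst (Z k)))\<^sup>2 + k * (norm (snd y - snd (Z k)))\<^sup>2)" .
      have "(norm (y - Z k))\<^sup>2 = (norm (fst y - fst (Z k)))\<^sup>2 + (norm (snd y - snd (Z k)))\<^sup>2"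
        by (simp add: norm_prod_def)
      then have "1/2 * (norm (fst y - fst (Z k)))\<^sup>2 + k * (norm (snd y - snd (Z k)))\<^sup>2 \<le> c * (norm (y - Z k))\<^sup>2"
        using k by (simp add: c_def algebra_simps)
      also have "\<dots> \<le> e * norm (y - Z k)"
      proof -
        have "norm (y - Z k) \<le> e / c" using elim by (simp add: dist_norm norm_minus_commute)
        then have "c * norm (y - Z k) \<le> e" using c by (simp add: field_simps)
        then show ?thesis using mult_right_mono[of "c * norm (y - Z k)" e "norm (y - Z k)"]
          by (simp add: power2_eq_square mult.assoc)
      qed
      finally have "\<kappa> k y \<le> \<kappa> k (Z k) - G k \<bullet> (y - Z k) + e * norm (y - Z k)" using eq by linarith
      moreover have "g (Z k) + ereal (\<kappa> k (Z k)) \<le> g y + ereal (\<kappa> k y)"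
        using Z(2) elim by auto
      ultimately show ?case by (cases "g y") (auto simp: R nm)
    qed
  qed
  have "\<forall>\<^sub>F n in sequentially. Z (K n) \<in> ball z0 1"
    using topological_tendstoD[OF limZ open_ball, of z0 1] zb by simp
  then obtain N where N: "\<And>n. Z (K (n + N)) \<in> ball z0 1"
    unfolding eventually_sequentially by (metis le_add2)
  have "((sb *\<^sub>R v, lb), - sb) \<in> normals (epi g) (z0, r0)"
    unfolding normals_def mem_Collect_eq
  proof (intro exI conjI allI)
    show "(\<lambda>n. (Z (K (n + N)), R (K (n + N)))) \<longlonglongrightarrow> (z0, r0)"
      using LIMSEQ_ignore_initial_segment[OF limZ, of N] LIMSEQ_ignore_initial_segment[OF limR, of N] zb
      by (intro tendsto_Pair) simp_all
    show "(Z (K (n + N)), R (K (n + N))) \<in> epi g" for n by (simp add: epi_def R)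
    show "s (K (n + N)) *\<^sub>R (G (K (n + N)), -1) \<in> regular_normals (epi g) (Z (K (n + N)), R (K (n + N)))" for n
      using regular_subdiff_iff[of g "Z (K (n + N))", OF R] sub[OF K0 N] less_imp_le[OF s(1)]
      by (intro regular_normals_scale) blast+
    have "(\<lambda>n. v - (fst (Z (K n)) - x)) \<longlonglongrightarrow> v - (fst zb - x)" by (intro tendsto_intros limZ)
    then have "(\<lambda>n. ((s (K n) *\<^sub>R (v - (fst (Z (K n)) - x)), s (K n) *\<^sub>R lam (K n)), - s (K n)))
        \<longlonglongrightarrow> ((sb *\<^sub>R v, lb), - sb)"
      using zb z0_def by (intro tendsto_Pair tendsto_scaleR tendsto_minus lims liml) auto
    from LIMSEQ_ignore_initial_segment[OF this, of N]
    show "(\<lambda>n. s (K (n + N)) *\<^sub>R (G (K (n + N)), -1)) \<longlonglongrightarrow> ((sb *\<^sub>R v, lb), - sb)"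
      by (simp add: G_def)
  qed
  moreover have "normals (epi g) (z0, r0) = regular_normals (epi g) (z0, r0)"
    using pt(5) r0 unfolding subdiff_regular_def clarke_regular_def z0_def by simp
  ultimately have nrm: "((sb *\<^sub>R v, lb), - sb) \<in> regular_normals (epi g) (z0, r0)" by simp
  have "(\<lambda>n. s (K n) + norm (s (K n) *\<^sub>R lam (K n))) \<longlonglongrightarrow> sb + norm lb"
    by (intro tendsto_intros lims liml)
  then have sum1: "sb + norm lb = 1" unfolding s(3) by (simp add: LIMSEQ_const_iff)
  have iff: "w \<in> subdiff g (x, u) \<longleftrightarrow> (w, -1) \<in> regular_normals (epi g) (z0, r0)" for w
    using regular_subdiff_iff[of g z0, OF r0] pt(4) by (simp add: z0_def)
  have "sb \<noteq> 0"
  proof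
    assume sb: "sb = 0"
    obtain d e where de: "(d, e) \<in> subdiff g (x, u)" using pt(3) by auto
    then have "((d, e), -1) + ((sb *\<^sub>R v, lb), - sb) \<in> regular_normals (epi g) (z0, r0)"
      using iff nrm by (intro regular_normals_add) auto
    then have "(d, e + lb) \<in> subdiff g (x, u)" using sb by (simp add: iff)
    from subdiff_diff(2)[OF x u de this] have "lb = 0" by simp
    then show False using sum1 sb by simp
  qed
  moreover have "sb \<ge> 0" using \<sigma>(1) by (auto simp: sb_def)
  ultimately have sb: "sb > 0" by simp
  have "(1 / sb) *\<^sub>R ((sb *\<^sub>R v, lb), - sb) \<in> regular_normals (epi g) (z0, r0)"
    using nrm sb by (intro regular_normals_scale) auto
  then have "(v, (1 / sb) *\<^sub>R lb) \<in> subdiff g (x, u)" using sb by (simp add: iff)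
  then show ?thesis by force
qed

lemma partial_subdiff:
  assumes "x \<in> M" "u \<in> \<Omega>"
  shows "convex_subdiff (\<lambda>x. g (x, u)) x = fst ` subdiff g (x, u)"
  using fst_subdiff[OF assms] partial_subdiff_subset[OF assms] by blast

text \<open>If \<open>w\<close> violated the conclusion along a sequence, the normals separating it from the subdifferential would
  converge to a unit normal that supports the limiting subdifferential at its relative interior point \<open>v\<close>.\<close>

lemma subgradient_stability:
  assumes x: "x \<in> M" and u: "u \<in> \<Omega>" and v: "v \<in> rel_interior (convex_subdiff (\<lambda>x. g (x, u)) x)"
  shows "\<exists>\<epsilon>>0. \<forall>p q w d. p \<in> M \<longrightarrow> q \<in> \<Omega> \<longrightarrow> dist p x < \<epsilon> \<longrightarrow> dist q u < \<epsilon> \<longrightarrow> dist w v < \<epsilon> \<longrightarrow>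
    d \<in> convex_subdiff (\<lambda>x. g (x, q)) p \<longrightarrow> w - d \<in> normal_space M p \<longrightarrow> w \<in> convex_subdiff (\<lambda>x. g (x, q)) p"
proof (rule ccontr)
  assume neg: "\<not> ?thesis"
  have "\<exists>p q w d. p \<in> M \<and> q \<in> \<Omega> \<and> dist p x < inverse (Suc n) \<and> dist q u < inverse (Suc n) \<and> dist w v < inverse (Suc n) \<and>
    d \<in> convex_subdiff (\<lambda>x. g (x, q)) p \<and> w - d \<in> normal_space M p \<and> w \<notin> convex_subdiff (\<lambda>x. g (x, q)) p" for n
    using neg[simplified not_ex, THEN spec, of "inverse (real (Suc n))"] by simp
  then obtain p q w d where *: "\<And>n. p n \<in> M" "\<And>n. q n \<in> \<Omega>" "\<And>n. dist (p n) x < inverse (Suc n)"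
    "\<And>n. dist (q n) u < inverse (Suc n)" "\<And>n. dist (w n) v < inverse (Suc n)"
    "\<And>n. d n \<in> convex_subdiff (\<lambda>x. g (x, q n)) (p n)" "\<And>n. w n - d n \<in> normal_space M (p n)"
    "\<And>n. w n \<notin> convex_subdiff (\<lambda>x. g (x, q n)) (p n)"
    by metis
  have lims: "p \<longlonglongrightarrow> x" "q \<longlonglongrightarrow> u" "w \<longlonglongrightarrow> v"
    by (intro LIMSEQ_if_dist_less_inverse *)+
  define D where "D n = fst ` subdiff g (p n, q n)" for n
  have D: "convex_subdiff (\<lambda>x. g (x, q n)) (p n) = D n" for n unfolding D_def by (rule partial_subdiff[OF *(1,2)])
  have Dc: "closed (D n)" "convex (D n)" "D n \<noteq> {}" for n
    unfolding D_def using fst_subdiff_closed_convex[OF *(1,2)] by auto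
  define c where "c n = closest_point (D n) (w n)" for n
  have cD: "c n \<in> D n" for n unfolding c_def using Dc by (simp add: closest_point_in_set)
  have wc: "w n - c n \<noteq> 0" for n using cD[of n] *(8)[of n] by (auto simp: D)
  define a where "a n = (w n - c n) /\<^sub>R norm (w n - c n)" for n
  have na: "norm (a n) = 1" for n using wc[of n] by (simp add: a_def)
  \<comment> \<open>\<open>w n - d n\<close> is normal by assumption, and \<open>d n - c n\<close>
    is normal because any two subgradients differ by a normal vector.\<close>
  have aN: "a n \<in> normal_space M (p n)" for n
  proof -
    obtain e where e: "(d n, e) \<in> subdiff g (p n, q n)" using *(6)[of n] by (auto simp: D D_def)
    obtain e' where e': "(c n, e') \<in> subdiff g (p n, q n)" using cD[of n] by (auto simp: D_def)
    have "(w n - d n) + (d n - c n) \<in> normal_space M (p n)"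
      using subdiff_diff(1)[OF *(1,2) e e'] *(7)[of n] by (intro subspace_add subspace_orthogonal_comp)
    then show ?thesis unfolding a_def by (intro subspace_scale subspace_orthogonal_comp) simp
  qed
  have ale: "a n \<bullet> y \<le> a n \<bullet> w n" if "y \<in> D n" for n y
  proof -
    have "(w n - c n) \<bullet> (y - c n) \<le> 0" unfolding c_def using Dc that by (intro closest_point_dot)
    moreover have "(w n - c n) \<bullet> (w n - c n) \<ge> 0" by simp
    ultimately have "(w n - c n) \<bullet> y \<le> (w n - c n) \<bullet> w n" unfolding inner_diff_right by linarith
    then show ?thesis unfolding a_def by (simp add: mult_left_mono)
  qed
  have "compact (sphere (0::'x) 1)" by simp
  then obtain a0 \<sigma> where \<sigma>: "a0 \<in> sphere 0 1" "strict_mono (\<sigma> :: nat \<Rightarrow> nat)" "(a \<circ> \<sigma>) \<longlonglongrightarrow> a0"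
    unfolding compact_def using na by (metis mem_sphere_0)
  have na0: "norm a0 = 1" using \<sigma>(1) by simp
  have plim: "(\<lambda>n. p (\<sigma> n)) \<longlonglongrightarrow> x" "(\<lambda>n. q (\<sigma> n)) \<longlonglongrightarrow> u" "(\<lambda>n. w (\<sigma> n)) \<longlonglongrightarrow> v" "(\<lambda>n. a (\<sigma> n)) \<longlonglongrightarrow> a0"
    using lims[THEN LIMSEQ_subseq_LIMSEQ[OF _ \<sigma>(2)]] \<sigma>(3) by (simp_all add: o_def)
  obtain V \<phi> \<phi>' S A B where ch: "chart M V \<phi> \<phi>' S A B" "x \<in> V" using chart_exists[OF M x] .
  have a0N: "a0 \<in> normal_space M x"
    using chart.normal_limit[OF ch x plim(1) *(1) aN plim(4)] .
  \<comment> \<open>Inner semicontinuity approximates each subgradient at the limit by subgradients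
    along the sequence, to which the separation \<open>ale\<close> applies.\<close>
  have a0le: "a0 \<bullet> y \<le> a0 \<bullet> v" if yD: "y \<in> fst ` subdiff g (x, u)" for y
  proof -
    obtain e where e: "(y, e) \<in> subdiff g (x, u)" using yD by auto
    have "(\<lambda>n. (p (\<sigma> n), q (\<sigma> n))) \<longlonglongrightarrow> (x, u)" by (intro tendsto_Pair plim)
    moreover have "\<forall>n. (p (\<sigma> n), q (\<sigma> n)) \<in> M \<times> \<Omega>" using * by simp
    ultimately obtain Y where Y: "\<forall>\<^sub>F n in sequentially. Y n \<in> subdiff g (p (\<sigma> n), q (\<sigma> n))" "Y \<longlonglongrightarrow> (y, e)"
      using at_point(7)[OF x u] e unfolding set_continuous_at_within_def by meson
    have "(\<lambda>n. a (\<sigma> n) \<bullet> fst (Y n)) \<longlonglongrightarrow> a0 \<bullet> y"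
      using tendsto_fst[OF Y(2)] by (intro tendsto_inner plim) simp
    moreover have "(\<lambda>n. a (\<sigma> n) \<bullet> w (\<sigma> n)) \<longlonglongrightarrow> a0 \<bullet> v" by (intro tendsto_inner plim)
    moreover have "\<forall>\<^sub>F n in sequentially. a (\<sigma> n) \<bullet> fst (Y n) \<le> a (\<sigma> n) \<bullet> w (\<sigma> n)"
      using Y(1) by eventually_elim (auto intro!: ale simp: D_def)
    ultimately show ?thesis using tendsto_le[OF sequentially_bot] by blast
  qed
  define C where "C = convex_subdiff (\<lambda>x. g (x, u)) x"
  have C: "C = fst ` subdiff g (x, u)" unfolding C_def by (rule partial_subdiff[OF x u])
  obtain e where e: "e > 0" "cball v e \<inter> affine hull C \<subseteq> C" and vC: "v \<in> C"
    using v unfolding C_def[symmetric] mem_rel_interior_cball by blast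
  \<comment> \<open>Being a parallel direction, \<open>a0\<close> can be added in a small multiple
    to the relative interior point \<open>v\<close> without leaving \<open>C\<close>; this breaks
    the bound \<open>a0le\<close>.\<close>
  have "(a0, 0) \<in> par (subdiff g (x, u))" using a0N at_point(6)[OF x u] by blast
  then obtain \<xi> \<eta> where \<xi>: "(a0, 0) = \<xi> - \<eta>" "\<xi> \<in> affine hull (subdiff g (x, u))" "\<eta> \<in> affine hull (subdiff g (x, u))"
    unfolding par_def by blast
  have "fst ` (affine hull (subdiff g (x, u))) = affine hull C"
    unfolding C by (intro affine_hull_linear_image bounded_linear_fst)
  then have "fst \<xi> \<in> affine hull C" "fst \<eta> \<in> affine hull C" using \<xi> by blast+
  moreover have "a0 = fst \<xi> - fst \<eta>" using \<xi>(1) by (metis fst_conv fst_diff)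
  ultimately have "v + e *\<^sub>R a0 \<in> affine hull C"
    using mem_affine_3_minus[OF affine_affine_hull hull_inc[OF vC]] by simp
  moreover have "v + e *\<^sub>R a0 \<in> cball v e" using na0 e(1) by (simp add: dist_norm)
  ultimately have "v + e *\<^sub>R a0 \<in> C" using e(2) by blast
  then have "a0 \<bullet> (v + e *\<^sub>R a0) \<le> a0 \<bullet> v" using a0le C by simp
  then have "e * (a0 \<bullet> a0) \<le> 0" by (simp add: inner_add_right)
  then show False using e(1) na0 by (simp add: mult_le_0_iff flip: power2_norm_eq_inner)
qed

end

section \<open>The proximal map\<close>

text \<open>The increment of \<theta> over \<open>[0, t]\<close> is \<open>t * \<theta>' s\<close>
  for some \<open>s < t\<close>, and a derivative vanishing to first order at 0 keeps this below
  half of \<open>\<kappa> * t\<^sup>2\<close>. It serves to exclude a kernel of the linearized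
  proximal equation.\<close>

lemma no_quadratic_growth_if_flat:
  fixes \<theta> \<theta>' :: "real \<Rightarrow> real"
  assumes der: "\<forall>\<^sub>F t in nhds 0. (\<theta> has_real_derivative \<theta>' t) (at t)"
    and flat: "\<theta>' 0 = 0" "(\<theta>' has_real_derivative 0) (at 0)" and \<kappa>: "0 < \<kappa>"
    and growth: "\<forall>\<^sub>F t in nhds 0. \<theta> 0 + \<kappa> * t\<^sup>2 \<le> \<theta> t"
  shows False
proof -
  obtain d1 where d1: "d1 > 0" "\<And>t. \<bar>t\<bar> < d1 \<Longrightarrow> (\<theta> has_real_derivative \<theta>' t) (at t)"
    using der unfolding eventually_nhds_metric by (auto simp: dist_norm)
  obtain d2 where d2: "d2 > 0" "\<And>t. \<bar>t\<bar> < d2 \<Longrightarrow> \<theta> 0 + \<kappa> * t\<^sup>2 \<le> \<theta> t"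
    using growth unfolding eventually_nhds_metric by (auto simp: dist_norm)
  have "(\<theta>' has_derivative (\<lambda>h. 0)) (at 0)"
    using flat(2) by (simp add: has_field_derivative_def lambda_zero)
  then have "\<exists>d>0. \<forall>t. norm (t - 0) < d \<longrightarrow> norm (\<theta>' t - \<theta>' 0 - 0) \<le> \<kappa>/2 * norm (t - 0)"
    using \<kappa> unfolding has_derivative_at_alt by (metis half_gt_zero)
  then obtain d3 where d3: "d3 > 0" "\<And>t. \<bar>t\<bar> < d3 \<Longrightarrow> \<bar>\<theta>' t\<bar> \<le> \<kappa>/2 * \<bar>t\<bar>"
    using flat(1) by auto
  define t where "t = min d1 (min d2 d3) / 2"
  have t: "0 < t" "t < d1" "t < d2" "t < d3" using d1(1) d2(1) d3(1) by (auto simp: t_def)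
  obtain s where s: "0 < s" "s < t" "\<theta> t - \<theta> 0 = (t - 0) * \<theta>' s"
    using MVT2[of 0 t \<theta> \<theta>'] t d1(2) by auto
  have "\<theta>' s \<le> \<kappa>/2 * s" using d3(2)[of s] s t by auto
  also have "\<dots> \<le> \<kappa>/2 * t" using s \<kappa> by simp
  finally have "t * \<theta>' s \<le> t * (\<kappa>/2 * t)" using t by simp
  moreover have "\<kappa> * t\<^sup>2 \<le> t * \<theta>' s" using d2(2)[of t] t s by simp
  ultimately have "\<kappa> * t\<^sup>2 \<le> \<kappa> * t\<^sup>2 / 2" by (simp add: power2_eq_square algebra_simps)
  then show False using \<kappa> t by simp
qed

text \<open>After expanding the square, the objective at \<open>y\<close> exceeds that at
  \<open>p\<close> by at least half of \<open>(norm (y - p))\<^sup>2\<close>. Strictness matters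
  because \<open>arg_min\<close> selects some minimizer by choice.\<close>

lemma prox_eqI:
  fixes g :: "'x::euclidean_space \<times> 'u \<Rightarrow> ereal"
  assumes \<alpha>: "0 < \<alpha>" and v: "(1 / \<alpha>) *\<^sub>R (w - p) \<in> convex_subdiff (\<lambda>x. g (x, q)) p"
  shows "prox \<alpha> g w q = p"
proof -
  define \<Phi> where "\<Phi> x = ereal \<alpha> * g (x, q) + ereal (1 / 2 * (norm (x - w))\<^sup>2)" for x
  obtain r where r: "g (p, q) = ereal r" using v unfolding convex_subdiff_def by (cases "g (p, q)") auto
  have less: "\<Phi> p < \<Phi> y" if "y \<noteq> p" for y
  proof -
    have "g (p, q) + ereal ((1 / \<alpha>) *\<^sub>R (w - p) \<bullet> (y - p)) \<le> g (y, q)"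
      using v unfolding convex_subdiff_def by blast
    then have le: "ereal (r + (1/\<alpha>) * ((w - p) \<bullet> (y - p))) \<le> g (y, q)" by (simp add: r)
    show ?thesis
    proof (cases "g (y, q)")
      case (real s)
      then have "\<alpha> * (r + (1/\<alpha>) * ((w - p) \<bullet> (y - p))) \<le> \<alpha> * s" using le \<alpha> by simp
      then have "\<alpha> * r + (w - p) \<bullet> (y - p) \<le> \<alpha> * s" using \<alpha> by (simp add: distrib_left)
      moreover have "(norm (y - w))\<^sup>2 = (norm (p - w))\<^sup>2 - 2 * ((w - p) \<bullet> (y - p)) + (norm (y - p))\<^sup>2"
        by (simp add: power2_norm_eq_inner inner_diff_left inner_diff_right inner_commute)
      moreover have "(norm (y - p))\<^sup>2 > 0" using that by simp
      ultimately have "\<alpha> * r + 1/2 * (norm (p - w))\<^sup>2 < \<alpha> * s + 1/2 * (norm (y - w))\<^sup>2" by linarith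
      then show ?thesis by (simp add: \<Phi>_def r real)
    next
      case PInf
      then show ?thesis using \<alpha> by (simp add: \<Phi>_def r)
    next
      case MInf
      then show ?thesis using le by simp
    qed
  qed
  have "(SOME x. is_arg_min \<Phi> (\<lambda>_. True) x) = p"
  proof (rule some_equality)
    show "is_arg_min \<Phi> (\<lambda>_. True) p" unfolding is_arg_min_def using less by (metis less_asym)
    show "x = p" if "is_arg_min \<Phi> (\<lambda>_. True) x" for x
      using that less unfolding is_arg_min_def by blast
  qed
  then show ?thesis unfolding prox_def arg_min_def \<Phi>_def .
qed

lemma tendsto_nhds_if_isCont: "isCont f a \<Longrightarrow> filterlim f (nhds (f a)) (nhds a)"
  by (simp add: isCont_def tendsto_at_iff_tendsto_nhds)

context partly_smooth_family
begin

text \<open>The unknown is a coordinate \<open>y\<close> with parameters \<open>(w, q)\<close>.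
  Adjoining the parameters as identity components lets the inverse function theorem act as an
  implicit function theorem. The second conclusion keeps the optimality certificate on a
  neighbourhood, from which the properties of the derivative are drawn later.\<close>

lemma prox_smooth:
  assumes x: "x \<in> M" and u: "u \<in> \<Omega>" and \<alpha>: "0 < \<alpha>"
    and v: "v \<in> rel_interior (convex_subdiff (\<lambda>x. g (x, u)) x)"
  shows "(\<lambda>z. prox \<alpha> g (fst z) (snd z)) differentiable (at (x + \<alpha> *\<^sub>R v, u))"
    and "\<forall>\<^sub>F z in nhds (x + \<alpha> *\<^sub>R v, u). prox \<alpha> g (fst z) (snd z) \<in> M \<and> snd z \<in> \<Omega> \<and>
      (1 / \<alpha>) *\<^sub>R (fst z - prox \<alpha> g (fst z) (snd z))
        \<in> convex_subdiff (\<lambda>x. g (x, snd z)) (prox \<alpha> g (fst z) (snd z))"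
proof -
  obtain V \<phi> \<phi>' S A B where ch: "chart M V \<phi> \<phi>' S A B" and xV: "x \<in> V" using chart_exists[OF M x] .
  interpret chart M V \<phi> \<phi>' S A B by (rule ch)
  obtain k where "C2_extension g (M \<times> \<Omega>) (x, u) k" using at_point(8)[OF x u] by (elim exE)
  then obtain V' where V': "(x, u) \<in> V'" "C2_on k V'" "\<forall>y\<in>(M \<times> \<Omega>) \<inter> V'. g y = ereal (k y)"
    unfolding C2_extension_def by (elim exE conjE)
  obtain E where oV': "open V'" and E: "\<forall>z\<in>V'. (k has_derivative blinfun_apply (E z)) (at z)" and E1: "C1_on E V'"
    using V'(2) unfolding C2_on_def by (elim exE conjE)
  \<comment> \<open>The gradient in \<open>x\<close> of the smooth extension \<open>k\<close>. Near
    the base point every partial subgradient at a point of \<open>M\<close> has the same tangential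
    part as \<open>G\<close>.\<close>
  define G where "G z = (\<Sum>b\<in>Basis. E z (b, 0) *\<^sub>R b)" for z
  have linE: "linear (\<lambda>a. E z (a, 0))" for z
    by (intro bounded_linear.linear bounded_linear_compose[OF blinfun.bounded_linear_right]
        bounded_linear_Pair bounded_linear_ident bounded_linear_zero)
  have EG: "E z (a, 0) = a \<bullet> G z" for z a
    unfolding G_def using linear_functional_representation[OF linE, of z a] by (simp add: inner_commute)
  have kder: "((\<lambda>p. k (p, q)) has_derivative (\<lambda>h. h \<bullet> G (p, q))) (at p)" if "(p, q) \<in> V'" for p q
  proof -
    from has_derivative_compose[OF has_derivative_insert_left bspec[OF E that]] show ?thesis by (simp add: EG)
  qed
  have subgrad: "d - G (p, q) \<in> normal_space M p"
    if p: "p \<in> M" "q \<in> \<Omega>" "(p, q) \<in> V'" and d: "d \<in> convex_subdiff (\<lambda>x. g (x, q)) p" for p q d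
  proof (rule convex_subdiff_minus_gradient_normal[OF p(1) kder[OF p(3)] _ d])
    have "filterlim (\<lambda>y. (y, q)) (nhds (p, q)) (nhds p)"
      by (intro tendsto_Pair filterlim_ident tendsto_const)
    from eventually_compose_filterlim[OF eventually_nhds_in_open[OF oV' p(3)] this]
    show "\<forall>\<^sub>F y in nhds p. y \<in> M \<longrightarrow> g (y, q) = ereal (k (y, q))"
      by eventually_elim (use V'(3) p(2) in auto)
  qed
  define y0 where "y0 = \<phi> x"
  define w0 where "w0 = x + \<alpha> *\<^sub>R v"
  have y0: "y0 \<in> \<phi> ` V" "y0 \<in> S" "\<phi>' y0 = x"
    using xV x in_M_iff inv by (auto simp: y0_def)
  define dh where "dh y w q c = \<alpha> * E (\<phi>' y, q) (B y c, 0) + (\<phi>' y - w) \<bullet> B y c" for y w q c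
  \<comment> \<open>\<open>\<Psi>\<close> vanishes exactly if \<open>y \<in> S\<close> and \<open>dh\<close>, the differential in \<open>y\<close> of the objective, vanishes on \<open>S\<close>.\<close>
  define \<Psi> where "\<Psi> t = (\<Sum>b\<in>Basis. dh (fst t) (fst (snd t)) (snd (snd t)) (proj S b) *\<^sub>R b) + (fst t - proj S (fst t))"
    for t :: "'x \<times> 'x \<times> 'u"
  have linp: "linear (proj S)" by (rule proj_linear[OF S])
  have lindh: "linear (dh y w q)" for y w q
    unfolding dh_def EG
    by (rule linearI) (simp_all add: blinfun.add_right blinfun.scaleR_right inner_add_left inner_add_right algebra_simps)
  \<comment> \<open>For \<open>n\<close> in \<open>S\<close> only the differential remains, for
    \<open>n\<close> orthogonal to \<open>S\<close> only the second summand; the tangential and the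
    transversal equations thus separate.\<close>
  have \<Psi>_inner: "\<Psi> (y, w, q) \<bullet> n = dh y w q (proj S n) + (y - proj S y) \<bullet> n" for y w q n
    using linear_functional_representation[OF linear_compose[OF linp lindh], of y w q n]
    by (simp add: \<Psi>_def inner_add_left o_def)
  define Op where "Op = (\<phi> ` V \<times> UNIV) \<inter> (\<lambda>t::'x\<times>'x\<times>'u. (\<phi>' (fst t), snd (snd t))) -` V'"
  have Op_iff: "(y, w, q) \<in> Op \<longleftrightarrow> y \<in> \<phi> ` V \<and> (\<phi>' y, q) \<in> V'" for y w q by (auto simp: Op_def)
  have oOp: "open Op"
    unfolding Op_def
  proof (rule continuous_open_preimage[OF _ _ oV'])
    show "continuous_on (\<phi> ` V \<times> UNIV) (\<lambda>t::'x\<times>'x\<times>'u. (\<phi>' (fst t), snd (snd t)))"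
      by (intro continuous_on_Pair continuous_on_compose2[OF cont_phi'] continuous_on_fst continuous_on_snd continuous_on_id)
        auto
  qed (intro open_Times W open_UNIV)
  have c\<phi>: "C1_on \<phi>' (\<phi> ` V)" by (rule C1_onI[OF W B cont_B])
  have f1: "C1_on (\<lambda>t. fst t) Op" by (rule C1_on_linear[OF bounded_linear_fst oOp])
  have f2: "C1_on (\<lambda>t. - fst (snd t)) Op"
    by (intro C1_on_linear oOp bounded_linear_minus bounded_linear_compose[OF bounded_linear_fst] bounded_linear_snd)
  have f3: "C1_on (\<lambda>t. snd (snd t)) Op"
    by (intro C1_on_linear oOp bounded_linear_compose[OF bounded_linear_snd] bounded_linear_snd)
  have f4: "C1_on (\<lambda>t. \<phi>' (fst t)) Op" by (rule C1_on_compose[OF f1 c\<phi>]) (auto simp: Op_def)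
  have f5: "C1_on (\<lambda>t. B (fst t) s) Op" for s
    by (rule C1_on_bilinear[OF bounded_bilinear_blinfun_apply _ C1_on_const[OF oOp]],
        rule C1_on_compose[OF f1 B1]) (auto simp: Op_def)
  have f6: "C1_on (\<lambda>t. E (\<phi>' (fst t), snd (snd t))) Op"
    by (rule C1_on_compose[OF C1_on_Pair[OF f4 f3] E1]) (auto simp: Op_def)
  have f7: "C1_on (\<lambda>t. E (\<phi>' (fst t), snd (snd t)) (B (fst t) s, 0)) Op" for s
    by (rule C1_on_bilinear[OF bounded_bilinear_blinfun_apply f6 C1_on_Pair[OF f5 C1_on_const[OF oOp]]])
  have f8: "C1_on (\<lambda>t. \<alpha> * E (\<phi>' (fst t), snd (snd t)) (B (fst t) s, 0)) Op" for s
    by (rule C1_on_bilinear[OF bounded_bilinear_mult C1_on_const[OF oOp] f7])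
  have f9: "C1_on (\<lambda>t. \<phi>' (fst t) - fst (snd t)) Op" using C1_on_add[OF f4 f2] by simp
  have f10: "C1_on (\<lambda>t. dh (fst t) (fst (snd t)) (snd (snd t)) s) Op" for s
    unfolding dh_def by (rule C1_on_add[OF f8 C1_on_bilinear[OF bounded_bilinear_inner f9 f5]])
  have f11: "C1_on (\<lambda>t. \<Sum>b\<in>Basis. dh (fst t) (fst (snd t)) (snd (snd t)) (proj S b) *\<^sub>R b) Op"
    by (intro C1_on_sum finite_Basis oOp C1_on_bilinear[OF bounded_bilinear_scaleR f10 C1_on_const[OF oOp]])
  have blp: "bounded_linear (proj S)" using linp linear_conv_bounded_linear by blast
  have f12: "C1_on (\<lambda>t::'x\<times>'x\<times>'u. fst t - proj S (fst t)) Op"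
    by (intro C1_on_linear oOp bounded_linear_sub bounded_linear_fst bounded_linear_compose[OF blp])
  have f13: "C1_on \<Psi> Op" unfolding \<Psi>_def by (rule C1_on_add[OF f11 f12])
  define F where "F t = (\<Psi> t, snd t)" for t
  have f14: "C1_on F Op" unfolding F_def by (rule C1_on_Pair[OF f13 C1_on_linear[OF bounded_linear_snd oOp]])
  obtain F' where F': "\<forall>t\<in>Op. (F has_derivative blinfun_apply (F' t)) (at t)" "continuous_on Op F'"
    using f14 unfolding C1_on_def by (elim conjE exE)
  define t0 where "t0 = (y0, w0, u)"
  have t0: "t0 \<in> Op" using y0 V'(1) by (simp add: t0_def Op_iff)
  have v0: "v - G (x, u) \<in> normal_space M x"
    using v rel_interior_subset by (intro subgrad x u V') blast
  \<comment> \<open>The base point enters here: \<open>w0 - x\<close> is \<alpha> times the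
    subgradient \<open>v\<close>, whose tangential part is that of \<open>G\<close>.\<close>
  have crit: "dh y0 w0 u s = 0" if "s \<in> S" for s
  proof -
    have "B y0 s \<in> tangent_space M x" unfolding tangent[OF xV x] y0_def using that by blast
    then have "B y0 s \<bullet> (v - G (x, u)) = 0" using v0 by (auto simp: orthogonal_comp_def orthogonal_def)
    then have "B y0 s \<bullet> G (x, u) = B y0 s \<bullet> v" by (simp add: inner_diff_right)
    then show ?thesis unfolding dh_def y0(3) EG by (simp add: w0_def inner_commute)
  qed
  have \<Psi>0: "\<Psi> t0 = 0"
  proof -
    have "proj S y0 = y0" using y0(2) by (rule closest_point_self)
    then have "\<Psi> t0 \<bullet> n = 0" for n
      unfolding t0_def \<Psi>_inner by (simp add: crit proj_in[OF S])
    from this[of "\<Psi> t0"] show ?thesis by simp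
  qed
  have Ft0: "F t0 = (0, w0, u)" using \<Psi>0 by (simp add: F_def t0_def)
  have nonsing: "h = 0" if h: "F' t0 h = 0" for h
  proof -
    have s1: "((\<lambda>t. snd (F t)) has_derivative (\<lambda>h. snd (F' t0 h))) (at t0)"
      by (rule has_derivative_snd[OF bspec[OF F'(1) t0]])
    have s2: "((\<lambda>t. snd (F t)) has_derivative (\<lambda>h. snd h)) (at t0)"
      unfolding F_def snd_conv by (rule has_derivative_snd[OF has_derivative_ident])
    from fun_cong[OF has_derivative_unique[OF s1 s2], of h] have h2: "snd h = 0" using h by simp
    define c where "c = fst h"
    have hc: "h = (c, 0)" using h2 by (simp add: c_def prod_eq_iff)
    define K where "K a = fst (F' t0 (a, 0))" for a
    have Kc: "K c = 0" using h by (simp add: K_def hc)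
    have \<psi>der: "((\<lambda>y. \<Psi> (y, w0, u)) has_derivative K) (at y0)"
    proof -
      have p2: "(F has_derivative F' t0) (at (y0, w0, u))" using bspec[OF F'(1) t0] by (simp add: t0_def)
      have "((\<lambda>y. fst (F (y, w0, u))) has_derivative (\<lambda>a. fst (F' t0 (a, 0)))) (at y0)"
        by (rule has_derivative_fst[OF has_derivative_compose[OF has_derivative_insert_left p2]])
      then show ?thesis by (simp add: F_def K_def[abs_def])
    qed
    \<comment> \<open>Along a vector \<open>n\<close> orthogonal to \<open>S\<close> the component
      of \<Psi> is just \<open>y \<bullet> n\<close>, so a kernel vector has no part outside
      \<open>S\<close>.\<close>
    have cS: "c \<in> S"
    proof -
      define n where "n = c - proj S c"
      have nS: "n \<bullet> s = 0" if "s \<in> S" for s unfolding n_def by (rule proj_orth[OF S that])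
      have pn: "proj S n = 0" by (rule proj_unique[OF S subspace_0[OF S]]) (simp add: nS)
      have "\<Psi> (y, w0, u) \<bullet> n = y \<bullet> n" for y
        unfolding \<Psi>_inner pn using nS[OF proj_in[OF S], of y] lindh[THEN linear_0]
        by (simp add: inner_diff_left inner_diff_right inner_commute)
      then have "((\<lambda>y. y \<bullet> n) has_derivative (\<lambda>a. K a \<bullet> n)) (at y0)"
        using has_derivative_inner_left[OF \<psi>der, of n] by simp
      from fun_cong[OF has_derivative_unique[OF this has_derivative_inner_left[OF has_derivative_ident]], of c] have "c \<bullet> n = 0" using Kc by simp
      then have "n \<bullet> n = 0" using nS[OF proj_in[OF S], of c] by (simp add: n_def inner_diff_left inner_commute)
      then show ?thesis using proj_in[OF S, of c] by (simp add: n_def)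
    qed
    have "c = 0"
    proof (rule ccontr)
      assume c0: "c \<noteq> 0"
      \<comment> \<open>The objective would be flat to second order along \<open>c\<close>, but by convexity of \<open>g\<close> it grows quadratically.\<close>
      define L where "L t = y0 + t *\<^sub>R c" for t :: real
      have LS: "L t \<in> S" for t unfolding L_def by (intro subspace_add subspace_scale S y0 cS)
      have L0: "L 0 = y0" by (simp add: L_def)
      have Lder: "(L has_derivative (\<lambda>s. s *\<^sub>R c)) (at t)" for t
        unfolding L_def by (rule has_derivative_line)
      have "filterlim (\<lambda>t. (L t, w0, u)) (nhds (L 0, w0, u)) (nhds 0)"
        by (intro tendsto_Pair tendsto_const tendsto_nhds_if_isCont has_derivative_continuous[OF Lder])
      then have evO: "\<forall>\<^sub>F t in nhds 0. (L t, w0, u) \<in> Op"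
        using eventually_compose_filterlim[OF eventually_nhds_in_open[OF oOp t0]] by (simp add: L0 t0_def)
      define h where "h y = \<alpha> * k (\<phi>' y, u) + 1/2 * ((\<phi>' y - w0) \<bullet> (\<phi>' y - w0))" for y
      have hder: "(h has_derivative dh y w0 u) (at y)" if y: "(y, w0, u) \<in> Op" for y
      proof -
        have y': "y \<in> \<phi> ` V" "(\<phi>' y, u) \<in> V'" using y by (auto simp: Op_iff)
        have "((\<lambda>y. (\<phi>' y, u)) has_derivative (\<lambda>a. (B y a, 0))) (at y)"
          by (intro has_derivative_Pair has_derivative_const B y')
        from has_derivative_compose[OF this bspec[OF E y'(2)]]
        have k1: "((\<lambda>y. k (\<phi>' y, u)) has_derivative (\<lambda>a. E (\<phi>' y, u) (B y a, 0))) (at y)" .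
        have k2: "((\<lambda>y. \<phi>' y - w0) has_derivative (\<lambda>a. B y a)) (at y)"
          using has_derivative_diff[OF B[OF y'(1)] has_derivative_const[of w0]] by simp
        have "(h has_derivative (\<lambda>a. \<alpha> * E (\<phi>' y, u) (B y a, 0) + 1/2 * ((\<phi>' y - w0) \<bullet> B y a + B y a \<bullet> (\<phi>' y - w0)))) (at y)"
          unfolding h_def by (intro has_derivative_add has_derivative_mult_right k1 has_derivative_inner[OF k2 k2])
        moreover have "\<alpha> * E (\<phi>' y, u) (B y a, 0) + 1/2 * ((\<phi>' y - w0) \<bullet> B y a + B y a \<bullet> (\<phi>' y - w0)) = dh y w0 u a" for a
          by (simp add: dh_def inner_commute)
        ultimately show ?thesis by simp
      qed
      have projc: "proj S c = c" using cS by (rule closest_point_self)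
      have \<Psi>c: "\<Psi> (y, w0, u) \<bullet> c = dh y w0 u c" for y
        unfolding \<Psi>_inner projc using proj_orth[OF S cS, of y] by simp
      \<comment> \<open>Near \<open>t = 0\<close> the lifted line is at distance at least
        \<open>\<bar>t\<bar> * norm (B y0 c) / 2\<close> from \<open>x\<close>; half the square of
        this is \<open>\<kappa> * t\<^sup>2\<close>.\<close>
      define \<kappa> where "\<kappa> = (norm (B y0 c))\<^sup>2 / 8"
      show False
      proof (rule no_quadratic_growth_if_flat[of "\<lambda>t. h (L t)" "\<lambda>t. \<Psi> (L t, w0, u) \<bullet> c" \<kappa>])
        show "\<forall>\<^sub>F t in nhds 0. ((\<lambda>t. h (L t)) has_real_derivative \<Psi> (L t, w0, u) \<bullet> c) (at t)"
          using evO
        proof eventually_elim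
          case (elim t)
          from has_derivative_compose[OF Lder hder[OF elim]]
          show ?case
            by (rule has_derivative_imp_has_field_derivative)
              (simp add: \<Psi>c linear_cmul[OF lindh])
        qed
        show "\<Psi> (L 0, w0, u) \<bullet> c = 0" using \<Psi>0 by (simp add: L0 t0_def)
        have "((\<lambda>t. \<Psi> (L t, w0, u)) has_derivative (\<lambda>s. K (s *\<^sub>R c))) (at 0)"
          by (rule has_derivative_compose[OF Lder]) (simp add: L0 \<psi>der)
        moreover have "K (s *\<^sub>R c) = 0" for s
          using linear_cmul[OF has_derivative_linear[OF \<psi>der], of s c] Kc by simp
        ultimately have "((\<lambda>t. \<Psi> (L t, w0, u)) has_derivative (\<lambda>s. 0)) (at 0)" by simp
        from has_derivative_inner_left[OF this, of c]
        show "((\<lambda>t. \<Psi> (L t, w0, u) \<bullet> c) has_real_derivative 0) (at 0)"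
          by (rule has_derivative_imp_has_field_derivative) simp
        have Bc: "B y0 c \<noteq> 0" using AB[OF xV, of c] c0 by (auto simp: y0_def)
        then show "0 < \<kappa>" by (simp add: \<kappa>_def)
        define e where "e = norm (B y0 c) / (2 * norm c)"
        have e: "e > 0" using Bc c0 by (simp add: e_def)
        obtain d where d: "d > 0" "\<And>y. norm (y - y0) < d \<Longrightarrow> norm (\<phi>' y - \<phi>' y0 - B y0 (y - y0)) \<le> e * norm (y - y0)"
          using B[OF y0(1)] e unfolding has_derivative_at_alt by meson
        have "filterlim L (nhds y0) (nhds 0)"
          using tendsto_nhds_if_isCont[OF has_derivative_continuous[OF Lder[of 0]]] by (simp add: L0)
        from eventually_compose_filterlim[OF eventually_nhds_in_open[OF open_ball] this, of y0 d]
        have "\<forall>\<^sub>F t in nhds 0. L t \<in> ball y0 d" using d(1) by simp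
        with evO show "\<forall>\<^sub>F t in nhds 0. h (L 0) + \<kappa> * t\<^sup>2 \<le> h (L t)"
        proof eventually_elim
          case (elim t)
          define p where "p = \<phi>' (L t)"
          have pV: "L t \<in> \<phi> ` V" "(p, u) \<in> V'" using elim by (auto simp: Op_iff p_def)
          have pM: "p \<in> M" unfolding p_def by (rule param_in_M[OF LS pV(1)])
          have Lt: "L t - y0 = t *\<^sub>R c" by (simp add: L_def)
          have "norm (L t - y0) < d" using elim(2) by (simp add: dist_norm norm_minus_commute)
          from d(2)[OF this] have "norm (p - x - t *\<^sub>R B y0 c) \<le> e * norm (t *\<^sub>R c)"
            by (simp add: p_def Lt y0(3) blinfun.scaleR_right)
          also have "\<dots> = \<bar>t\<bar> * norm (B y0 c) / 2" using c0 by (simp add: e_def)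
          finally have "\<bar>t\<bar> * norm (B y0 c) \<le> norm (p - x) + \<bar>t\<bar> * norm (B y0 c) / 2"
            using norm_triangle_ineq4[of "p - x" "p - x - t *\<^sub>R B y0 c"] by simp
          then have "\<bar>t\<bar> * norm (B y0 c) / 2 \<le> norm (p - x)" by linarith
          then have "(\<bar>t\<bar> * norm (B y0 c) / 2)\<^sup>2 \<le> (norm (p - x))\<^sup>2" by (intro power_mono) auto
          then have n1: "\<kappa> * t\<^sup>2 \<le> 1/2 * (norm (p - x))\<^sup>2"
            by (simp add: \<kappa>_def power_mult_distrib power_divide)
          \<comment> \<open>The subgradient inequality absorbs the linear term of the square
            expanded around \<open>x\<close>, leaving a gain of half the squared distance.\<close>
          have "v \<in> convex_subdiff (\<lambda>x. g (x, u)) x" using v rel_interior_subset by blast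
          then have "g (x, u) + ereal (v \<bullet> (p - x)) \<le> g (p, u)" unfolding convex_subdiff_def by blast
          moreover have "g (x, u) = ereal (k (x, u))" "g (p, u) = ereal (k (p, u))"
            using V'(1,3) x u pM pV(2) by auto
          ultimately have "k (x, u) + v \<bullet> (p - x) \<le> k (p, u)" by simp
          then have "\<alpha> * (k (x, u) + v \<bullet> (p - x)) \<le> \<alpha> * k (p, u)" using \<alpha> by simp
          moreover have "(p - w0) \<bullet> (p - w0) = (norm (p - x))\<^sup>2 - 2 * \<alpha> * (v \<bullet> (p - x)) + (x - w0) \<bullet> (x - w0)"
            by (simp add: w0_def power2_norm_eq_inner inner_diff_left inner_diff_right inner_add_left
                inner_add_right inner_commute algebra_simps)
          ultimately have "h y0 + 1/2 * (norm (p - x))\<^sup>2 \<le> h (L t)"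
            unfolding h_def y0(3) p_def[symmetric] by (simp add: algebra_simps)
          then show ?case using n1 unfolding L0 by linarith
        qed
      qed
    qed
    then show ?thesis by (simp add: hc zero_prod_def)
  qed
  have linF: "linear (blinfun_apply (F' t0))" by (intro bounded_linear.linear blinfun.bounded_linear_right)
  have "inj (blinfun_apply (F' t0))" using nonsing linear_injective_0[OF linF] by blast
  then obtain J where J: "linear J" "J \<circ> blinfun_apply (F' t0) = id" using linear_injective_left_inverse[OF linF] by blast
  have bJ: "blinfun_apply (Blinfun J) = J" using J(1) linear_conv_bounded_linear bounded_linear_Blinfun_apply by blast
  have invJ: "Blinfun J o\<^sub>L F' t0 = id_blinfun"
    using fun_cong[OF J(2)] by (intro blinfun_eqI) (simp add: bJ)
  obtain U' Vn Gi Gi' where Gi: "open U'" "U' \<subseteq> Op" "t0 \<in> U'" "open Vn" "F t0 \<in> Vn" "homeomorphism U' Vn F Gi"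
    "\<And>y. y \<in> Vn \<Longrightarrow> (Gi has_derivative Gi' y) (at y)"
    by (rule inverse_function_theorem[OF oOp bspec[OF F'(1)] F'(2) t0 invJ]) blast+
  \<comment> \<open>Solving with right-hand side \<open>(0, z)\<close> gives a coordinate, which the
    inverse chart returns to \<open>M\<close>; differentiability comes from the local
    inverse.\<close>
  define p where "p z = \<phi>' (fst (Gi (0, z)))" for z
  define z0 where "z0 = (w0, u)"
  have Giz0: "Gi (0, z0) = t0" using Gi(3,6) Ft0 by (metis homeomorphism_apply1 z0_def)
  have pz0: "p z0 = x" by (simp add: p_def Giz0 t0_def y0(3))
  have pder: "(p has_derivative (\<lambda>h. B y0 (fst (Gi' (0, z0) (0, h))))) (at z0)"
  proof -
    have p2: "(Gi has_derivative Gi' (0, z0)) (at (0, z0))" using Gi(5,7) Ft0 by (simp add: z0_def)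
    note * = has_derivative_fst[OF has_derivative_compose[OF has_derivative_insert_right p2]]
    show ?thesis unfolding p_def
      by (rule has_derivative_compose[OF *]) (simp add: Giz0 t0_def B y0(1))
  qed
  have pcont: "filterlim p (nhds x) (nhds z0)"
    using tendsto_nhds_if_isCont[OF has_derivative_continuous[OF pder]] by (simp add: pz0)
  obtain \<epsilon> where \<epsilon>: "\<epsilon> > 0" "\<And>p q w d. p \<in> M \<Longrightarrow> q \<in> \<Omega> \<Longrightarrow> dist p x < \<epsilon> \<Longrightarrow> dist q u < \<epsilon> \<Longrightarrow> dist w v < \<epsilon> \<Longrightarrow>
    d \<in> convex_subdiff (\<lambda>x. g (x, q)) p \<Longrightarrow> w - d \<in> normal_space M p \<Longrightarrow> w \<in> convex_subdiff (\<lambda>x. g (x, q)) p"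
    using subgradient_stability[OF x u v] by meson
  have lim2: "filterlim snd (nhds u) (nhds z0)"
    using tendsto_snd[OF filterlim_ident, of z0] by (simp add: z0_def)
  have lim1: "filterlim fst (nhds w0) (nhds z0)"
    using tendsto_fst[OF filterlim_ident, of z0] by (simp add: z0_def)
  have "((\<lambda>z. (1/\<alpha>) *\<^sub>R (fst z - p z)) \<longlongrightarrow> (1/\<alpha>) *\<^sub>R (w0 - x)) (nhds z0)"
    by (intro tendsto_scaleR tendsto_const tendsto_diff lim1 pcont)
  then have lim3: "((\<lambda>z. (1/\<alpha>) *\<^sub>R (fst z - p z)) \<longlongrightarrow> v) (nhds z0)"
    using \<alpha> by (simp add: w0_def)
  have "filterlim (\<lambda>z. (0::'x, z)) (nhds (0, z0)) (nhds z0)"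
    by (intro tendsto_Pair filterlim_ident tendsto_const)
  then have ev0: "\<forall>\<^sub>F z in nhds z0. (0, z) \<in> Vn"
    by (rule eventually_compose_filterlim[OF eventually_nhds_in_open[OF Gi(4)], rotated]) (use Gi(5) Ft0 in \<open>simp add: z0_def\<close>)
  have ev1: "\<forall>\<^sub>F z in nhds z0. snd z \<in> \<Omega>" using topological_tendstoD[OF lim2 \<Omega> u] .
  have ev: "\<forall>\<^sub>F z in nhds z0. prox \<alpha> g (fst z) (snd z) = p z \<and> p z \<in> M \<and> snd z \<in> \<Omega> \<and>
      (1 / \<alpha>) *\<^sub>R (fst z - p z) \<in> convex_subdiff (\<lambda>x. g (x, snd z)) (p z)"
    using ev0 ev1 tendstoD[OF pcont \<epsilon>(1)] tendstoD[OF lim2 \<epsilon>(1)] tendstoD[OF lim3 \<epsilon>(1)]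
  proof eventually_elim
    case (elim z)
    define w where "w = fst z"
    define q where "q = snd z"
    define y where "y = fst (Gi (0, z))"
    have "Gi (0, z) \<in> U'" using Gi(6) elim(1) unfolding homeomorphism_def by blast
    moreover have FG: "F (Gi (0, z)) = (0, z)" using Gi(6) elim(1) by (rule homeomorphism_apply2)
    ultimately have t: "Gi (0, z) \<in> Op" "snd (Gi (0, z)) = z" "\<Psi> (Gi (0, z)) = 0"
      using Gi(2) unfolding F_def by auto
    have Gz: "Gi (0, z) = (y, w, q)" using t(2) by (simp add: y_def w_def q_def prod_eq_iff)
    have pz: "p z = \<phi>' y" by (simp add: p_def y_def)
    have yO: "y \<in> \<phi> ` V" "(p z, q) \<in> V'" using t(1) unfolding Gz Op_iff pz by auto
    have \<Psi>z: "dh y w q (proj S n) + (y - proj S y) \<bullet> n = 0" for n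
      using \<Psi>_inner[of y w q n] t(3) unfolding Gz by simp
    have yS: "y \<in> S"
    proof -
      define n where "n = y - proj S y"
      have "proj S n = 0"
        by (rule proj_unique[OF S subspace_0[OF S]]) (simp add: n_def proj_orth[OF S])
      then have "n \<bullet> n = 0" using \<Psi>z[of n] linear_0[OF lindh] by (simp add: n_def)
      then show ?thesis using proj_in[OF S, of y] by (simp add: n_def)
    qed
    have dh0: "dh y w q s = 0" if "s \<in> S" for s
      using \<Psi>z[of s] closest_point_self[OF that] closest_point_self[OF yS] by simp
    have pM: "p z \<in> M" unfolding pz by (rule param_in_M[OF yS yO(1)])
    have pV: "p z \<in> V" "\<phi> (p z) = y" unfolding pz using inv'[OF yO(1)] by auto
    have "\<tau> \<bullet> ((1/\<alpha>) *\<^sub>R (w - p z) - G (p z, q)) = 0" if \<tau>: "\<tau> \<in> tangent_space M (p z)" for \<tau>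
    proof -
      obtain s where s: "s \<in> S" "\<tau> = B y s" using \<tau> unfolding tangent[OF pV(1) pM] pV(2) by blast
      have "\<alpha> * (\<tau> \<bullet> G (p z, q)) + (p z - w) \<bullet> \<tau> = 0"
        using dh0[OF s(1)] unfolding dh_def EG pz[symmetric] s(2)[symmetric] .
      then have "\<tau> \<bullet> G (p z, q) = (1/\<alpha>) * (\<tau> \<bullet> (w - p z))"
        using \<alpha> by (simp add: field_simps inner_diff_left inner_diff_right inner_commute)
      then show ?thesis by (simp add: inner_diff_right)
    qed
    then have wG: "(1/\<alpha>) *\<^sub>R (w - p z) - G (p z, q) \<in> normal_space M (p z)"
      by (auto simp: orthogonal_comp_def orthogonal_def)
    have q\<Omega>: "q \<in> \<Omega>" using elim(2) by (simp add: q_def)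
    \<comment> \<open>Any subgradient \<open>d\<close> at the critical point will do: its tangential
      part agrees with that of \<open>(w - p z) / \<alpha>\<close>, and
      \<open>subgradient_stability\<close> then makes the latter a subgradient as well.\<close>
    obtain d where d: "d \<in> convex_subdiff (\<lambda>x. g (x, q)) (p z)"
      using fst_subdiff_closed_convex(3)[OF pM q\<Omega>] fst_subdiff[OF pM q\<Omega>] by blast
    have "((1/\<alpha>) *\<^sub>R (w - p z) - G (p z, q)) - (d - G (p z, q)) \<in> normal_space M (p z)"
      by (intro subspace_diff subspace_orthogonal_comp wG subgrad pM q\<Omega> yO(2) d)
    then have "(1/\<alpha>) *\<^sub>R (w - p z) - d \<in> normal_space M (p z)" by simp
    then have sg: "(1/\<alpha>) *\<^sub>R (w - p z) \<in> convex_subdiff (\<lambda>x. g (x, q)) (p z)"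
      by (rule \<epsilon>(2)[OF pM q\<Omega> _ _ _ d, rotated 3]) (use elim in \<open>simp_all add: q_def w_def\<close>)
    then show ?case using prox_eqI[OF \<alpha> sg] pM q\<Omega> by (simp add: w_def q_def)
  qed
  have zz: "(x + \<alpha> *\<^sub>R v, u) = z0" by (simp add: z0_def w0_def)
  have evp: "\<forall>\<^sub>F z in nhds z0. p z = prox \<alpha> g (fst z) (snd z)" using ev by eventually_elim simp
  have "((\<lambda>z. prox \<alpha> g (fst z) (snd z)) has_derivative (\<lambda>h. B y0 (fst (Gi' (0, z0) (0, h))))) (at z0)"
  proof (rule has_derivative_transform_eventually[OF pder])
    show "\<forall>\<^sub>F z in at z0. p z = prox \<alpha> g (fst z) (snd z)"
      using evp unfolding eventually_nhds_conv_at by (rule conjunct1)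
    show "p z0 = prox \<alpha> g (fst z0) (snd z0)"
      using evp unfolding eventually_nhds_conv_at by (rule conjunct2)
  qed simp
  then show "(\<lambda>z. prox \<alpha> g (fst z) (snd z)) differentiable (at (x + \<alpha> *\<^sub>R v, u))"
    unfolding zz by (rule differentiableI)
  show "\<forall>\<^sub>F z in nhds (x + \<alpha> *\<^sub>R v, u). prox \<alpha> g (fst z) (snd z) \<in> M \<and> snd z \<in> \<Omega> \<and>
      (1 / \<alpha>) *\<^sub>R (fst z - prox \<alpha> g (fst z) (snd z))
        \<in> convex_subdiff (\<lambda>x. g (x, snd z)) (prox \<alpha> g (fst z) (snd z))"
    unfolding zz using ev by eventually_elim simp
qed

end

section \<open>The derivative of the proximal map\<close>

lemma vector_derivative_quotient:
  assumes "(f has_vector_derivative v) (at (0::real))"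
  shows "((\<lambda>t. (1 / t) *\<^sub>R (f t - f 0)) \<longlongrightarrow> v) (at 0)"
proof -
  have "((\<lambda>t. norm ((1 / norm (t - 0)) *\<^sub>R (f t - (f 0 + (t - 0) *\<^sub>R v)))) \<longlongrightarrow> 0) (at 0)"
    using assms unfolding has_vector_derivative_def has_derivative_at2 by (intro tendsto_norm_zero) blast
  moreover have "\<forall>\<^sub>F t in at 0. norm ((1 / norm (t - 0)) *\<^sub>R (f t - (f 0 + (t - 0) *\<^sub>R v)))
      = norm ((1 / t) *\<^sub>R (f t - f 0) - v)"
  proof -
    have "norm ((1 / norm (t - 0)) *\<^sub>R (f t - (f 0 + (t - 0) *\<^sub>R v))) = norm ((1 / t) *\<^sub>R (f t - f 0) - v)"
      if "t \<noteq> 0" for t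
    proof -
      have "(1 / t) *\<^sub>R (f t - f 0) - v = (1 / t) *\<^sub>R (f t - (f 0 + (t - 0) *\<^sub>R v))"
        using that by (simp add: algebra_simps)
      then show ?thesis by simp
    qed
    then show ?thesis by (simp add: eventually_at_filter)
  qed
  ultimately have "((\<lambda>t. norm ((1 / t) *\<^sub>R (f t - f 0) - v)) \<longlongrightarrow> 0) (at 0)"
    by (rule Lim_transform_eventually)
  then show ?thesis by (simp add: LIM_zero_cancel tendsto_norm_zero_iff)
qed

lemma gderiv_if_quadratic_remainder:
  fixes e :: "'a::euclidean_space \<Rightarrow> real"
  assumes "\<forall>\<^sub>F y in nhds x. \<bar>e y - e x - G \<bullet> (y - x)\<bar> \<le> (norm (y - x))\<^sup>2"
  shows "GDERIV e x :> G"
  unfolding gderiv_def has_derivative_at_alt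
proof (intro conjI allI impI)
  show "bounded_linear (\<lambda>h. h \<bullet> G)" by (rule bounded_linear_inner_left)
  fix r :: real assume r: "0 < r"
  obtain d where d: "d > 0" "\<And>y. dist y x < d \<Longrightarrow> \<bar>e y - e x - G \<bullet> (y - x)\<bar> \<le> (norm (y - x))\<^sup>2"
    using assms unfolding eventually_nhds_metric by blast
  have "norm (e y - e x - (y - x) \<bullet> G) \<le> r * norm (y - x)" if y: "norm (y - x) < min d r" for y
  proof -
    have "\<bar>e y - e x - G \<bullet> (y - x)\<bar> \<le> norm (y - x) * norm (y - x)"
      using d(2)[of y] y by (simp add: dist_norm power2_eq_square)
    also have "\<dots> \<le> r * norm (y - x)" using y by (intro mult_right_mono) auto
    finally show ?thesis by (simp add: inner_commute)
  qed
  then show "\<exists>d>0. \<forall>y. norm (y - x) < d \<longrightarrow> norm (e y - e x - (y - x) \<bullet> G) \<le> r * norm (y - x)"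
    using d(1) r by (intro exI[of _ "min d r"]) simp
qed

context partly_smooth_family
begin

text \<open>Firmness and symmetry come from subgradient inequalities between pairs of nearby values,
  tangency from the curve of values inside \<open>M\<close>.\<close>

lemma prox_derivative:
  assumes x: "x \<in> M" and u: "u \<in> \<Omega>" and \<alpha>: "0 < \<alpha>"
    and v: "v \<in> rel_interior (convex_subdiff (\<lambda>x. g (x, u)) x)"
    and D: "((\<lambda>z. prox \<alpha> g (fst z) (snd z)) has_derivative D) (at (x + \<alpha> *\<^sub>R v, u))"
  shows "D (a, 0) \<bullet> b = a \<bullet> D (b, 0)" "D (a, 0) \<bullet> D (a, 0) \<le> D (a, 0) \<bullet> a"
    "D (a, 0) \<in> tangent_space M x"
proof -
  define w0 where "w0 = x + \<alpha> *\<^sub>R v"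
  define p where "p w = prox \<alpha> g w u" for w
  define P where "P a = D (a, 0)" for a
  have pder: "(p has_derivative P) (at w0)"
  proof -
    from has_derivative_compose[OF has_derivative_insert_left D[folded w0_def]] show ?thesis by (simp add: p_def[abs_def] P_def[abs_def])
  qed
  have Plin: "linear P" by (rule has_derivative_linear[OF pder])
  have "v \<in> convex_subdiff (\<lambda>x. g (x, u)) x" using v rel_interior_subset by blast
  then have "(1 / \<alpha>) *\<^sub>R (w0 - x) \<in> convex_subdiff (\<lambda>x. g (x, u)) x" using \<alpha> by (simp add: w0_def)
  then have px: "p w0 = x" unfolding p_def by (rule prox_eqI[OF \<alpha>])
  define h where "h = (\<lambda>x. g (x, u))"
  define good where "good w \<longleftrightarrow> p w \<in> M \<and> (1 / \<alpha>) *\<^sub>R (w - p w) \<in> convex_subdiff h (p w)" for w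
  have "filterlim (\<lambda>w. (w, u)) (nhds (w0, u)) (nhds w0)"
    by (intro tendsto_Pair filterlim_ident tendsto_const)
  from eventually_compose_filterlim[OF prox_smooth(2)[OF x u \<alpha> v, folded w0_def] this]
  have good: "\<forall>\<^sub>F w in nhds w0. good w"
    by eventually_elim (simp add: good_def p_def h_def)
  have goodD: "\<alpha> * real_of_ereal (h (p w')) \<ge> \<alpha> * real_of_ereal (h (p w)) + (w - p w) \<bullet> (p w' - p w)"
    if gw: "good w" "good w'" for w w'
  proof -
    obtain r where r: "h (p w) = ereal r"
      using gw unfolding good_def convex_subdiff_def by (cases "h (p w)") auto
    obtain r' where r': "h (p w') = ereal r'"
      using gw unfolding good_def convex_subdiff_def by (cases "h (p w')") auto
    have "h (p w) + ereal ((1 / \<alpha>) *\<^sub>R (w - p w) \<bullet> (p w' - p w)) \<le> h (p w')"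
      using gw unfolding good_def convex_subdiff_def by blast
    then have "r + (1 / \<alpha>) * ((w - p w) \<bullet> (p w' - p w)) \<le> r'" by (simp add: r r')
    then have "\<alpha> * (r + (1 / \<alpha>) * ((w - p w) \<bullet> (p w' - p w))) \<le> \<alpha> * r'" using \<alpha> by simp
    then show ?thesis using \<alpha> by (simp add: r r' distrib_left)
  qed
  \<comment> \<open>Adding the two subgradient inequalities expresses monotonicity of the
    subdifferential.\<close>
  have firm: "(p w' - p w) \<bullet> (p w' - p w) \<le> (p w' - p w) \<bullet> (w' - w)" if "good w" "good w'" for w w'
  proof -
    have "(w - p w) \<bullet> (p w' - p w) + (w' - p w') \<bullet> (p w - p w') \<le> 0"
      using goodD[OF that] goodD[OF that(2,1)] by linarith
    then show ?thesis by (simp add: inner_diff_left inner_diff_right inner_commute)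
  qed
  define L where "L t = w0 + t *\<^sub>R a" for t :: real
  have Lder: "(L has_derivative (\<lambda>s. s *\<^sub>R a)) (at 0)"
    unfolding L_def by (rule has_derivative_line)
  have L0: "L 0 = w0" by (simp add: L_def)
  have "filterlim L (nhds w0) (nhds 0)"
    using tendsto_nhds_if_isCont[OF has_derivative_continuous[OF Lder]] by (simp add: L0)
  from eventually_compose_filterlim[OF good this] have goodL: "\<forall>\<^sub>F t in nhds 0. good (L t)" .
  have "((\<lambda>t. p (L t)) has_derivative (\<lambda>s. P (s *\<^sub>R a))) (at 0)"
    by (rule has_derivative_compose[OF Lder]) (simp add: L0 pder)
  then have cder: "((\<lambda>t. p (L t)) has_vector_derivative P a) (at 0)"
    by (simp add: has_vector_derivative_def linear_cmul[OF Plin])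
  show "D (a, 0) \<in> tangent_space M x"
  proof -
    obtain V \<phi> \<phi>' S A B where ch: "chart M V \<phi> \<phi>' S A B" "x \<in> V" using chart_exists[OF M x] .
    have "\<forall>\<^sub>F t in nhds 0. p (L t) \<in> M" using goodL by eventually_elim (simp add: good_def)
    from chart.curve_tangent[OF ch _ this cder] show ?thesis by (simp add: L0 px P_def)
  qed
  show "D (a, 0) \<bullet> D (a, 0) \<le> D (a, 0) \<bullet> a"
  proof -
    define Q where "Q t = (1 / t) *\<^sub>R (p (L t) - p (L 0))" for t
    have Qlim: "(Q \<longlongrightarrow> P a) (at 0)" unfolding Q_def by (rule vector_derivative_quotient[OF cder])
    have g0: "good (L 0)" using eventually_nhds_x_imp_x[OF goodL] .
    have le: "Q t \<bullet> Q t \<le> Q t \<bullet> a" if t: "good (L t)" "t \<noteq> 0" for t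
    proof -
      have "(p (L t) - p (L 0)) \<bullet> (p (L t) - p (L 0)) \<le> (p (L t) - p (L 0)) \<bullet> (t *\<^sub>R a)"
        using firm[OF g0 t(1)] by (simp add: L_def)
      moreover have "p (L t) - p (L 0) = t *\<^sub>R Q t" using t(2) by (simp add: Q_def)
      ultimately have "(t * t) * (Q t \<bullet> Q t) \<le> (t * t) * (Q t \<bullet> a)" by (simp add: mult.assoc)
      moreover have "0 < t * t" using t(2) by (auto simp: zero_less_mult_iff)
      ultimately show ?thesis by (rule mult_left_le_imp_le)
    qed
    have "\<forall>\<^sub>F t in at 0. Q t \<bullet> Q t \<le> Q t \<bullet> a"
      using eventually_mono[OF goodL, of "\<lambda>t. t \<noteq> 0 \<longrightarrow> Q t \<bullet> Q t \<le> Q t \<bullet> a"] le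
      by (auto simp: eventually_at_filter)
    then have "P a \<bullet> P a \<le> P a \<bullet> a"
      by (intro tendsto_le[OF _ tendsto_inner[OF Qlim tendsto_const] tendsto_inner[OF Qlim Qlim]]) simp_all
    then show ?thesis by (simp add: P_def)
  qed
  show "D (a, 0) \<bullet> b = a \<bullet> D (b, 0)"
  proof -
    \<comment> \<open>On good points this is \<alpha> times the Moreau envelope of \<open>h\<close>.
      Its remainder against the slope \<open>w - p w\<close> is nonnegative by the subgradient
      inequality; exchanging the two points bounds it above by the squared distance.\<close>
    define e where "e w = \<alpha> * real_of_ereal (h (p w)) + 1/2 * ((p w - w) \<bullet> (p w - w))" for w
    have remainder_nonneg: "e w' - e w - (w - p w) \<bullet> (w' - w) \<ge> 0" if "good w" "good w'" for w w'
    proof -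
      have *: "m \<bullet> r + 1/2 * ((m + s - r) \<bullet> (m + s - r)) - 1/2 * (m \<bullet> m) - m \<bullet> s = 1/2 * ((s - r) \<bullet> (s - r))"
        for m r s :: 'x
        by (simp add: inner_diff_left inner_diff_right inner_add_left inner_add_right inner_commute algebra_simps)
      have "p w' - w' = - ((w - p w) + (w' - w) - (p w' - p w))" "p w - w = - (w - p w)" by simp_all
      then have "(p w' - w') \<bullet> (p w' - w') = ((w - p w) + (w' - w) - (p w' - p w)) \<bullet> ((w - p w) + (w' - w) - (p w' - p w))"
        "(p w - w) \<bullet> (p w - w) = (w - p w) \<bullet> (w - p w)" by (metis inner_minus_left inner_minus_right minus_minus)+
      then have "e w' - e w - (w - p w) \<bullet> (w' - w) \<ge> 1/2 * (((w' - w) - (p w' - p w)) \<bullet> ((w' - w) - (p w' - p w)))"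
        unfolding e_def using goodD[OF that] *[of "w - p w" "p w' - p w" "w' - w"] by simp
      moreover have "((w' - w) - (p w' - p w)) \<bullet> ((w' - w) - (p w' - p w)) \<ge> 0" by simp
      ultimately show ?thesis by linarith
    qed
    have remainder: "\<bar>e w' - e w - (w - p w) \<bullet> (w' - w)\<bar> \<le> (norm (w' - w))\<^sup>2" if gg: "good w" "good w'" for w w'
    proof -
      have "0 \<le> e w - e w' - (w' - p w') \<bullet> (w - w')" by (rule remainder_nonneg[OF gg(2,1)])
      then have "e w' - e w - (w - p w) \<bullet> (w' - w) \<le> (w' - p w') \<bullet> (w' - w) - (w - p w) \<bullet> (w' - w)"
        by (simp add: inner_diff_right)
      also have "\<dots> = (w' - w) \<bullet> (w' - w) - (p w' - p w) \<bullet> (w' - w)"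
        by (simp add: inner_diff_left)
      also have "\<dots> \<le> (w' - w) \<bullet> (w' - w)"
        using firm[OF gg] inner_ge_zero[of "p w' - p w"] by linarith
      finally show ?thesis using remainder_nonneg[OF gg] by (simp add: power2_norm_eq_inner)
    qed
    have "\<forall>\<^sub>F w in nhds w0. \<forall>\<^sub>F w' in nhds w. good w'" using good by (simp add: eventually_eventually)
    with good have "\<forall>\<^sub>F w in nhds w0. GDERIV e w :> w - p w"
    proof eventually_elim
      case (elim w)
      show ?case
        by (rule gderiv_if_quadratic_remainder, rule eventually_mono[OF elim(2)])
          (rule remainder[OF elim(1)])
    qed
    moreover have "((\<lambda>w. w - p w) has_derivative (\<lambda>a. a - P a)) (at w0)"
      by (rule has_derivative_diff[OF has_derivative_ident pder])
    ultimately have "(a - P a) \<bullet> b = a \<bullet> (b - P b)" by (rule gradient_derivative_symmetric)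
    then show ?thesis by (simp add: P_def inner_diff_left inner_diff_right)
  qed
qed

end

section \<open>Spectrum of the inertial map\<close>

text \<open>A pair \<open>(p, q)\<close> stands for the vector \<open>p + \<i> q\<close> of the complexification.\<close>

definition cscale :: "complex \<Rightarrow> 'a::real_vector \<times> 'a \<Rightarrow> 'a \<times> 'a" where
  "cscale l z = (Re l *\<^sub>R fst z - Im l *\<^sub>R snd z, Im l *\<^sub>R fst z + Re l *\<^sub>R snd z)"

definition cext :: "('a \<Rightarrow> 'b) \<Rightarrow> 'a \<times> 'a \<Rightarrow> 'b \<times> 'b" where
  "cext A z = (A (fst z), A (snd z))"

lemma cscale_mult: "cscale l (cscale m z) = cscale (l * m) z"
  by (simp add: cscale_def algebra_simps)

lemma cscale_diff_left: "cscale (l - m) z = cscale l z - cscale m z"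
  by (simp add: cscale_def algebra_simps)

lemma cscale_one [simp]: "cscale 1 z = z" and cscale_zero [simp]: "cscale 0 z = 0" "cscale l 0 = 0"
  by (simp_all add: cscale_def zero_prod_def)

lemma cscale_eq_0: "cscale l z = 0 \<longleftrightarrow> l = 0 \<or> z = 0"
proof
  assume *: "cscale l z = 0"
  show "l = 0 \<or> z = 0"
  proof (cases "l = 0")
    case False
    then have "z = cscale (1 / l) (cscale l z)" by (simp add: cscale_mult)
    then show ?thesis by (simp add: *)
  qed simp
qed auto

lemma cext_cscale: "linear A \<Longrightarrow> cext A (cscale l z) = cscale l (cext A z)"
  by (simp add: cext_def cscale_def linear_diff linear_add linear_cmul)

lemma complex_eigenvalue_iff: "complex_eigenvalue A l \<longleftrightarrow> (\<exists>z. z \<noteq> 0 \<and> cext A z = cscale l z)"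
  by (auto simp: complex_eigenvalue_def cext_def cscale_def zero_prod_def)

text \<open>Unit eigenvectors paired with their eigenvalues form a compact set, so the supremum is
  attained and remains strictly below 1. The eigenvalue \<open>l0\<close> keeps the supremum from
  ranging over the empty set.\<close>

lemma spectral_radius_less_1:
  fixes A :: "'a::euclidean_space \<Rightarrow> 'a"
  assumes A: "linear A" and less: "\<And>l. complex_eigenvalue A l \<Longrightarrow> cmod l < 1"
    and ex: "complex_eigenvalue A l0"
  shows "spectral_radius A < 1"
proof -
  define T where "T = (sphere (0::'a \<times> 'a) 1 \<times> cball (0::complex) 1) \<inter> {t. cext A (fst t) = cscale (snd t) (fst t)}"
  have cA: "continuous_on UNIV A" using A linear_continuous_on linear_conv_bounded_linear by blast
  have "closed {t::('a \<times> 'a) \<times> complex. cext A (fst t) = cscale (snd t) (fst t)}"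
    unfolding cext_def cscale_def
    by (intro closed_Collect_eq continuous_intros continuous_on_compose2[OF cA]) auto
  then have "compact T" unfolding T_def by (intro compact_Int_closed compact_Times) simp_all
  have eq: "{l. complex_eigenvalue A l} = snd ` T"
  proof (intro set_eqI iffI)
    fix l assume "l \<in> {l. complex_eigenvalue A l}"
    then obtain z where z: "z \<noteq> 0" "cext A z = cscale l z" unfolding complex_eigenvalue_iff by auto
    define c where "c = complex_of_real (1 / norm z)"
    have "cscale c z = (1 / norm z) *\<^sub>R z" by (simp add: cscale_def c_def scaleR_prod_def)
    then have "norm (cscale c z) = 1" using z(1) by simp
    moreover have "cext A (cscale c z) = cscale l (cscale c z)"
      by (simp add: cext_cscale[OF A] z cscale_mult mult.commute)
    moreover have "cmod l \<le> 1"
      using less[of l] z unfolding complex_eigenvalue_iff by (meson less_imp_le)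
    ultimately have "(cscale c z, l) \<in> T" by (simp add: T_def)
    then show "l \<in> snd ` T" by force
  next
    fix l assume "l \<in> snd ` T"
    then obtain z where "(z, l) \<in> T" by auto
    then show "l \<in> {l. complex_eigenvalue A l}"
      unfolding T_def mem_Collect_eq complex_eigenvalue_iff by (intro exI[of _ z]) auto
  qed
  define R where "R = cmod ` {l. complex_eigenvalue A l}"
  have "compact R" unfolding R_def eq
    using \<open>compact T\<close> by (intro compact_continuous_image continuous_intros) simp_all
  moreover have "R \<noteq> {}" using ex by (auto simp: R_def)
  ultimately have "\<exists>r\<in>R. \<forall>s\<in>R. s \<le> r" by (rule compact_attains_sup)
  then obtain r where r: "r \<in> R" "\<And>s. s \<in> R \<Longrightarrow> s \<le> r" by blast
  have "spectral_radius A = r"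
    unfolding spectral_radius_def R_def[symmetric] by (rule cSup_eq_maximum[OF r])
  moreover have "r < 1" using r(1) less by (auto simp: R_def)
  ultimately show ?thesis by simp
qed

text \<open>At a maximizer \<open>x\<close> of the quotient of the two quadratic forms,
  \<open>\<mu> E - N\<close> is positive semidefinite with vanishing form at \<open>x\<close>, which
  forces \<open>x\<close> into its kernel.\<close>

lemma generalized_symmetric_eigenvector:
  fixes N E :: "'a::euclidean_space \<Rightarrow> 'a"
  assumes N: "linear N" "\<And>x y. N x \<bullet> y = x \<bullet> N y" and E: "linear E" "\<And>x y. E x \<bullet> y = x \<bullet> E y"
    and pos: "\<And>x. x \<noteq> 0 \<Longrightarrow> 0 < x \<bullet> E x"
  obtains x \<mu> where "x \<noteq> 0" "N x = \<mu> *\<^sub>R E x"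
proof -
  have cN: "continuous_on UNIV N" "continuous_on UNIV E"
    using N(1) E(1) linear_continuous_on linear_conv_bounded_linear by blast+
  have nz: "x \<in> sphere 0 1 \<Longrightarrow> x \<bullet> E x \<noteq> 0" for x using pos[of x] by fastforce
  have cont: "continuous_on (sphere 0 1) (\<lambda>x. (x \<bullet> N x) / (x \<bullet> E x))"
    by (intro continuous_on_divide continuous_on_inner continuous_on_id continuous_on_subset[OF cN(1)]
        continuous_on_subset[OF cN(2)]) (use nz in auto)
  have "(SOME b::'a. b \<in> Basis) \<in> sphere 0 1" by simp
  then have ne: "sphere (0::'a) 1 \<noteq> {}" by blast
  obtain x where x: "x \<in> sphere 0 1"
    "\<And>y. y \<in> sphere 0 1 \<Longrightarrow> (y \<bullet> N y) / (y \<bullet> E y) \<le> (x \<bullet> N x) / (x \<bullet> E x)"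
    using continuous_attains_sup[OF compact_sphere ne cont] by (elim bexE) (rule that; blast)
  define \<mu> where "\<mu> = (x \<bullet> N x) / (x \<bullet> E x)"
  have x0: "x \<noteq> 0" using x(1) by auto
  define D where "D y = \<mu> *\<^sub>R E y - N y" for y
  have D: "linear D" unfolding D_def
    by (intro linear_compose_sub linear_compose_scale_right N E)
  have sym: "D a \<bullet> b = a \<bullet> D b" for a b
    by (simp add: D_def inner_diff_left inner_diff_right N E)
  have psd: "0 \<le> y \<bullet> D y" for y
  proof (cases "y = 0")
    case False
    have "(y /\<^sub>R norm y) \<in> sphere 0 1" using False by simp
    from x(2)[OF this] have "(y \<bullet> N y) / (y \<bullet> E y) \<le> \<mu>"
      using False by (simp add: \<mu>_def linear_cmul[OF N(1)] linear_cmul[OF E(1)])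
    then show ?thesis using pos[OF False] by (simp add: D_def inner_diff_right pos_divide_le_eq)
  qed simp
  have xDx: "x \<bullet> D x = 0" using pos[OF x0] by (simp add: D_def \<mu>_def inner_diff_right)
  have "D x = 0"
  proof (rule ccontr)
    assume "D x \<noteq> 0"
    define d where "d = D x"
    define a where "a = d \<bullet> d"
    define q where "q = d \<bullet> D d"
    have a: "a > 0" using \<open>D x \<noteq> 0\<close> by (simp add: a_def d_def)
    have q: "q \<ge> 0" unfolding q_def by (rule psd)
    \<comment> \<open>A step of this length against \<open>d\<close> would make the form negative:
      \<open>t * q\<close> is at most \<open>a\<close>, while the linear gain contributes
      \<open>2 * a\<close>.\<close>
    define t where "t = a / (q + 1)"
    have t: "t > 0" using a q by (simp add: t_def)
    have "0 \<le> (x - t *\<^sub>R d) \<bullet> D (x - t *\<^sub>R d)" by (rule psd)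
    also have "\<dots> = x \<bullet> D x - t * (x \<bullet> D d) - t * (d \<bullet> D x) + t * t * q"
      by (simp add: linear_diff[OF D] linear_cmul[OF D] inner_diff_left inner_diff_right q_def algebra_simps)
    also have "\<dots> = t * (t * q - 2 * a)"
      using sym[of x d] xDx by (simp add: a_def d_def[symmetric] algebra_simps)
    finally have "0 \<le> t * q - 2 * a" using t by (simp add: zero_le_mult_iff)
    moreover have "t * q \<le> a" using a q by (simp add: t_def field_simps)
    ultimately show False using a by simp
  qed
  then have "N x = \<mu> *\<^sub>R E x" by (simp add: D_def)
  then show ?thesis using that x0 by blast
qed

text \<open>The Jury conditions for the polynomial \<open>l\<^sup>2 - \<mu> (1 + \<beta>) l + \<mu> \<beta>\<close>.\<close>

lemma inertial_root_less_1:
  fixes l :: complex and \<mu> \<beta> :: real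
  assumes \<beta>: "0 \<le> \<beta>" "\<beta> \<le> 1" and \<mu>: "- (1 / (1 + 2 * \<beta>)) < \<mu>" "\<bar>\<mu>\<bar> < 1"
    and l: "l * l = of_real \<mu> * ((1 + of_real \<beta>) * l - of_real \<beta>)"
  shows "cmod l < 1"
proof -
  define x where "x = Re l"
  define y where "y = Im l"
  have re: "x * x - y * y = \<mu> * ((1 + \<beta>) * x - \<beta>)" and im: "2 * x * y = \<mu> * (1 + \<beta>) * y"
    using l by (auto simp: complex_eq_iff x_def y_def)
  have mb: "\<bar>\<mu> * (1 + \<beta>)\<bar> < 2"
    using \<mu>(2) \<beta> mult_strict_mono'[of "\<bar>\<mu>\<bar>" 1 "1 + \<beta>" 2] mult_mono[of "\<bar>\<mu>\<bar>" 1 "1 + \<beta>" 2]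
    by (cases "\<beta> = 1") (auto simp: abs_mult)
  have "x * x + y * y < 1"
  proof (cases "y = 0")
    case False
    \<comment> \<open>A nonreal root has real part equal to half the sum of the roots, and its
      squared modulus is their product \<open>\<mu> * \<beta>\<close>.\<close>
    then have x: "2 * x = \<mu> * (1 + \<beta>)" using im by simp
    have "2 * (x * x) = \<mu> * (1 + \<beta>) * x" using x by (metis mult.assoc)
    then have "x * x + y * y = \<mu> * \<beta>" using re by (simp add: algebra_simps)
    also have "\<dots> \<le> \<bar>\<mu>\<bar> * 1" using \<beta> by (intro mult_mono) auto
    finally show ?thesis using \<mu> by simp
  next
    case True
    have root: "x * x - \<mu> * (1 + \<beta>) * x + \<mu> * \<beta> = 0" using re True by (simp add: algebra_simps)
    have "x < 1"
    proof (rule ccontr)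
      assume "\<not> x < 1"
      \<comment> \<open>The product equals the polynomial at the root, which is 0, minus its value
        \<open>1 - \<mu>\<close> at 1.\<close>
      then have "0 \<le> (x - 1) * (x + 1 - \<mu> * (1 + \<beta>))" using mb by (intro mult_nonneg_nonneg) auto
      also have "\<dots> = \<mu> - 1" using root by (simp add: algebra_simps)
      finally show False using \<mu> by simp
    qed
    moreover have "- 1 < x"
    proof (rule ccontr)
      assume "\<not> - 1 < x"
      \<comment> \<open>The same comparison at -1, where the polynomial takes the value
        \<open>1 + \<mu> * (1 + 2 * \<beta>)\<close>; the lower bound on \<mu> says that this is
        positive.\<close>
      then have "0 \<le> (- (x + 1)) * (- (x - 1 - \<mu> * (1 + \<beta>)))" using mb by (intro mult_nonneg_nonneg) auto
      also have "\<dots> = - (1 + \<mu> * (1 + 2 * \<beta>))" using root by (simp add: algebra_simps)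
      finally have "\<mu> * (1 + 2 * \<beta>) \<le> -1" by simp
      moreover have "-1 < \<mu> * (1 + 2 * \<beta>)" using \<mu>(1) \<beta> by (simp add: field_simps)
      ultimately show False by simp
    qed
    ultimately have "\<bar>x\<bar> < 1" by simp
    then have "x * x < 1" by (metis abs_mult_self_eq mult_strict_mono' abs_ge_zero mult_1)
    then show ?thesis using True by simp
  qed
  then have "(cmod l)\<^sup>2 < 1\<^sup>2" unfolding cmod_power2 by (simp add: x_def y_def power2_eq_square)
  then show ?thesis by (rule power_less_imp_less_base) simp
qed

lemma complex_quadratic_root_exists:
  fixes b c :: complex
  obtains l where "l * l = b * l - c"
proof -
  define l where "l = (b + csqrt (b * b - 4 * c)) / 2"
  have half: "2 * (x / 2) = x" for x :: complex by simp
  have "2 * l - b = csqrt (b * b - 4 * c)" unfolding l_def half by simp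
  then have "(2 * l - b) * (2 * l - b) = b * b - 4 * c"
    using power2_csqrt[of "b * b - 4 * c"] by (simp only: power2_eq_square)
  then have "4 * (l * l) = 4 * (b * l - c)" by (simp add: algebra_simps)
  then have "l * l = b * l - c" by (metis mult_cancel_left zero_neq_numeral)
  then show ?thesis using that by blast
qed

text \<open>In the application \<open>P\<close> is the derivative of a proximal map, \<open>J = I - \<alpha> H\<close> the derivative of a
  gradient step and \<open>T\<close> the tangent space.\<close>

locale prox_gradient_derivative =
  fixes P J :: "'a::euclidean_space \<Rightarrow> 'a" and T :: "'a set"
  assumes P: "linear P" and P_sym: "P a \<bullet> b = a \<bullet> P b" and P_firm: "P a \<bullet> P a \<le> P a \<bullet> a"
    and J: "linear J" and J_sym: "J a \<bullet> b = a \<bullet> J b"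
    and T: "subspace T" and P_range: "P a \<in> T"
    and J_bound: "a \<in> T \<Longrightarrow> a \<noteq> 0 \<Longrightarrow> \<bar>a \<bullet> J a\<bar> < a \<bullet> a"
begin

abbreviation K where "K a \<equiv> P (J a)"

lemma linear_K: "linear K"
  using linear_compose[OF J P] by (simp add: o_def)

text \<open>With \<open>c = J a / \<mu>\<close> one has \<open>P c = a\<close>, so firmness gives
  \<open>a \<bullet> a \<le> a \<bullet> c\<close>, while
  \<open>\<mu> * (a \<bullet> c) = a \<bullet> J a\<close> is smaller than
  \<open>a \<bullet> a\<close> in modulus.\<close>

lemma real_eigenvalue_bound:
  assumes "K a = \<mu> *\<^sub>R a" "a \<noteq> 0"
  shows "\<bar>\<mu>\<bar> < 1"
proof (cases "\<mu> = 0")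
  case False
  define c where "c = (1 / \<mu>) *\<^sub>R J a"
  have Pc: "P c = a" using assms False by (simp add: c_def linear_cmul[OF P])
  have aT: "a \<in> T" using P_range[of c] Pc by simp
  have ac: "a \<bullet> a \<le> a \<bullet> c" using P_firm[of c] Pc by simp
  have "\<mu> * (a \<bullet> c) = a \<bullet> J a" using False by (simp add: c_def)
  then have "\<bar>\<mu>\<bar> * (a \<bullet> c) < a \<bullet> a"
    using J_bound[OF aT assms(2)] ac inner_ge_zero[of a] by (metis abs_mult abs_of_nonneg order_trans)
  also have "\<dots> \<le> a \<bullet> c" by (rule ac)
  finally show ?thesis using ac assms(2) by (smt (verit) inner_gt_zero_iff mult_le_cancel_right1)
qed simp

lemma fixed_point_trivial: "K a = a \<Longrightarrow> a = 0"
  using real_eigenvalue_bound[of a 1] by auto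

text \<open>\<open>K\<close> need not be symmetric, but it is so with respect to the possibly
  indefinite form of \<open>J\<close>. A nonreal eigenvalue forces
  \<open>J p \<bullet> p + J q \<bullet> q = 0\<close>; firmness then yields
  \<open>K p = K q = 0\<close>, so that the eigenvector would vanish.\<close>

lemma complex_eigenvalue_real:
  assumes "K p = r *\<^sub>R p - s *\<^sub>R q" "K q = s *\<^sub>R p + r *\<^sub>R q" "p \<noteq> 0 \<or> q \<noteq> 0"
  shows "s = 0"
proof (rule ccontr)
  assume s: "s \<noteq> 0"
  have Jqp: "J q \<bullet> p = J p \<bullet> q" using J_sym[of q p] by (simp add: inner_commute)
  have "J q \<bullet> K p = K q \<bullet> J p" using P_sym[of "J q" "J p"] by simp
  then have "J q \<bullet> (r *\<^sub>R p - s *\<^sub>R q) = J p \<bullet> (s *\<^sub>R p + r *\<^sub>R q)"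
    unfolding assms(1,2) by (simp add: inner_commute)
  then have "- (s * (J q \<bullet> q)) = s * (J p \<bullet> p)"
    by (simp add: inner_diff_right inner_add_right Jqp)
  then have "s * (J p \<bullet> p + J q \<bullet> q) = 0" by (simp add: algebra_simps)
  then have z: "J p \<bullet> p + J q \<bullet> q = 0" using s by simp
  have "K p \<bullet> J p + K q \<bullet> J q = r * (J p \<bullet> p + J q \<bullet> q)"
    unfolding assms(1,2) by (simp add: inner_diff_left inner_add_left inner_commute[of _ "J p"] inner_commute[of _ "J q"] Jqp algebra_simps)
  then have "K p \<bullet> K p + K q \<bullet> K q \<le> 0"
    using P_firm[of "J p"] P_firm[of "J q"] z by simp
  then have "K p = 0" "K q = 0"
    by (smt (verit) inner_ge_zero inner_gt_zero_iff)+
  then have "r *\<^sub>R p = s *\<^sub>R q" "s *\<^sub>R p + r *\<^sub>R q = 0" using assms(1,2) by auto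
  then have "s *\<^sub>R (s *\<^sub>R p + r *\<^sub>R q) = 0" "r *\<^sub>R (r *\<^sub>R p) = r *\<^sub>R s *\<^sub>R q" by auto
  then have "(s * s + r * r) *\<^sub>R p = 0" by (simp add: algebra_simps)
  moreover have "s * s + r * r \<noteq> 0" using s by (simp add: sum_squares_eq_zero_iff)
  ultimately have "p = 0" by (simp only: scaleR_eq_0_iff simp_thms)
  then show False using \<open>r *\<^sub>R p = s *\<^sub>R q\<close> s assms(3) by simp
qed

text \<open>The derivative of the accelerated map at a diagonal point, precomposed with the
  projection onto \<open>T \<times> T\<close>: \<open>K\<close> acts on the derivative
  \<open>(1 + \<beta>) a - \<beta> b\<close> of the extrapolation.\<close>

definition inertial :: "real \<Rightarrow> 'a \<times> 'a \<Rightarrow> 'a \<times> 'a" where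
  "inertial \<beta> z = (K ((1 + \<beta>) *\<^sub>R proj T (fst z) - \<beta> *\<^sub>R proj T (snd z)), proj T (fst z))"

lemma linear_inertial: "linear (inertial \<beta>)"
  unfolding inertial_def
  by (rule linearI) (simp_all add: linear_add[OF proj_linear[OF T]] linear_cmul[OF proj_linear[OF T]]
      linear_add[OF P] linear_add[OF J] linear_diff[OF P] linear_diff[OF J] linear_cmul[OF P]
      linear_cmul[OF J] algebra_simps)

text \<open>For \<open>l \<noteq> 0\<close> the first component \<open>a\<close> of an eigenvector
  is a multiple of a value of \<open>P\<close> and so lies in the complexified \<open>T\<close>. The
  second row then reads \<open>a = l b\<close>, the first
  \<open>((1 + \<beta>) l - \<beta>) K b = l\<^sup>2 b\<close>, so \<open>b\<close> is an
  eigenvector of \<open>K\<close>, whose eigenvalue is real.\<close>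

lemma inertial_eigenvalue:
  assumes \<beta>: "0 \<le> \<beta>" "\<beta> \<le> 1" and \<mu>: "\<And>\<mu> a. a \<noteq> 0 \<Longrightarrow> K a = \<mu> *\<^sub>R a \<Longrightarrow> - (1 / (1 + 2 * \<beta>)) < \<mu>"
    and l: "complex_eigenvalue (inertial \<beta>) l"
  shows "cmod l < 1"
proof (cases "l = 0")
  case l0: False
  note pl = proj_linear[OF T]
  obtain p q where pq: "(p, q) \<noteq> (0, 0)" "inertial \<beta> p = Re l *\<^sub>R p - Im l *\<^sub>R q"
    "inertial \<beta> q = Im l *\<^sub>R p + Re l *\<^sub>R q"
    using l unfolding complex_eigenvalue_def by blast
  define a where "a = (fst p, fst q)"
  define b where "b = (snd p, snd q)"
  define w where "w = ((1 + \<beta>) *\<^sub>R proj T (fst p) - \<beta> *\<^sub>R proj T (snd p), (1 + \<beta>) *\<^sub>R proj T (fst q) - \<beta> *\<^sub>R proj T (snd q))"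
  have e1: "cext K w = cscale l a"
    using pq(2,3)[THEN arg_cong[where f=fst]] by (simp add: cext_def cscale_def a_def w_def inertial_def)
  have e2: "cext (proj T) a = cscale l b"
    using pq(2,3)[THEN arg_cong[where f=snd]] by (simp add: cext_def cscale_def a_def b_def inertial_def)
  have cT: "fst (cscale m z) \<in> T \<and> snd (cscale m z) \<in> T" if "fst z \<in> T" "snd z \<in> T" for m z
    using that T by (auto simp: cscale_def intro!: subspace_add subspace_diff subspace_scale)
  have cancel: "z = cscale (1 / l) (cscale l z)" for z :: "'a \<times> 'a" using l0 by (simp add: cscale_mult)
  have aT: "fst a \<in> T" "snd a \<in> T"
    using cT[of "cext K w" "1 / l"] cancel[of a] unfolding e1[symmetric] by (auto simp: cext_def P_range)
  then have "cext (proj T) a = a" by (simp add: cext_def closest_point_self)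
  then have ab: "a = cscale l b" using e2 by simp
  have bT: "fst b \<in> T" "snd b \<in> T" using cT[OF aT, of "1 / l"] cancel[of b] ab by auto
  have b0: "b \<noteq> 0"
  proof
    assume "b = 0"
    then show False using ab pq(1) by (auto simp: a_def b_def zero_prod_def cscale_def prod_eq_iff)
  qed
  define m where "m = (1 + of_real \<beta>) * l - of_real \<beta>"
  have "w = cscale (1 + of_real \<beta>) a - cscale (of_real \<beta>) b"
    using aT bT by (simp add: w_def cscale_def a_def b_def closest_point_self)
  then have "w = cscale m b" by (simp add: ab cscale_mult m_def cscale_diff_left)
  then have Kb: "cscale m (cext K b) = cscale (l * l) b"
    using e1 by (simp add: ab cscale_mult cext_cscale[OF linear_K])
  have m0: "m \<noteq> 0"
  proof
    assume "m = 0"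
    then have "cscale (l * l) b = 0" using Kb by simp
    then show False using l0 b0 by (simp add: cscale_eq_0)
  qed
  define \<mu> where "\<mu> = l * l / m"
  have "cscale (1 / m) (cscale m (cext K b)) = cscale \<mu> b" unfolding Kb by (simp add: cscale_mult \<mu>_def)
  then have Kb': "cext K b = cscale \<mu> b" using m0 by (simp add: cscale_mult)
  have "Im \<mu> = 0"
    by (rule complex_eigenvalue_real[of "fst b" "Re \<mu>" "Im \<mu>" "snd b"])
      (use Kb' b0 in \<open>auto simp: cext_def cscale_def prod_eq_iff\<close>)
  then have "K (fst b) = Re \<mu> *\<^sub>R fst b" "K (snd b) = Re \<mu> *\<^sub>R snd b" "\<mu> = of_real (Re \<mu>)"
    using Kb' by (auto simp: cext_def cscale_def complex_eq_iff)
  moreover have "fst b \<noteq> 0 \<or> snd b \<noteq> 0" using b0 by (auto simp: prod_eq_iff)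
  ultimately obtain d where d: "d \<noteq> 0" "K d = Re \<mu> *\<^sub>R d" and \<mu>r: "\<mu> = of_real (Re \<mu>)" by blast
  have "l * l = of_real (Re \<mu>) * m" by (subst \<mu>r[symmetric]) (simp add: \<mu>_def m0)
  then show ?thesis
    unfolding m_def by (intro inertial_root_less_1[OF \<beta> \<mu>[OF d] real_eigenvalue_bound[OF d(2,1)]])
qed simp

text \<open>It makes the supremum in \<open>spectral_radius\<close> meaningful. Either
  \<open>K\<close> after the projection has a kernel and 0 is an eigenvalue, or \<open>P\<close> is
  positive definite, the symmetric pencil \<open>P J P x = \<mu> P x\<close> has a solution, and a
  root of the quadratic lifts the eigenvector \<open>P x\<close> of \<open>K\<close>.\<close>

lemma inertial_eigenvalue_exists: "\<exists>l. complex_eigenvalue (inertial \<beta>) l"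
proof (cases "\<exists>b. b \<noteq> 0 \<and> K (proj T b) = 0")
  case True
  then obtain b where b: "b \<noteq> 0" "K (proj T b) = 0" by blast
  have "proj T 0 = 0" using linear_0[OF proj_linear[OF T]] .
  then have "inertial \<beta> (0, b) = 0"
    using b linear_cmul[OF linear_K, of "- \<beta>" "proj T b"] by (simp add: inertial_def zero_prod_def)
  then have "complex_eigenvalue (inertial \<beta>) 0"
    unfolding complex_eigenvalue_def using b(1) linear_0[OF linear_inertial]
    by (intro exI[of _ "(0, b)"] exI[of _ 0]) (simp add: zero_prod_def)
  then show ?thesis ..
next
  case False
  have projT: "proj T b = b" for b
  proof (rule ccontr)
    assume "proj T b \<noteq> b"
    moreover have "proj T (b - proj T b) = 0"
      by (simp add: linear_diff[OF proj_linear[OF T]] closest_point_self[OF proj_in[OF T]])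
    ultimately show False using False linear_0[OF linear_K] by (metis right_minus_eq)
  qed
  have Kinj: "K b = 0 \<Longrightarrow> b = 0" for b using False projT by metis
  have "inj J"
    unfolding linear_injective_0[OF J] using Kinj linear_0[OF P] by metis
  then have "surj J" using linear_injective_imp_surjective[OF J] by simp
  then have Pinj: "P c = 0 \<Longrightarrow> c = 0" for c
    using Kinj linear_0[OF J] by (metis surjD)
  have pos: "0 < c \<bullet> P c" if "c \<noteq> 0" for c
  proof -
    have "0 < P c \<bullet> P c" using Pinj that by (metis inner_gt_zero_iff)
    from order_less_le_trans[OF this P_firm[of c]] show ?thesis by (simp add: inner_commute)
  qed
  have N: "linear (\<lambda>x. K (P x))" using linear_compose[OF P linear_K] by (simp add: o_def)
  have N_sym: "K (P x) \<bullet> y = x \<bullet> K (P y)" for x y by (simp only: P_sym J_sym)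
  obtain x \<mu> where x: "x \<noteq> 0" "K (P x) = \<mu> *\<^sub>R P x"
    by (rule generalized_symmetric_eigenvector[OF N N_sym P P_sym pos])
  define a where "a = P x"
  have a0: "a \<noteq> 0" using Pinj x(1) by (auto simp: a_def)
  have Ka: "K a = \<mu> *\<^sub>R a" using x(2) by (simp add: a_def)
  obtain l :: complex where l: "l * l = (of_real (\<mu> * (1 + \<beta>))) * l - of_real (\<mu> * \<beta>)"
    by (rule complex_quadratic_root_exists[of "of_real (\<mu> * (1 + \<beta>))" "of_real (\<mu> * \<beta>)"])
  have re: "Re l * Re l - Im l * Im l = \<mu> * (1 + \<beta>) * Re l - \<mu> * \<beta>"
    and im: "2 * Re l * Im l = \<mu> * (1 + \<beta>) * Im l"
    using l by (auto simp: complex_eq_iff)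
  have Kc: "K (c *\<^sub>R a) = (c * \<mu>) *\<^sub>R a" for c using linear_cmul[OF linear_K, of c a] Ka by simp
  \<comment> \<open>The complex eigenvector is \<open>(l a, a)\<close>, split into its real part
    \<open>(Re l *\<^sub>R a, a)\<close> and its imaginary part
    \<open>(Im l *\<^sub>R a, 0)\<close>.\<close>
  have "inertial \<beta> (Re l *\<^sub>R a, a) = Re l *\<^sub>R (Re l *\<^sub>R a, a) - Im l *\<^sub>R (Im l *\<^sub>R a, 0)"
  proof -
    have "(1 + \<beta>) *\<^sub>R Re l *\<^sub>R a - \<beta> *\<^sub>R a = ((1 + \<beta>) * Re l - \<beta>) *\<^sub>R a" by (simp add: algebra_simps)
    moreover have "((1 + \<beta>) * Re l - \<beta>) * \<mu> = Re l * Re l - Im l * Im l" using re by (simp add: algebra_simps)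
    ultimately show ?thesis unfolding inertial_def projT fst_conv snd_conv
      by (simp only: Kc) (simp add: scaleR_left_diff_distrib)
  qed
  moreover have "inertial \<beta> (Im l *\<^sub>R a, 0) = Im l *\<^sub>R (Re l *\<^sub>R a, a) + Re l *\<^sub>R (Im l *\<^sub>R a, 0)"
  proof -
    have "(1 + \<beta>) *\<^sub>R Im l *\<^sub>R a - \<beta> *\<^sub>R 0 = ((1 + \<beta>) * Im l) *\<^sub>R a" by simp
    moreover have "((1 + \<beta>) * Im l) * \<mu> = 2 * (Re l * Im l)"
      using im by (simp add: algebra_simps)
    moreover have "(2 * (Re l * Im l)) *\<^sub>R a = Im l *\<^sub>R Re l *\<^sub>R a + Re l *\<^sub>R Im l *\<^sub>R a"
      by (metis mult_2 scaleR_left_distrib scaleR_scaleR mult.commute)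
    ultimately show ?thesis unfolding inertial_def projT fst_conv snd_conv
      by (simp only: Kc) simp
  qed
  ultimately have "complex_eigenvalue (inertial \<beta>) l"
    unfolding complex_eigenvalue_def
    by - (rule exI[of _ "(Re l *\<^sub>R a, a)"], rule exI[of _ "(Im l *\<^sub>R a, 0)"], intro conjI,
      auto simp: a0 zero_prod_def)
  then show ?thesis ..
qed

text \<open>As an infimum, \<open>lambda_min K\<close> lies below each real eigenvalue because these
  are bounded below by -1.\<close>

lemma spectral_radius_inertial:
  assumes \<beta>: "0 \<le> \<beta>" "\<beta> \<le> 1" and lm: "- (1 / (1 + 2 * \<beta>)) < lambda_min K"
  shows "spectral_radius (inertial \<beta>) < 1"
proof -
  have "lambda_min K \<le> \<mu>" if "a \<noteq> 0" "K a = \<mu> *\<^sub>R a" for \<mu> a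
    unfolding lambda_min_def
  proof (rule cInf_lower)
    show "\<mu> \<in> {l. \<exists>v. v \<noteq> 0 \<and> K v = l *\<^sub>R v}" using that by blast
    have "-1 \<le> l" if "l \<in> {l. \<exists>v. v \<noteq> 0 \<and> K v = l *\<^sub>R v}" for l
      using that real_eigenvalue_bound by (smt (verit) mem_Collect_eq)
    then show "bdd_below {l. \<exists>v. v \<noteq> 0 \<and> K v = l *\<^sub>R v}" by (rule bdd_belowI)
  qed
  then have "- (1 / (1 + 2 * \<beta>)) < \<mu>" if "a \<noteq> 0" "K a = \<mu> *\<^sub>R a" for \<mu> a
    using lm that by (meson order_less_le_trans)
  then show ?thesis
    using inertial_eigenvalue[OF \<beta>] inertial_eigenvalue_exists spectral_radius_less_1[OF linear_inertial] by metis
qed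

text \<open>A vector fixed by \<open>inertial\<close> has the form \<open>(d, d)\<close> with
  \<open>K d = d\<close>, and 1 is not an eigenvalue of \<open>K\<close>. This argument applies
  along the whole solution map near the base point.\<close>

lemma inertial_resolvent_bij: "bij (\<lambda>w. w - inertial \<beta> w)"
proof -
  have lin: "linear (\<lambda>w. w - inertial \<beta> w)" by (intro linear_compose_sub linear_ident linear_inertial)
  have "w = 0" if "w - inertial \<beta> w = 0" for w
  proof -
    have w1: "fst w = K ((1 + \<beta>) *\<^sub>R proj T (fst w) - \<beta> *\<^sub>R proj T (snd w))" and w2: "snd w = proj T (fst w)"
      using that by (metis eq_iff_diff_eq_0 inertial_def fst_conv snd_conv)+
    have "fst w \<in> T" using w1 P_range by metis
    then have "proj T (fst w) = fst w" "proj T (snd w) = fst w" using w2 by (simp_all add: closest_point_self)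
    then have "K (fst w) = fst w" using w1 by (simp add: scaleR_left_distrib)
    then have "fst w = 0" by (rule fixed_point_trivial)
    then show ?thesis using w2 linear_0[OF proj_linear[OF T]] by (simp add: prod_eq_iff)
  qed
  then have "inj (\<lambda>w. w - inertial \<beta> w)" using linear_injective_0[OF lin] by blast
  then show ?thesis using linear_injective_imp_surjective[OF lin] by (simp add: bij_def)
qed

end

section \<open>The update maps\<close>

lemma partial_gradient_C1:
  fixes f :: "'x::euclidean_space \<times> 'u::euclidean_space \<Rightarrow> real"
  assumes "C2_on f UNIV"
  obtains G G' where "\<And>x u. GDERIV (\<lambda>y. f (y, u)) x :> G (x, u)"
    "\<And>z. (G has_derivative blinfun_apply (G' z)) (at z)" "continuous_on UNIV G'"
proof -
  obtain E where E: "\<forall>z\<in>UNIV. (f has_derivative blinfun_apply (E z)) (at z)" and E1: "C1_on E UNIV"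
    using assms unfolding C2_on_def by (elim exE conjE)
  define G where "G z = (\<Sum>b\<in>Basis. E z (b, 0) *\<^sub>R b)" for z
  have gd: "GDERIV (\<lambda>y. f (y, u)) x :> G (x, u)" for x u
    unfolding G_def
    by (rule gderiv_of_has_derivative)
      (rule has_derivative_compose[OF has_derivative_insert_left bspec[OF E UNIV_I]])
  have "C1_on G UNIV"
    unfolding G_def
    by (intro C1_on_sum finite_Basis open_UNIV C1_on_bilinear[OF bounded_bilinear_scaleR]
        C1_on_bilinear[OF bounded_bilinear_blinfun_apply E1] C1_on_const)
  then obtain G' where G': "\<And>z. z \<in> UNIV \<Longrightarrow> (G has_derivative blinfun_apply (G' z)) (at z)" "continuous_on UNIV G'"
    "\<And>h. continuous_on UNIV (\<lambda>z. blinfun_apply (G' z) h)"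
    by (rule C1_onE) (rule that; assumption)
  show ?thesis by (rule that[OF gd G'(1)[OF UNIV_I] G'(2)])
qed

lemma gderiv_small_o:
  assumes "GDERIV f x :> G" "0 < e"
  shows "\<forall>\<^sub>F y in nhds x. \<bar>f y - f x - G \<bullet> (y - x)\<bar> \<le> e * norm (y - x)"
proof -
  have "\<exists>d>0. \<forall>y. norm (y - x) < d \<longrightarrow> norm (f y - f x - (y - x) \<bullet> G) \<le> e * norm (y - x)"
    using assms unfolding gderiv_def has_derivative_at_alt by blast
  then show ?thesis unfolding eventually_nhds_metric by (simp add: dist_norm inner_commute)
qed

text \<open>The first-order expansion makes the gradient a regular subgradient; convexity of the
  epigraph makes the inequality global.\<close>

lemma convex_gradient_inequality:
  fixes f0 :: "'a::euclidean_space \<Rightarrow> real"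
  assumes cv: "convex_on UNIV f0" and G: "GDERIV f0 x :> G"
  shows "f0 x + G \<bullet> (y - x) \<le> f0 y"
proof -
  have "epi (\<lambda>y. ereal (f0 y)) = epigraph UNIV f0"
    by (auto simp: epi_def epigraph_def)
  then have "convex (epi (\<lambda>y. ereal (f0 y)))" using cv by (simp add: convex_epigraph)
  moreover have "G \<in> regular_subdiff (\<lambda>y. ereal (f0 y)) x"
    unfolding regular_subdiff_def mem_Collect_eq
  proof (intro conjI allI impI)
    fix e :: real assume "0 < e"
    from gderiv_small_o[OF G this]
    show "\<forall>\<^sub>F y in nhds x. ereal (f0 x) + ereal (G \<bullet> (y - x) - e * norm (y - x)) \<le> ereal (f0 y)"
      by eventually_elim (simp add: abs_le_iff)
  qed simp
  ultimately have "G \<in> convex_subdiff (\<lambda>y. ereal (f0 y)) x" by (rule convex_subdiff_if_regular)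
  then have "ereal (f0 x) + ereal (G \<bullet> (y - x)) \<le> ereal (f0 y)" unfolding convex_subdiff_def by blast
  then show ?thesis by simp
qed

text \<open>Subtracting the expansion of \<open>f0\<close> from a subgradient inequality of the sum
  leaves a regular subgradient of \<open>h\<close>, which convexity promotes to a convex
  one.\<close>

lemma convex_subdiff_sum:
  fixes h :: "'a::euclidean_space \<Rightarrow> ereal"
  assumes cv: "convex_on UNIV f0" and G: "GDERIV f0 x :> G" and ch: "convex (epi h)"
  shows "convex_subdiff (\<lambda>y. ereal (f0 y) + h y) x = (+) G ` convex_subdiff h x"
proof
  show "convex_subdiff (\<lambda>y. ereal (f0 y) + h y) x \<subseteq> (+) G ` convex_subdiff h x"
  proof
    fix w assume w: "w \<in> convex_subdiff (\<lambda>y. ereal (f0 y) + h y) x"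
    then obtain r0 where r0: "h x = ereal r0" unfolding convex_subdiff_def by (cases "h x") auto
    have "w - G \<in> regular_subdiff h x"
      unfolding regular_subdiff_def mem_Collect_eq
    proof (intro conjI allI impI)
      show "\<bar>h x\<bar> \<noteq> \<infinity>" by (simp add: r0)
      fix e :: real assume "0 < e"
      from gderiv_small_o[OF G this]
      show "\<forall>\<^sub>F y in nhds x. h x + ereal ((w - G) \<bullet> (y - x) - e * norm (y - x)) \<le> h y"
      proof eventually_elim
        case (elim y)
        have "ereal (f0 x) + h x + ereal (w \<bullet> (y - x)) \<le> ereal (f0 y) + h y"
          using w unfolding convex_subdiff_def by blast
        then show ?case using elim by (cases "h y") (auto simp: r0 abs_le_iff inner_diff_left)
      qed
    qed
    then have "w - G \<in> convex_subdiff h x" by (rule convex_subdiff_if_regular[OF ch])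
    then show "w \<in> (+) G ` convex_subdiff h x" by (rule rev_image_eqI) simp
  qed
  show "(+) G ` convex_subdiff h x \<subseteq> convex_subdiff (\<lambda>y. ereal (f0 y) + h y) x"
  proof
    fix w assume "w \<in> (+) G ` convex_subdiff h x"
    then obtain v where v: "v \<in> convex_subdiff h x" "w = G + v" by auto
    obtain r0 where r0: "h x = ereal r0" using v(1) unfolding convex_subdiff_def by (cases "h x") auto
    have "ereal (f0 x) + h x + ereal (w \<bullet> (y - x)) \<le> ereal (f0 y) + h y" for y
    proof -
      have "h x + ereal (v \<bullet> (y - x)) \<le> h y" using v(1) unfolding convex_subdiff_def by blast
      then show ?thesis using convex_gradient_inequality[OF cv G, of y]
        by (cases "h y") (auto simp: r0 v(2) inner_add_left)
    qed
    then show "w \<in> convex_subdiff (\<lambda>y. ereal (f0 y) + h y) x"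
      unfolding convex_subdiff_def by (simp add: r0)
  qed
qed

locale parametric_optimization = partly_smooth_family g M \<Omega>
  for g :: "'x::euclidean_space \<times> 'u::euclidean_space \<Rightarrow> ereal" and M \<Omega> +
  fixes f :: "'x \<times> 'u \<Rightarrow> real" and G :: "'x \<times> 'u \<Rightarrow> 'x" and G' :: "'x \<times> 'u \<Rightarrow> ('x \<times> 'u) \<Rightarrow>\<^sub>L 'x" and L \<alpha> :: real
  assumes G: "GDERIV (\<lambda>y. f (y, u)) x :> G (x, u)"
    and G': "(G has_derivative blinfun_apply (G' z)) (at z)" and cont_G': "continuous_on UNIV G'"
    and convex_f: "u \<in> \<Omega> \<Longrightarrow> convex_on UNIV (\<lambda>x. f (x, u))"
    and lip: "u \<in> \<Omega> \<Longrightarrow> L-lipschitz_on UNIV (grad (\<lambda>x. f (x, u)))"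
    and \<alpha>: "0 < \<alpha>" "\<alpha> * L < 2"
begin

lemma grad_f: "grad (\<lambda>x. f (x, u)) = (\<lambda>x. G (x, u))"
  using grad_eqI[OF G] by blast

lemma partial_G: "((\<lambda>y. G (y, u)) has_derivative (\<lambda>a. G' (x, u) (a, 0))) (at x)"
  by (rule has_derivative_compose[OF has_derivative_insert_left G'])

lemma hess_f: "hess (\<lambda>y. f (y, u)) x = (\<lambda>a. G' (x, u) (a, 0))"
  unfolding hess_def grad_f using frechet_derivative_at[OF partial_G] by simp

lemma hess_symmetric: "G' (x, u) (a, 0) \<bullet> b = a \<bullet> G' (x, u) (b, 0)"
  by (rule gradient_derivative_symmetric[OF _ partial_G, of "\<lambda>y. f (y, u)"]) (simp add: G)

text \<open>Difference quotients of the Lipschitz gradient are bounded by \<open>L * norm a\<close>,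
  hence so is the Hessian applied to \<open>a\<close>; Cauchy-Schwarz bounds the form.\<close>

lemma hess_bound:
  assumes "u \<in> \<Omega>"
  shows "a \<bullet> G' (x, u) (a, 0) \<le> L * (a \<bullet> a)"
proof -
  have "((\<lambda>y. G (y, u)) has_derivative (\<lambda>a. G' (x, u) (a, 0))) (at (x + 0 *\<^sub>R a))"
    using partial_G by simp
  then have "((\<lambda>t. G (x + t *\<^sub>R a, u)) has_derivative (\<lambda>t. G' (x, u) (t *\<^sub>R a, 0))) (at (0::real))"
    by (rule has_derivative_compose[OF has_derivative_line])
  moreover have "G' (x, u) (t *\<^sub>R a, 0) = t *\<^sub>R G' (x, u) (a, 0)" for t
    using linear_cmul[OF has_derivative_linear[OF partial_G[of u x]], of t a] by simp
  ultimately have "((\<lambda>t. G (x + t *\<^sub>R a, u)) has_vector_derivative G' (x, u) (a, 0)) (at 0)"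
    by (simp add: has_vector_derivative_def)
  from tendsto_norm[OF vector_derivative_quotient[OF this]]
  have lim: "((\<lambda>t. norm ((1 / t) *\<^sub>R (G (x + t *\<^sub>R a, u) - G (x + 0 *\<^sub>R a, u)))) \<longlongrightarrow> norm (G' (x, u) (a, 0))) (at 0)" .
  have "norm ((1 / t) *\<^sub>R (G (x + t *\<^sub>R a, u) - G (x + 0 *\<^sub>R a, u))) \<le> L * norm a" if "t \<noteq> 0" for t
  proof -
    have "dist (G (x + t *\<^sub>R a, u)) (G (x, u)) \<le> L * dist (x + t *\<^sub>R a) x"
      using lip[OF assms] unfolding grad_f by (rule lipschitz_onD) auto
    then have "norm (G (x + t *\<^sub>R a, u) - G (x, u)) \<le> (L * norm a) * \<bar>t\<bar>"
      by (simp add: dist_norm mult_ac)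
    moreover have "norm ((1 / t) *\<^sub>R \<Delta>) = norm \<Delta> / \<bar>t\<bar>" for \<Delta> :: 'x by simp
    moreover have "0 < \<bar>t\<bar>" using that by simp
    ultimately show ?thesis by (simp only: pos_divide_le_eq scaleR_zero_left add_0_right)
  qed
  then have "norm (G' (x, u) (a, 0)) \<le> L * norm a"
    by (intro tendsto_upperbound[OF lim]) (simp_all add: eventually_at_filter)
  then have "norm a * norm (G' (x, u) (a, 0)) \<le> norm a * (L * norm a)" by (rule mult_left_mono) simp
  moreover have "a \<bullet> G' (x, u) (a, 0) \<le> norm a * norm (G' (x, u) (a, 0))" by (rule norm_cauchy_schwarz)
  moreover have "norm a * (L * norm a) = L * (a \<bullet> a)"
    by (simp add: power2_norm_eq_inner[symmetric] power2_eq_square)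
  ultimately show ?thesis by linarith
qed

lemma RPD_ii_iff:
  assumes "x \<in> M"
  shows "RPD_ii f M x u \<longleftrightarrow> (\<forall>a\<in>tangent_space M x. a \<noteq> 0 \<longrightarrow> 0 < a \<bullet> G' (x, u) (a, 0))"
proof -
  have "a \<bullet> proj (tangent_space M x) b = a \<bullet> b" if "a \<in> tangent_space M x" for a b
    using proj_inner[OF subspace_tangent_space[OF M assms] that, of b] by (simp add: inner_commute)
  then show ?thesis unfolding RPD_ii_def pos_def_on_def hess_f by simp
qed

text \<open>Adding the gradient translates the subdifferential together with its relative interior.
  With \<open>v = - G (x, u)\<close>, the base point \<open>x + \<alpha> v\<close> of the proximal
  analysis is the gradient step from \<open>x\<close>.\<close>

lemma ND_gradient:
  assumes "x \<in> M" "u \<in> \<Omega>" "ND f g x u"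
  shows "- G (x, u) \<in> rel_interior (convex_subdiff (\<lambda>x. g (x, u)) x)"
proof -
  have "convex_subdiff (obj f g u) x = (+) (G (x, u)) ` convex_subdiff (\<lambda>x. g (x, u)) x"
    unfolding obj_def by (rule convex_subdiff_sum[OF convex_f[OF assms(2)] G cv[OF assms(2)]])
  then have "0 \<in> (+) (G (x, u)) ` rel_interior (convex_subdiff (\<lambda>x. g (x, u)) x)"
    using assms(3) unfolding ND_def by (simp add: rel_interior_translation)
  then obtain w where "w \<in> rel_interior (convex_subdiff (\<lambda>x. g (x, u)) x)" "0 = G (x, u) + w" by blast
  then show ?thesis by (metis minus_unique)
qed

lemma pg_map_eq: "pg_map f g \<alpha> x u = prox \<alpha> g (x - \<alpha> *\<^sub>R G (x, u)) u"
  unfolding pg_map_def grad_f ..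

lemma pg_map_fixed_point:
  assumes "x \<in> M" "u \<in> \<Omega>" "ND f g x u"
  shows "pg_map f g \<alpha> x u = x"
  unfolding pg_map_eq
proof (rule prox_eqI[OF \<alpha>(1)])
  have "- G (x, u) \<in> convex_subdiff (\<lambda>x. g (x, u)) x"
    using ND_gradient[OF assms] rel_interior_subset by blast
  then show "(1 / \<alpha>) *\<^sub>R (x - \<alpha> *\<^sub>R G (x, u) - x) \<in> convex_subdiff (\<lambda>x. g (x, u)) x"
    using \<alpha>(1) by simp
qed

lemma pg_map_derivative:
  assumes x: "x \<in> M" and u: "u \<in> \<Omega>" and nd: "ND f g x u"
  obtains D where "((\<lambda>z. pg_map f g \<alpha> (fst z) (snd z)) has_derivative D) (at (x, u))"
    "((\<lambda>y. pg_map f g \<alpha> y u) has_derivative (\<lambda>a. D (a, 0))) (at x)"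
    "((\<lambda>w. pg_map f g \<alpha> x w) has_derivative (\<lambda>b. D (0, b))) (at u)"
    "RPD_ii f M x u \<Longrightarrow> \<exists>P J. prox_gradient_derivative P J (tangent_space M x) \<and> (\<forall>a. D (a, 0) = P (J a))"
proof -
  note v = ND_gradient[OF assms]
  obtain Q where Q: "((\<lambda>z. prox \<alpha> g (fst z) (snd z)) has_derivative Q) (at (x + \<alpha> *\<^sub>R (- G (x, u)), u))"
    using prox_smooth(1)[OF x u \<alpha>(1) v] unfolding differentiable_def by blast
  define D where "D h = Q (fst h - \<alpha> *\<^sub>R G' (x, u) h, snd h)" for h
  have i1: "((\<lambda>z. (fst z - \<alpha> *\<^sub>R G z, snd z)) has_derivative (\<lambda>h. (fst h - \<alpha> *\<^sub>R G' (x, u) h, snd h))) (at (x, u))"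
    by (intro has_derivative_Pair has_derivative_diff has_derivative_fst has_derivative_snd has_derivative_ident
        has_derivative_scaleR_right G')
  have i2: "((\<lambda>z. prox \<alpha> g (fst z) (snd z)) has_derivative Q) (at (fst (x, u) - \<alpha> *\<^sub>R G (x, u), snd (x, u)))"
    using Q by simp
  have D: "((\<lambda>z. pg_map f g \<alpha> (fst z) (snd z)) has_derivative D) (at (x, u))"
    using has_derivative_compose[OF i1 i2] by (simp add: pg_map_eq D_def[abs_def])
  show ?thesis
  proof (rule that[OF D])
    show "((\<lambda>y. pg_map f g \<alpha> y u) has_derivative (\<lambda>a. D (a, 0))) (at x)"
      using has_derivative_compose[OF has_derivative_insert_left D] by simp
    show "((\<lambda>w. pg_map f g \<alpha> x w) has_derivative (\<lambda>b. D (0, b))) (at u)"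
      using has_derivative_compose[OF has_derivative_insert_right D] by simp
    assume rpd: "RPD_ii f M x u"
    define P where "P a = Q (a, 0)" for a
    define J where "J a = a - \<alpha> *\<^sub>R G' (x, u) (a, 0)" for a
    note pd = prox_derivative[OF x u \<alpha>(1) v Q]
    have "prox_gradient_derivative P J (tangent_space M x)"
    proof (rule prox_gradient_derivative.intro)
      have linQ: "linear Q" by (rule has_derivative_linear[OF Q])
      show "linear P"
        unfolding P_def by (rule linear_compose[OF _ linQ, unfolded o_def])
          (intro bounded_linear.linear bounded_linear_Pair bounded_linear_ident bounded_linear_zero)
      show "P a \<bullet> b = a \<bullet> P b" "P a \<bullet> P a \<le> P a \<bullet> a" "P a \<in> tangent_space M x" for a b
        unfolding P_def by (rule pd)+
      show "linear J" unfolding J_def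
        by (intro linear_compose_sub linear_ident linear_compose_scale_right has_derivative_linear[OF partial_G])
      show "J a \<bullet> b = a \<bullet> J b" for a b
        by (simp add: J_def inner_diff_left inner_diff_right hess_symmetric)
      show "subspace (tangent_space M x)" by (rule subspace_tangent_space[OF M x])
      \<comment> \<open>\<open>a \<bullet> J a\<close> is \<open>a \<bullet> a\<close> minus
        \<alpha> times the Hessian form: RPD-ii keeps the subtracted term positive, and the
        Lipschitz bound with \<open>\<alpha> * L < 2\<close> keeps it below twice
        \<open>a \<bullet> a\<close>.\<close>
      show "\<bar>a \<bullet> J a\<bar> < a \<bullet> a" if a: "a \<in> tangent_space M x" "a \<noteq> 0" for a
      proof -
        have "0 < a \<bullet> G' (x, u) (a, 0)" using rpd a unfolding RPD_ii_iff[OF x] by blast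
        then have "0 < \<alpha> * (a \<bullet> G' (x, u) (a, 0))" using \<alpha> by simp
        moreover have "\<alpha> * (a \<bullet> G' (x, u) (a, 0)) \<le> \<alpha> * (L * (a \<bullet> a))"
          using hess_bound[OF u] \<alpha> by (intro mult_left_mono) auto
        moreover have "(\<alpha> * L) * (a \<bullet> a) < 2 * (a \<bullet> a)"
          using \<alpha> a(2) by (intro mult_strict_right_mono) auto
        ultimately show ?thesis by (simp add: J_def inner_diff_right mult.assoc)
      qed
    qed
    moreover have "D (a, 0) = P (J a)" for a by (simp add: D_def P_def J_def)
    ultimately show "\<exists>P J. prox_gradient_derivative P J (tangent_space M x) \<and> (\<forall>a. D (a, 0) = P (J a))" by blast
  qed
qed

text \<open>Otherwise unit tangent vectors with nonpositive Hessian form, at parameters tending to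
  \<open>u0\<close>, would accumulate at such a vector tangent at \<open>\<psi> u0\<close>. This is
  where the neighbourhood has to shrink.\<close>

lemma RPD_ii_eventually:
  assumes U: "open U" "u0 \<in> U" and \<psi>: "continuous_on U \<psi>" "\<psi> ` U \<subseteq> M"
    and rpd: "RPD_ii f M (\<psi> u0) u0"
  shows "\<forall>\<^sub>F u in nhds u0. u \<in> U \<longrightarrow> RPD_ii f M (\<psi> u) u"
proof (rule ccontr)
  assume neg: "\<not> ?thesis"
  have "\<exists>u a. dist u u0 < inverse (real (Suc n)) \<and> u \<in> U \<and> a \<in> tangent_space M (\<psi> u) \<and> a \<noteq> 0 \<and> a \<bullet> G' (\<psi> u, u) (a, 0) \<le> 0" for n
  proof -
    have "\<exists>u. dist u u0 < inverse (real (Suc n)) \<and> u \<in> U \<and> \<not> RPD_ii f M (\<psi> u) u"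
      using neg unfolding eventually_nhds_metric by (metis inverse_positive_iff_positive of_nat_0_less_iff zero_less_Suc)
    then obtain u where u: "dist u u0 < inverse (real (Suc n))" "u \<in> U" "\<not> RPD_ii f M (\<psi> u) u" by blast
    have "\<psi> u \<in> M" using \<psi>(2) u(2) by blast
    from u(3)[unfolded RPD_ii_iff[OF this]] show ?thesis using u(1,2) by (meson not_less)
  qed
  then obtain X b where Xb: "\<And>n. dist (X n) u0 < inverse (real (Suc n))" "\<And>n. X n \<in> U"
    "\<And>n. b n \<in> tangent_space M (\<psi> (X n))" "\<And>n. b n \<noteq> 0" "\<And>n. b n \<bullet> G' (\<psi> (X n), X n) (b n, 0) \<le> 0"
    by metis
  have \<psi>M: "\<psi> (X n) \<in> M" for n using \<psi>(2) Xb(2) by blast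
  have \<psi>0: "\<psi> u0 \<in> M" using \<psi>(2) U(2) by blast
  define a where "a n = b n /\<^sub>R norm (b n)" for n
  have na: "a n \<in> sphere 0 1" for n using Xb(4)[of n] by (simp add: a_def)
  have aT: "a n \<in> tangent_space M (\<psi> (X n))" for n
    unfolding a_def by (intro subspace_scale subspace_tangent_space M \<psi>M Xb(3))
  have aG: "a n \<bullet> G' (\<psi> (X n), X n) (a n, 0) \<le> 0" for n
  proof -
    have "G' (\<psi> (X n), X n) (a n, 0) = G' (\<psi> (X n), X n) (b n, 0) /\<^sub>R norm (b n)"
      unfolding a_def using linear_cmul[OF has_derivative_linear[OF partial_G]] .
    then show ?thesis using Xb(5)[of n] by (simp add: a_def mult_nonneg_nonpos)
  qed
  have "compact (sphere (0::'x) 1)" by simp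
  then obtain a0 \<sigma> where \<sigma>: "a0 \<in> sphere 0 1" "strict_mono (\<sigma> :: nat \<Rightarrow> nat)" "(a \<circ> \<sigma>) \<longlonglongrightarrow> a0"
    unfolding compact_def using na by meson
  have Xlim: "X \<longlonglongrightarrow> u0" by (rule LIMSEQ_if_dist_less_inverse[OF Xb(1)])
  have Xs: "(\<lambda>n. X (\<sigma> n)) \<longlonglongrightarrow> u0" using LIMSEQ_subseq_LIMSEQ[OF Xlim \<sigma>(2)] by (simp add: o_def)
  have as: "(\<lambda>n. a (\<sigma> n)) \<longlonglongrightarrow> a0" using \<sigma>(3) by (simp add: o_def)
  have \<psi>s: "(\<lambda>n. \<psi> (X (\<sigma> n))) \<longlonglongrightarrow> \<psi> u0"
    by (rule continuous_on_tendsto_compose[OF \<psi>(1) Xs U(2)]) (simp add: Xb(2))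
  obtain V \<phi> \<phi>' S A B where ch: "chart M V \<phi> \<phi>' S A B" "\<psi> u0 \<in> V" using chart_exists[OF M \<psi>0] .
  have a0T: "a0 \<in> tangent_space M (\<psi> u0)"
    by (rule chart.tangent_limit[OF ch \<psi>0 \<psi>s \<psi>M aT as])
  have "(\<lambda>n. G' (\<psi> (X (\<sigma> n)), X (\<sigma> n))) \<longlonglongrightarrow> G' (\<psi> u0, u0)"
    by (rule continuous_on_tendsto_compose[OF cont_G' tendsto_Pair[OF \<psi>s Xs]]) auto
  then have "(\<lambda>n. a (\<sigma> n) \<bullet> G' (\<psi> (X (\<sigma> n)), X (\<sigma> n)) (a (\<sigma> n), 0)) \<longlonglongrightarrow> a0 \<bullet> G' (\<psi> u0, u0) (a0, 0)"
    by (intro tendsto_inner as bounded_bilinear.tendsto[OF bounded_bilinear_blinfun_apply] tendsto_Pair tendsto_const)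
  then have "a0 \<bullet> G' (\<psi> u0, u0) (a0, 0) \<le> 0"
    by (rule tendsto_upperbound) (simp_all add: aG)
  moreover have "a0 \<noteq> 0" using \<sigma>(1) by auto
  ultimately show False using rpd a0T unfolding RPD_ii_iff[OF \<psi>0] by (metis not_less)
qed

lemma apg_map_derivative:
  assumes "((\<lambda>y. pg_map f g \<alpha> y u) has_derivative K) (at x)"
  shows "((\<lambda>z. apg_map f g \<alpha> \<beta> z u) has_derivative (\<lambda>h. (K (fst h + \<beta> *\<^sub>R (fst h - snd h)), fst h))) (at (x, x))"
proof -
  have i: "((\<lambda>z. fst z + \<beta> *\<^sub>R (fst z - snd z)) has_derivative (\<lambda>h. fst h + \<beta> *\<^sub>R (fst h - snd h))) (at (x, x))"
    by (intro has_derivative_add has_derivative_scaleR_right has_derivative_diff has_derivative_fst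
        has_derivative_snd has_derivative_ident)
  have j: "((\<lambda>y. pg_map f g \<alpha> y u) has_derivative K) (at (fst (x, x) + \<beta> *\<^sub>R (fst (x, x) - snd (x, x))))"
    using assms by simp
  show ?thesis
    unfolding apg_map_def
    by (intro has_derivative_Pair has_derivative_compose[OF i j] has_derivative_fst has_derivative_ident)
qed

lemma apg_map_derivative_inertial:
  assumes D: "((\<lambda>y. pg_map f g \<alpha> y u) has_derivative K) (at x)"
    and pj: "prox_gradient_derivative P J (tangent_space M x)" and K: "\<And>a. K a = P (J a)"
  shows "frechet_derivative (\<lambda>z. apg_map f g \<alpha> \<beta> z u) (at (x, x)) (proj2 M (x, x) w)
    = prox_gradient_derivative.inertial P J (tangent_space M x) \<beta> w"
proof -
  have "a + \<beta> *\<^sub>R (a - b) = (1 + \<beta>) *\<^sub>R a - \<beta> *\<^sub>R b" for a b :: 'x by (simp add: algebra_simps)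
  then show ?thesis
    unfolding frechet_derivative_at[OF apg_map_derivative[OF D], symmetric]
      prox_gradient_derivative.inertial_def[OF pj] proj2_def K
    by simp
qed

lemma spectral_radius_apg_map:
  assumes x: "x \<in> M" and u: "u \<in> \<Omega>" and nd: "ND f g x u" and rpd: "RPD_ii f M x u"
    and \<beta>: "0 \<le> \<beta>" "\<beta> \<le> 1"
    and lm: "- (1 / (1 + 2 * \<beta>)) < lambda_min (frechet_derivative (\<lambda>x. pg_map f g \<alpha> x u) (at x))"
  shows "(\<lambda>z. apg_map f g \<alpha> \<beta> z u) differentiable (at (x, x))"
    "spectral_radius (frechet_derivative (\<lambda>z. apg_map f g \<alpha> \<beta> z u) (at (x, x)) \<circ> proj2 M (x, x)) < 1"
proof -
  obtain D where D: "((\<lambda>z. pg_map f g \<alpha> (fst z) (snd z)) has_derivative D) (at (x, u))"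
    "((\<lambda>y. pg_map f g \<alpha> y u) has_derivative (\<lambda>a. D (a, 0))) (at x)"
    "((\<lambda>w. pg_map f g \<alpha> x w) has_derivative (\<lambda>b. D (0, b))) (at u)"
    "RPD_ii f M x u \<Longrightarrow> \<exists>P J. prox_gradient_derivative P J (tangent_space M x) \<and> (\<forall>a. D (a, 0) = P (J a))"
    by (rule pg_map_derivative[OF x u nd]) (rule that; assumption)
  obtain P J where pj: "prox_gradient_derivative P J (tangent_space M x)" and K: "\<And>a. D (a, 0) = P (J a)"
    using D(4)[OF rpd] by blast
  show "(\<lambda>z. apg_map f g \<alpha> \<beta> z u) differentiable (at (x, x))"
    using apg_map_derivative[OF D(2)] by (rule differentiableI)
  have fd: "frechet_derivative (\<lambda>x. pg_map f g \<alpha> x u) (at x) = (\<lambda>a. P (J a))"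
    using frechet_derivative_at[OF D(2)] by (simp add: K)
  have "frechet_derivative (\<lambda>z. apg_map f g \<alpha> \<beta> z u) (at (x, x)) \<circ> proj2 M (x, x)
    = prox_gradient_derivative.inertial P J (tangent_space M x) \<beta>"
    using apg_map_derivative_inertial[OF D(2) pj K] by (intro ext) simp
  then show "spectral_radius (frechet_derivative (\<lambda>z. apg_map f g \<alpha> \<beta> z u) (at (x, x)) \<circ> proj2 M (x, x)) < 1"
    using prox_gradient_derivative.spectral_radius_inertial[OF pj \<beta> lm[unfolded fd]] by simp
qed

text \<open>Differentiating the fixed point equation gives \<open>d = P (J d) + D (0, v)\<close> for
  the derivative \<open>d\<close> of \<psi> along \<open>v\<close>. As \<open>d\<close> is tangent,
  the projections fix it, and \<open>(d, d)\<close> solves the resolvent equation with right-hand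
  side \<open>(D (0, v), 0)\<close>.\<close>

lemma implicit_derivative_apg_map:
  fixes \<psi> :: "'u \<Rightarrow> 'x" and \<beta> :: real
  assumes U: "open U" "u \<in> U" "U \<subseteq> \<Omega>" and \<psi>: "\<psi> ` U \<subseteq> M" "\<psi> differentiable (at u)"
    and nd: "\<And>w. w \<in> U \<Longrightarrow> ND f g (\<psi> w) w" and rpd: "RPD_ii f M (\<psi> u) u"
  defines "z \<equiv> (\<psi> u, \<psi> u)"
  defines "R \<equiv> (\<lambda>w. w - frechet_derivative (\<lambda>z'. apg_map f g \<alpha> \<beta> z' u) (at z) (proj2 M z w))"
  shows "z = apg_map f g \<alpha> \<beta> z u" "(\<lambda>z'. apg_map f g \<alpha> \<beta> z' u) differentiable (at z)"
    "(\<lambda>u'. apg_map f g \<alpha> \<beta> z u') differentiable (at u)" "bij R"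
    "(frechet_derivative \<psi> (at u) v, frechet_derivative \<psi> (at u) v)
      = inv R (frechet_derivative (\<lambda>u'. apg_map f g \<alpha> \<beta> z u') (at u) v)"
proof -
  define x where "x = \<psi> u"
  have x: "x \<in> M" and u: "u \<in> \<Omega>" using U \<psi> by (auto simp: x_def)
  have fp: "pg_map f g \<alpha> (\<psi> w) w = \<psi> w" if "w \<in> U" for w
    by (rule pg_map_fixed_point) (use that U \<psi> nd in auto)
  have ndx: "ND f g x u" unfolding x_def by (rule nd[OF U(2)])
  obtain D where D: "((\<lambda>z. pg_map f g \<alpha> (fst z) (snd z)) has_derivative D) (at (x, u))"
    "((\<lambda>y. pg_map f g \<alpha> y u) has_derivative (\<lambda>a. D (a, 0))) (at x)"
    "((\<lambda>w. pg_map f g \<alpha> x w) has_derivative (\<lambda>b. D (0, b))) (at u)"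
    "RPD_ii f M x u \<Longrightarrow> \<exists>P J. prox_gradient_derivative P J (tangent_space M x) \<and> (\<forall>a. D (a, 0) = P (J a))"
    by (rule pg_map_derivative[OF x u ndx]) (rule that; assumption)
  obtain P J where pj: "prox_gradient_derivative P J (tangent_space M x)" and K: "\<And>a. D (a, 0) = P (J a)"
    using D(4) rpd unfolding x_def by blast
  interpret pj: prox_gradient_derivative P J "tangent_space M x" by (rule pj)
  have z: "z = (x, x)" by (simp add: z_def x_def)
  show "z = apg_map f g \<alpha> \<beta> z u" using fp[OF U(2)] by (simp add: apg_map_def z_def)
  show "(\<lambda>z'. apg_map f g \<alpha> \<beta> z' u) differentiable (at z)"
    unfolding z using apg_map_derivative[OF D(2)] by (rule differentiableI)
  \<comment> \<open>The second component of \<open>apg_map\<close> is a component of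
    \<open>z\<close> itself and does not vary with the parameter.\<close>
  have Du: "((\<lambda>u'. apg_map f g \<alpha> \<beta> z u') has_derivative (\<lambda>b. (D (0, b), 0))) (at u)"
    unfolding apg_map_def z using has_derivative_Pair[OF D(3) has_derivative_const[of x]] by simp
  then show "(\<lambda>u'. apg_map f g \<alpha> \<beta> z u') differentiable (at u)" by (rule differentiableI)
  have R: "R = (\<lambda>w. w - pj.inertial \<beta> w)"
    unfolding R_def z apg_map_derivative_inertial[OF D(2) pj K] ..
  show bij: "bij R" unfolding R by (rule pj.inertial_resolvent_bij)
  define D\<psi> where "D\<psi> = frechet_derivative \<psi> (at u)"
  have \<psi>d: "(\<psi> has_derivative D\<psi>) (at u)"
    using \<psi>(2) unfolding D\<psi>_def by (simp add: frechet_derivative_works)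
  define d where "d = D\<psi> v"
  have dT: "d \<in> tangent_space M x"
  proof -
    obtain V \<phi> \<phi>' S A B where ch: "chart M V \<phi> \<phi>' S A B" "x \<in> V" using chart_exists[OF M x] .
    have \<psi>d': "(\<psi> has_derivative D\<psi>) (at (u + 0 *\<^sub>R v))" using \<psi>d by simp
    have "((\<lambda>t. \<psi> (u + t *\<^sub>R v)) has_derivative (\<lambda>t. D\<psi> (t *\<^sub>R v))) (at (0::real))"
      by (rule has_derivative_compose[OF has_derivative_line \<psi>d'])
    then have cder: "((\<lambda>t. \<psi> (u + t *\<^sub>R v)) has_vector_derivative d) (at 0)"
      by (simp add: has_vector_derivative_def d_def linear_cmul[OF has_derivative_linear[OF \<psi>d]])
    have "filterlim (\<lambda>t::real. u + t *\<^sub>R v) (nhds u) (nhds 0)"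
      using tendsto_nhds_if_isCont[OF has_derivative_continuous[OF has_derivative_line[of u v 0]]] by simp
    from eventually_compose_filterlim[OF eventually_nhds_in_open[OF U(1,2)] this]
    have "\<forall>\<^sub>F t in nhds (0::real). \<psi> (u + t *\<^sub>R v) \<in> M"
      by eventually_elim (use \<psi>(1) in blast)
    from chart.curve_tangent[OF ch _ this cder] show ?thesis by (simp add: x_def)
  qed
  have "D\<psi> v = D (D\<psi> v, v)"
  proof -
    have i: "((\<lambda>w. (\<psi> w, w)) has_derivative (\<lambda>h. (D\<psi> h, h))) (at u)"
      by (intro has_derivative_Pair \<psi>d has_derivative_ident)
    have D': "((\<lambda>z. pg_map f g \<alpha> (fst z) (snd z)) has_derivative D) (at (\<psi> u, u))"
      using D(1) by (simp add: x_def)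
    have "((\<lambda>w. pg_map f g \<alpha> (\<psi> w) w) has_derivative (\<lambda>h. D (D\<psi> h, h))) (at u)"
      using has_derivative_compose[OF i D'] by simp
    then have "(\<psi> has_derivative (\<lambda>h. D (D\<psi> h, h))) (at u)"
      by (rule has_derivative_transform_within_open[OF _ U(1,2) fp])
    from fun_cong[OF has_derivative_unique[OF \<psi>d this], of v] show ?thesis .
  qed
  also have "\<dots> = D (D\<psi> v, 0) + D (0, v)"
    using linear_add[OF has_derivative_linear[OF D(1)], of "(D\<psi> v, 0)" "(0, v)"] by simp
  finally have "d = P (J d) + D (0, v)" by (simp only: d_def K)
  then have dK: "d - P (J d) = D (0, v)" by (metis add_diff_cancel_left')
  have "R (d, d) = (D (0, v), 0)"
    unfolding R pj.inertial_def fst_conv snd_conv closest_point_self[OF dT]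
    using dK by (simp add: scaleR_left_distrib)
  also have "\<dots> = frechet_derivative (\<lambda>u'. apg_map f g \<alpha> \<beta> z u') (at u) v"
    using frechet_derivative_at[OF Du] by (metis (no_types))
  finally have "inv R (frechet_derivative (\<lambda>u'. apg_map f g \<alpha> \<beta> z u') (at u) v) = (d, d)"
    using bij by (metis bij_is_inj inv_f_f)
  then show "(frechet_derivative \<psi> (at u) v, frechet_derivative \<psi> (at u) v)
      = inv R (frechet_derivative (\<lambda>u'. apg_map f g \<alpha> \<beta> z u') (at u) v)"
    by (simp add: d_def D\<psi>_def)
qed

end

theorem mainTheorem2:
  fixes f :: "'x::euclidean_space \<times> 'u::euclidean_space \<Rightarrow> real"
    and g :: "'x \<times> 'u \<Rightarrow> ereal"
    and M :: "'x set" and \<Omega> :: "'u set"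
    and L \<alpha>lo \<alpha>hi \<alpha> \<beta> :: real
    and xs :: 'x and us :: 'u
  assumes "C2_submanifold M" and "open \<Omega>"
    and "0 < L" and "0 < \<alpha>lo" and "\<alpha>lo \<le> \<alpha>hi" and "\<alpha>hi < 2 / L"
    and "CPSO f g M \<Omega> L"
    and "(xs, us) \<in> M \<times> \<Omega>"
    and "RPD_ii f M xs us"
    and "ND f g xs us"
    and "\<alpha> \<in> {\<alpha>lo..\<alpha>hi}" and "\<beta> \<in> {0..1}"
    and "- (1 / (1 + 2 * \<beta>)) < lambda_min (frechet_derivative (\<lambda>x. pg_map f g \<alpha> x us) (at xs))"
  shows "((\<lambda>z. apg_map f g \<alpha> \<beta> z us) differentiable at (xs, xs) \<and>
      spectral_radius (frechet_derivative (\<lambda>z. apg_map f g \<alpha> \<beta> z us) (at (xs, xs))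
        \<circ> proj2 M (xs, xs)) < 1) \<and>
    (RPD_i f g M xs us \<longrightarrow>
      (\<forall>U \<psi>. local_solution_map f g M \<Omega> xs us U \<psi> \<longrightarrow>
        (\<exists>U'. open U' \<and> us \<in> U' \<and> U' \<subseteq> U \<and>
          (\<forall>u\<in>U'. let z = (\<psi> u, \<psi> u);
                      Dz = frechet_derivative (\<lambda>z'. apg_map f g \<alpha> \<beta> z' u) (at z);
                      Du = frechet_derivative (\<lambda>u'. apg_map f g \<alpha> \<beta> z u') (at u);
                      D\<psi> = frechet_derivative \<psi> (at u);
                      R = (\<lambda>w. w - Dz (proj2 M z w))
            in z = apg_map f g \<alpha> \<beta> z u \<and>
               (\<lambda>z'. apg_map f g \<alpha> \<beta> z' u) differentiable at z \<and>
               (\<lambda>u'. apg_map f g \<alpha> \<beta> z u') differentiable at u \<and>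
               bij R \<and>
               (\<forall>v. (D\<psi> v, D\<psi> v) = inv R (Du v))))))"
proof -
  have C2: "C2_on f UNIV" and ps: "partly_smooth g (M \<times> \<Omega>)"
    and cp: "\<And>u. u \<in> \<Omega> \<Longrightarrow> convex_on UNIV (\<lambda>x. f (x, u))" "\<And>u. u \<in> \<Omega> \<Longrightarrow> convex (epi (\<lambda>x. g (x, u)))"
      "\<And>u. u \<in> \<Omega> \<Longrightarrow> L-lipschitz_on UNIV (grad (\<lambda>x. f (x, u)))"
    using assms(7) unfolding CPSO_def by simp_all
  obtain G G' where G: "\<And>x u. GDERIV (\<lambda>y. f (y, u)) x :> G (x, u)"
    "\<And>z. (G has_derivative blinfun_apply (G' z)) (at z)" "continuous_on UNIV G'"
    by (rule partial_gradient_C1[OF C2]) (rule that; assumption)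
  have \<alpha>: "0 < \<alpha>" "\<alpha> < 2 / L" using assms(4,6,11) by auto
  then have \<alpha>L: "\<alpha> * L < 2" using assms(3) by (simp add: field_simps)
  interpret parametric_optimization g M \<Omega> f G G' L \<alpha>
    by unfold_locales (rule assms(1,2) ps cp G \<alpha>(1) \<alpha>L; assumption?)+
  have xs: "xs \<in> M" "us \<in> \<Omega>" and \<beta>: "0 \<le> \<beta>" "\<beta> \<le> 1" using assms(8,12) by auto
  show ?thesis
  proof (intro conjI impI allI, goal_cases)
    case 1
    show ?case by (rule spectral_radius_apg_map(1)[OF xs assms(10,9) \<beta> assms(13)])
  next
    case 2
    show ?case by (rule spectral_radius_apg_map(2)[OF xs assms(10,9) \<beta> assms(13)])
  next
    case (3 U \<psi>)
    have U: "open U" "us \<in> U" "U \<subseteq> \<Omega>" and C1: "C1_on \<psi> U" and \<psi>M: "\<psi> ` U \<subseteq> M" and \<psi>us: "\<psi> us = xs"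
      and nd: "\<And>w. w \<in> U \<Longrightarrow> ND f g (\<psi> w) w"
      using 3 unfolding local_solution_map_def by simp_all
    \<comment> \<open>ND along \<psi> is part of \<open>local_solution_map\<close>; RPD-ii is given
      at the base point and has to be carried over to nearby parameters.\<close>
    have "RPD_ii f M (\<psi> us) us" using assms(9) \<psi>us by simp
    then have "\<forall>\<^sub>F u in nhds us. u \<in> U \<longrightarrow> RPD_ii f M (\<psi> u) u"
      by (rule RPD_ii_eventually[OF U(1,2) C1_onD(3)[OF C1] \<psi>M])
    then obtain U0 where U0: "open U0" "us \<in> U0" "\<And>u. u \<in> U0 \<Longrightarrow> u \<in> U \<Longrightarrow> RPD_ii f M (\<psi> u) u"
      unfolding eventually_nhds by blast
    show ?case
    proof (intro exI[of _ "U0 \<inter> U"] conjI ballI, goal_cases)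
      case (4 u)
      then have "u \<in> U" and rpd: "RPD_ii f M (\<psi> u) u" using U0(3) by auto
      note impl = implicit_derivative_apg_map[OF U(1) \<open>u \<in> U\<close> U(3) \<psi>M C1_onD(2)[OF C1 \<open>u \<in> U\<close>] nd rpd, where \<beta>=\<beta>]
      show ?case unfolding Let_def by (intro conjI allI impl)
    qed (use U U0 in auto)
  qed
qed

end
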